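(* Let $\mathcal{N}$ be a von Neumann algebra with a faithful normal trace $tr$, normalized by $tr(1)=1$, let $\theta$ be a trace preserving ergodic automorphism of $\mathcal{N}$ defining an action $\alpha_n=\theta^n$ of $\mathbb{Z}$ on $\mathcal{N}$, let $u$ be the unitary in $\mathcal{M}=\mathcal{N}\rtimes_\alpha\mathbb{Z}$ which implements $\theta$, and let $\mathcal{B}$ be the abelian von Neumann algebra generated by $u$. Then $\mathbb{E}_{\mathcal{B}}$ is an asymptotic homomorphism with respect to $u$ if and only if $\theta$ is strongly mixing. In particular, $\mathcal{B}$ is a strongly singular masa in $\mathcal{M}$ when $\theta$ is strongly mixing.
   Context: The crossed product $\mathcal{M}=\mathcal{N}\rtimes_\alpha\mathbb{Z}$ is represented on $L^2(\mathcal{N},tr)\otimes\ell^2(\mathbb{Z})$; there are a representation $\pi$ of $\mathcal{N}$ and a unitary $u$ on this space with $\pi(\theta^n(x))=u^n\pi(x)u^{-n}$ ($x\in\mathcal{N}$, $n\in\mathbb{Z}$), and $\mathcal{M}$ is generated by $\pi(\mathcal{N})$ and $u$. Elements of $\mathcal{M}$ are uniquely of the form $\sum_{n}\pi(x_n)u^n$, and $\mathcal{M}$ carries the faithful normal trace $tr(\sum_n\pi(x_n)u^n)=tr(x_0)$. The automorphism $\theta$ (or the action) is ergodic if for each $n\ne0$ the only fixed points of $\theta^n$ are multiples of the identity. It is strongly mixing if $\lim_{n\to\infty}tr(x\theta^n(y))=tr(x)tr(y)$ for all $x,y\in\mathcal{N}$. Put $\|x\|_2=(tr(x^*x))^{1/2}$,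 and for a linear map $\phi:\mathcal{M}\to\mathcal{M}$ put $\|\phi\|_{\infty,2}=\sup\{\|\phi(x)\|_2:\|x\|\le1\}$. For a von Neumann subalgebra $\mathcal{A}\subseteq\mathcal{M}$, $\mathbb{E}_{\mathcal{A}}$ is the unique trace preserving conditional expectation of $\mathcal{M}$ onto $\mathcal{A}$. For an abelian von Neumann subalgebra $\mathcal{A}$ and a unitary $v\in\mathcal{A}$, $\mathbb{E}_{\mathcal{A}}$ is an asymptotic homomorphism with respect to $v$ if $\lim_{|n|\to\infty}\|\mathbb{E}_{\mathcal{A}}(xv^ny)-\mathbb{E}_{\mathcal{A}}(x)v^n\mathbb{E}_{\mathcal{A}}(y)\|_2=0$ for all $x,y\in\mathcal{M}$. $\mathcal{A}$ is strongly singular in $\mathcal{M}$ if $\|\mathbb{E}_{\mathcal{A}}-\mathbb{E}_{w\mathcal{A}w^*}\|_{\infty,2}\ge\|(I-\mathbb{E}_{\mathcal{A}})(w)\|_2$ for all unitaries $w\in\mathcal{M}$. A masa is a maximal abelian self-adjoint subalgebra. *)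

theory Defs
  imports "HOL-Analysis.Analysis"
begin

section \<open>Complex Hilbert spaces\<close>

class complex_vector = real_vector +
  fixes scaleC :: "complex \<Rightarrow> 'a \<Rightarrow> 'a" (infixr "*\<^sub>C" 75)
  assumes scaleC_add_right: "c *\<^sub>C (x + y) = c *\<^sub>C x + c *\<^sub>C y"
    and scaleC_add_left: "(c + d) *\<^sub>C x = c *\<^sub>C x + d *\<^sub>C x"
    and scaleC_scaleC: "c *\<^sub>C d *\<^sub>C x = (c * d) *\<^sub>C x"
    and scaleR_scaleC: "r *\<^sub>R x = complex_of_real r *\<^sub>C x"

text \<open>The inner product is linear in the first and conjugate linear in the second argument.\<close>

class complex_hilbert = complex_vector + banach +
  fixes cinner :: "'a \<Rightarrow> 'a \<Rightarrow> complex"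
  assumes cinner_commute: "cinner x y = cnj (cinner y x)"
    and cinner_add_left: "cinner (x + y) z = cinner x z + cinner y z"
    and cinner_scaleC_left: "cinner (c *\<^sub>C x) y = c * cinner x y"
    and norm_eq_sqrt_cinner: "norm x = sqrt (Re (cinner x x))"

instantiation complex :: complex_hilbert
begin
definition "scaleC_complex (c::complex) (x::complex) = c * x"
definition "cinner_complex (x::complex) (y::complex) = x * cnj y"
instance
  by standard (auto simp: scaleC_complex_def cinner_complex_def algebra_simps
      scaleR_conv_of_real cmod_def power2_eq_square)
end

lemma scaleC_one [simp]: "1 *\<^sub>C x = (x::'a::complex_vector)"
  using scaleR_scaleC[of 1 x] by simp

lemma scaleC_zero_left [simp]: "0 *\<^sub>C x = (0::'a::complex_vector)"
  using scaleR_scaleC[of 0 x] by simp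

lemma scaleC_zero_right [simp]: "c *\<^sub>C 0 = (0::'a::complex_vector)"
  using scaleC_add_right[of c 0 0] by simp

lemma scaleC_minus1 [simp]: "(-1) *\<^sub>C x = - (x::'a::complex_vector)"
  using scaleR_scaleC[of "-1" x] by simp

lemma scaleC_minus_right: "c *\<^sub>C (- x) = - (c *\<^sub>C (x::'a::complex_vector))"
  using scaleC_add_right[of c x "-x"] by (simp add: eq_neg_iff_add_eq_0 add.commute)

lemma scaleC_diff_right: "c *\<^sub>C (x - y) = c *\<^sub>C x - c *\<^sub>C (y::'a::complex_vector)"
  using scaleC_add_right[of c x "-y"] by (simp add: scaleC_minus_right)

lemma scaleC_scaleR_commute: "c *\<^sub>C r *\<^sub>R x = r *\<^sub>R c *\<^sub>C (x::'a::complex_vector)"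
  by (simp add: scaleR_scaleC scaleC_scaleC mult.commute)

lemma cinner_add_right: "cinner x (y + z) = cinner x y + cinner x (z::'a::complex_hilbert)"
  by (metis cinner_add_left cinner_commute complex_cnj_add)

lemma cinner_scaleC_right: "cinner x (c *\<^sub>C y) = cnj c * cinner x (y::'a::complex_hilbert)"
  by (metis cinner_commute cinner_scaleC_left complex_cnj_mult)

lemma cinner_zero_left [simp]: "cinner 0 (x::'a::complex_hilbert) = 0"
  using cinner_scaleC_left[of 0 x x] by simp

lemma cinner_zero_right [simp]: "cinner (x::'a::complex_hilbert) 0 = 0"
  using cinner_scaleC_right[of x 0 x] by simp

lemma cinner_minus_left: "cinner (- x) y = - cinner x (y::'a::complex_hilbert)"
  using cinner_scaleC_left[of "-1" x y] by simp

lemma cinner_minus_right: "cinner x (- y) = - cinner x (y::'a::complex_hilbert)"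
  using cinner_scaleC_right[of x "-1" y] by simp

lemma cinner_diff_left: "cinner (x - y) z = cinner x z - cinner y (z::'a::complex_hilbert)"
  using cinner_add_left[of x "-y" z] by (simp add: cinner_minus_left)

lemma cinner_diff_right: "cinner x (y - z) = cinner x y - cinner x (z::'a::complex_hilbert)"
  using cinner_add_right[of x y "-z"] by (simp add: cinner_minus_right)

lemma cinner_self: "cinner x x = complex_of_real ((norm (x::'a::complex_hilbert))\<^sup>2)"
proof -
  have "Im (cinner x x) = 0"
    by (metis cinner_commute complex_cnj_cancel_iff cnj.simps(2) neg_equal_zero)
  moreover have "0 \<le> Re (cinner x x)"
    using norm_ge_zero[of x] unfolding norm_eq_sqrt_cinner by (simp add: real_sqrt_ge_0_iff)
  then have "Re (cinner x x) = (norm x)\<^sup>2"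
    unfolding norm_eq_sqrt_cinner by simp
  ultimately show ?thesis by (simp add: complex_eq_iff)
qed

lemma norm_scaleC: "norm (c *\<^sub>C x) = cmod c * norm (x::'a::complex_hilbert)"
proof -
  have "complex_of_real ((norm (c *\<^sub>C x))\<^sup>2) = complex_of_real ((cmod c * norm x)\<^sup>2)"
    unfolding cinner_self[symmetric] cinner_scaleC_left cinner_scaleC_right
    by (simp add: cinner_self power_mult_distrib complex_norm_square mult.assoc[symmetric]
        mult.commute[of "cnj c"] del: of_real_power)
  then have "(norm (c *\<^sub>C x))\<^sup>2 = (cmod c * norm x)\<^sup>2"
    using of_real_eq_iff by blast
  then show ?thesis by simp
qed

lemma norm_diff_square:
  "(norm (x - y))\<^sup>2 = (norm x)\<^sup>2 - 2 * Re (cinner x y) + (norm (y::'a::complex_hilbert))\<^sup>2"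
proof -
  have "complex_of_real ((norm (x - y))\<^sup>2)
      = complex_of_real ((norm x)\<^sup>2) - (cinner x y + cnj (cinner x y)) + complex_of_real ((norm y)\<^sup>2)"
    unfolding cinner_self[symmetric] cinner_diff_left cinner_diff_right
    by (simp add: cinner_commute[of y x])
  from arg_cong[OF this, of Re] show ?thesis by simp
qed

lemma cinner_Cauchy_Schwarz: "cmod (cinner x y) \<le> norm x * norm (y::'a::complex_hilbert)"
proof (cases "y = 0")
  case False
  define c where "c = cinner x y / complex_of_real ((norm y)\<^sup>2)"
  have n: "(norm y)\<^sup>2 > 0" using False by simp
  have "0 \<le> (norm (x - c *\<^sub>C y))\<^sup>2" by simp
  also have "\<dots> = (norm x)\<^sup>2 - 2 * Re (cnj c * cinner x y) + (cmod c * norm y)\<^sup>2"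
    unfolding norm_diff_square by (simp add: cinner_scaleC_right norm_scaleC)
  also have "cnj c * cinner x y = complex_of_real ((cmod (cinner x y))\<^sup>2 / (norm y)\<^sup>2)"
    unfolding c_def using complex_norm_square[of "cinner x y"] by (simp add: mult.commute)
  also have "(cmod c * norm y)\<^sup>2 = (cmod (cinner x y))\<^sup>2 / (norm y)\<^sup>2"
    unfolding c_def using n
    by (simp add: norm_divide power_mult_distrib power_divide norm_power del: of_real_power)
      (simp add: power2_eq_square power4_eq_xxxx)
  finally have "(cmod (cinner x y))\<^sup>2 / (norm y)\<^sup>2 \<le> (norm x)\<^sup>2" by simp
  then have "(cmod (cinner x y))\<^sup>2 \<le> (norm x * norm y)\<^sup>2"
    using n by (simp add: divide_le_eq power_mult_distrib)
  then show ?thesis by (rule power2_le_imp_le) simp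
qed simp

section \<open>Bounded complex linear operators\<close>

typedef (overloaded) 'a bop =
  "{f :: 'a::complex_hilbert \<Rightarrow> 'a. bounded_linear f \<and> (\<forall>c x. f (c *\<^sub>C x) = c *\<^sub>C f x)}"
  morphisms app Bop
  by (rule exI[of _ "\<lambda>x. x"]) simp

setup_lifting type_definition_bop

instantiation bop :: (complex_hilbert) "{real_normed_vector, complex_vector}"
begin

lift_definition norm_bop :: "'a bop \<Rightarrow> real" is onorm .

lift_definition minus_bop :: "'a bop \<Rightarrow> 'a bop \<Rightarrow> 'a bop" is "\<lambda>f g x. f x - g x"
  by (simp add: bounded_linear_sub scaleC_diff_right)

definition dist_bop :: "'a bop \<Rightarrow> 'a bop \<Rightarrow> real"
  where "dist_bop a b = norm (a - b)"

definition [code del]: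
  "(uniformity :: ('a bop \<times> 'a bop) filter) = (INF e\<in>{0 <..}. principal {(x, y). dist x y < e})"

definition open_bop :: "'a bop set \<Rightarrow> bool"
  where [code del]: "open_bop S = (\<forall>x\<in>S. \<forall>\<^sub>F (x', y) in uniformity. x' = x \<longrightarrow> y \<in> S)"

lift_definition uminus_bop :: "'a bop \<Rightarrow> 'a bop" is "\<lambda>f x. - f x"
  by (simp add: bounded_linear_minus scaleC_minus_right)

lift_definition zero_bop :: "'a bop" is "\<lambda>x. 0"
  by simp

lift_definition plus_bop :: "'a bop \<Rightarrow> 'a bop \<Rightarrow> 'a bop" is "\<lambda>f g x. f x + g x"
  by (simp add: bounded_linear_add scaleC_add_right)

lift_definition scaleR_bop :: "real \<Rightarrow> 'a bop \<Rightarrow> 'a bop" is "\<lambda>r f x. r *\<^sub>R f x"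
  by (simp add: bounded_linear_const_scaleR scaleC_scaleR_commute)

lemma bounded_linear_scaleC: "bounded_linear (\<lambda>x::'a. c *\<^sub>C x)"
  by (rule bounded_linear_intro[of _ "cmod c"])
    (simp_all add: scaleC_add_right scaleC_scaleR_commute norm_scaleC mult.commute)

lift_definition scaleC_bop :: "complex \<Rightarrow> 'a bop \<Rightarrow> 'a bop" is "\<lambda>c f x. c *\<^sub>C f x"
  by (auto intro: bounded_linear_compose[OF bounded_linear_scaleC] simp: scaleC_scaleC mult.commute)

definition sgn_bop :: "'a bop \<Rightarrow> 'a bop"
  where "sgn_bop x = scaleR (inverse (norm x)) x"

instance
  apply standard
  unfolding dist_bop_def open_bop_def sgn_bop_def uniformity_bop_def
  apply (rule refl
      | (transfer, (rule ext)?, (elim conjE)?, simp add: onorm_triangle onorm_scaleR onorm_eq_0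
          algebra_simps fun_eq_iff scaleC_add_right scaleC_add_left scaleC_scaleC; fail)
      | (transfer, rule ext, rule scaleR_scaleC))+
  done

end

instantiation bop :: (complex_hilbert) "{ring, monoid_mult}"
begin

lift_definition one_bop :: "'a bop" is "\<lambda>x. x" by simp

lift_definition times_bop :: "'a bop \<Rightarrow> 'a bop \<Rightarrow> 'a bop" is "\<lambda>f g x. f (g x)"
  by (auto intro: bounded_linear_compose)

instance
  by standard (transfer, auto simp: linear_add bounded_linear.linear)+

end

text \<open>The adjoint exists by the Riesz representation theorem, see \<open>cinner_adj_right\<close> below.\<close>

definition adj :: "'a::complex_hilbert bop \<Rightarrow> 'a bop" where
  "adj T = (THE S. \<forall>\<xi> \<eta>. cinner (app T \<xi>) \<eta> = cinner \<xi> (app S \<eta>))"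

definition pos_op :: "'a::complex_hilbert bop \<Rightarrow> bool" where
  "pos_op T \<longleftrightarrow> (\<forall>\<xi>. cinner (app T \<xi>) \<xi> \<in> \<real>\<^sub>\<ge>\<^sub>0)"

definition op_le :: "'a::complex_hilbert bop \<Rightarrow> 'a bop \<Rightarrow> bool" where
  "op_le S T \<longleftrightarrow> pos_op (T - S)"

definition unitary_op :: "'a::complex_hilbert bop \<Rightarrow> bool" where
  "unitary_op v \<longleftrightarrow> adj v * v = 1 \<and> v * adj v = 1"

definition upower :: "'a::complex_hilbert bop \<Rightarrow> int \<Rightarrow> 'a bop" where
  "upower v n = (if n \<ge> 0 then v ^ nat n else adj v ^ nat (- n))"

definition clinear_on :: "'a::complex_vector set \<Rightarrow> ('a \<Rightarrow> 'b::complex_vector) \<Rightarrow> bool" where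
  "clinear_on A f \<longleftrightarrow> (\<forall>x\<in>A. \<forall>y\<in>A. f (x + y) = f x + f y) \<and> (\<forall>c. \<forall>x\<in>A. f (c *\<^sub>C x) = c *\<^sub>C f x)"

section \<open>Von Neumann algebras, traces and automorphisms\<close>

definition commutant :: "'a::complex_hilbert bop set \<Rightarrow> 'a bop set" where
  "commutant S = {x. \<forall>s\<in>S. x * s = s * x}"

definition von_neumann_algebra :: "'a::complex_hilbert bop set \<Rightarrow> bool" where
  "von_neumann_algebra A \<longleftrightarrow> adj ` A \<subseteq> A \<and> commutant (commutant A) = A"

text \<open>Normality: suprema of bounded increasing nets (here: directed sets) of positive elements are
  preserved.\<close>

definition normal_on :: "'a::complex_hilbert bop set \<Rightarrow> ('a bop \<Rightarrow> complex) \<Rightarrow> bool" where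
  "normal_on A \<phi> \<longleftrightarrow>
    (\<forall>D s. D \<noteq> {} \<and> D \<subseteq> {a \<in> A. pos_op a} \<and> (\<forall>a\<in>D. \<forall>b\<in>D. \<exists>c\<in>D. op_le a c \<and> op_le b c) \<and>
       s \<in> A \<and> (\<forall>a\<in>D. op_le a s) \<and> (\<forall>t\<in>A. (\<forall>a\<in>D. op_le a t) \<longrightarrow> op_le s t)
     \<longrightarrow> Re (\<phi> s) = (SUP a\<in>D. Re (\<phi> a)))"

definition faithful_normal_trace :: "'a::complex_hilbert bop set \<Rightarrow> ('a bop \<Rightarrow> complex) \<Rightarrow> bool" where
  "faithful_normal_trace A tr \<longleftrightarrow> clinear_on A tr
     \<and> (\<forall>x\<in>A. pos_op x \<longrightarrow> tr x \<in> \<real>\<^sub>\<ge>\<^sub>0)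
     \<and> (\<forall>x\<in>A. tr (adj x * x) = 0 \<longrightarrow> x = 0)
     \<and> (\<forall>x\<in>A. \<forall>y\<in>A. tr (x * y) = tr (y * x))
     \<and> normal_on A tr \<and> tr 1 = 1"

definition automorphism :: "'a::complex_hilbert bop set \<Rightarrow> ('a bop \<Rightarrow> 'a bop) \<Rightarrow> bool" where
  "automorphism A \<theta> \<longleftrightarrow> bij_betw \<theta> A A \<and> clinear_on A \<theta>
     \<and> (\<forall>x\<in>A. \<forall>y\<in>A. \<theta> (x * y) = \<theta> x * \<theta> y) \<and> (\<forall>x\<in>A. \<theta> (adj x) = adj (\<theta> x))"

definition autpow :: "'a set \<Rightarrow> ('a \<Rightarrow> 'a) \<Rightarrow> int \<Rightarrow> 'a \<Rightarrow> 'a" where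
  "autpow A \<theta> n = (if n \<ge> 0 then \<theta> ^^ nat n else inv_into A \<theta> ^^ nat (- n))"

definition trace_preserving :: "'a set \<Rightarrow> ('a \<Rightarrow> complex) \<Rightarrow> ('a \<Rightarrow> 'a) \<Rightarrow> bool" where
  "trace_preserving A tr \<theta> \<longleftrightarrow> (\<forall>x\<in>A. tr (\<theta> x) = tr x)"

definition ergodic :: "'a::complex_hilbert bop set \<Rightarrow> ('a bop \<Rightarrow> 'a bop) \<Rightarrow> bool" where
  "ergodic A \<theta> \<longleftrightarrow> (\<forall>n. n \<noteq> 0 \<longrightarrow> (\<forall>x\<in>A. autpow A \<theta> n x = x \<longrightarrow> (\<exists>c. x = c *\<^sub>C 1)))"

definition strongly_mixing ::
    "'a::complex_hilbert bop set \<Rightarrow> ('a bop \<Rightarrow> complex) \<Rightarrow> ('a bop \<Rightarrow> 'a bop) \<Rightarrow> bool" where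
  "strongly_mixing A tr \<theta> \<longleftrightarrow>
     (\<forall>x\<in>A. \<forall>y\<in>A. (\<lambda>n. tr (x * (\<theta> ^^ n) y)) \<longlonglongrightarrow> tr x * tr y)"

section \<open>Finite von Neumann algebras and their subalgebras\<close>

text \<open>Throughout this section \<open>M\<close> is a von Neumann algebra with trace \<open>\<tau>\<close>, and \<open>A\<close> is a von
  Neumann subalgebra of it.\<close>

definition norm2 :: "('a::complex_hilbert bop \<Rightarrow> complex) \<Rightarrow> 'a bop \<Rightarrow> real" where
  "norm2 \<tau> x = sqrt (Re (\<tau> (adj x * x)))"

text \<open>The supremum is taken in the extended reals, as it may be infinite for an unbounded \<open>\<phi>\<close>.\<close>

definition norm_inf2 ::
    "'a::complex_hilbert bop set \<Rightarrow> ('a bop \<Rightarrow> complex) \<Rightarrow> ('a bop \<Rightarrow> 'a bop) \<Rightarrow> ereal" where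
  "norm_inf2 M \<tau> \<phi> = (SUP x\<in>{x \<in> M. norm x \<le> 1}. ereal (norm2 \<tau> (\<phi> x)))"

definition conditional_expectation ::
    "'a::complex_hilbert bop set \<Rightarrow> 'a bop set \<Rightarrow> ('a bop \<Rightarrow> 'a bop) \<Rightarrow> bool" where
  "conditional_expectation M A E \<longleftrightarrow> E ` M \<subseteq> A \<and> clinear_on M E \<and> (\<forall>a\<in>A. E a = a)
     \<and> (\<forall>x\<in>M. pos_op x \<longrightarrow> pos_op (E x))
     \<and> (\<forall>x\<in>M. \<forall>a\<in>A. \<forall>b\<in>A. E (a * x * b) = a * E x * b)"

text \<open>Restricting to \<^term>\<open>extensional M\<close> makes the trace preserving conditional expectation
  unique as a HOL function, since its values outside \<open>M\<close> are then fixed.\<close>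

definition cond_exp ::
    "'a::complex_hilbert bop set \<Rightarrow> ('a bop \<Rightarrow> complex) \<Rightarrow> 'a bop set \<Rightarrow> 'a bop \<Rightarrow> 'a bop" where
  "cond_exp M \<tau> A = (THE E. E \<in> extensional M \<and> conditional_expectation M A E
     \<and> (\<forall>x\<in>M. \<tau> (E x) = \<tau> x))"

text \<open>The filter \<^term>\<open>filtercomap abs at_top :: int filter\<close> expresses \<open>\<bar>n\<bar> \<longrightarrow> \<infinity>\<close>.\<close>

definition asymptotic_homomorphism ::
    "'a::complex_hilbert bop set \<Rightarrow> ('a bop \<Rightarrow> complex) \<Rightarrow> 'a bop set \<Rightarrow> 'a bop \<Rightarrow> bool" where
  "asymptotic_homomorphism M \<tau> A v \<longleftrightarrow> (\<forall>x\<in>M. \<forall>y\<in>M.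
     ((\<lambda>n. norm2 \<tau> (cond_exp M \<tau> A (x * upower v n * y)
                     - cond_exp M \<tau> A x * upower v n * cond_exp M \<tau> A y)) \<longlongrightarrow> 0)
       (filtercomap abs at_top))"

definition strongly_singular ::
    "'a::complex_hilbert bop set \<Rightarrow> ('a bop \<Rightarrow> complex) \<Rightarrow> 'a bop set \<Rightarrow> bool" where
  "strongly_singular M \<tau> A \<longleftrightarrow> (\<forall>w\<in>M. unitary_op w \<longrightarrow>
     norm_inf2 M \<tau> (\<lambda>x. cond_exp M \<tau> A x - cond_exp M \<tau> ((\<lambda>a. w * a * adj w) ` A) x)
       \<ge> ereal (norm2 \<tau> (w - cond_exp M \<tau> A w)))"

definition abelian :: "'a::complex_hilbert bop set \<Rightarrow> bool" where
  "abelian A \<longleftrightarrow> (\<forall>x\<in>A. \<forall>y\<in>A. x * y = y * x)"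

definition selfadjoint_subalgebra :: "'a::complex_hilbert bop set \<Rightarrow> bool" where
  "selfadjoint_subalgebra A \<longleftrightarrow> 0 \<in> A \<and> (\<forall>x\<in>A. \<forall>y\<in>A. x + y \<in> A \<and> x * y \<in> A)
     \<and> (\<forall>c. \<forall>x\<in>A. c *\<^sub>C x \<in> A) \<and> (\<forall>x\<in>A. adj x \<in> A)"

definition masa :: "'a::complex_hilbert bop set \<Rightarrow> 'a bop set \<Rightarrow> bool" where
  "masa M A \<longleftrightarrow> selfadjoint_subalgebra A \<and> abelian A \<and> A \<subseteq> M
     \<and> (\<forall>C. selfadjoint_subalgebra C \<and> abelian C \<and> C \<subseteq> M \<and> A \<subseteq> C \<longrightarrow> C = A)"

section \<open>The Hilbert space of square summable two-sided sequences\<close>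

text \<open>For a Hilbert space \<open>H\<close>, the type of square summable functions from the integers to \<open>H\<close> is
  the Hilbert space tensor product of \<open>H\<close> with the scalar space of square summable sequences.\<close>

typedef (overloaded) 'a ell2Z =
  "{f :: int \<Rightarrow> 'a::complex_hilbert. (\<lambda>n. (norm (f n))\<^sup>2) summable_on UNIV}"
  morphisms coord Ell2Z
  by (rule exI[of _ "\<lambda>_. 0"]) simp

setup_lifting type_definition_ell2Z

lemma sq_summableI:
  fixes f :: "int \<Rightarrow> 'a::real_normed_vector"
  assumes "\<And>F. finite F \<Longrightarrow> L2_set (\<lambda>n. norm (f n)) F \<le> B"
  shows "(\<lambda>n. (norm (f n))\<^sup>2) summable_on UNIV"
proof (rule nonneg_bdd_above_summable_on)
  show "bdd_above (sum (\<lambda>n. (norm (f n))\<^sup>2) ` {F. F \<subseteq> UNIV \<and> finite F})"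
  proof (rule bdd_aboveI2)
    fix F :: "int set" assume "F \<in> {F. F \<subseteq> UNIV \<and> finite F}"
    then have "L2_set (\<lambda>n. norm (f n)) F \<le> B" using assms by simp
    moreover have "0 \<le> L2_set (\<lambda>n. norm (f n)) F" by (rule L2_set_nonneg)
    ultimately have "(L2_set (\<lambda>n. norm (f n)) F)\<^sup>2 \<le> B\<^sup>2" by (rule power_mono)
    then show "(\<Sum>n\<in>F. (norm (f n))\<^sup>2) \<le> B\<^sup>2"
      by (simp add: L2_set_def sum_nonneg)
  qed
qed simp

lemma L2_set_le_sqrt_infsum:
  fixes f :: "int \<Rightarrow> 'a::real_normed_vector"
  assumes "(\<lambda>n. (norm (f n))\<^sup>2) summable_on UNIV" "finite F"
  shows "L2_set (\<lambda>n. norm (f n)) F \<le> sqrt (\<Sum>\<^sub>\<infinity>n. (norm (f n))\<^sup>2)"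
  unfolding L2_set_def by (intro real_sqrt_le_mono finite_sum_le_infsum assms) auto

lemma sqrt_infsum_le:
  fixes f :: "int \<Rightarrow> 'a::real_normed_vector"
  assumes "\<And>F. finite F \<Longrightarrow> L2_set (\<lambda>n. norm (f n)) F \<le> B"
  shows "sqrt (\<Sum>\<^sub>\<infinity>n. (norm (f n))\<^sup>2) \<le> B"
proof (rule real_le_lsqrt)
  show B: "0 \<le> B" using assms[of "{}"] by simp
  show "(\<Sum>\<^sub>\<infinity>n. (norm (f n))\<^sup>2) \<le> B\<^sup>2"
  proof (rule infsum_le_finite_sums[OF sq_summableI[OF assms]])
    fix F :: "int set" assume "finite F"
    then have "sqrt (\<Sum>n\<in>F. (norm (f n))\<^sup>2) \<le> B" using assms[of F] by (simp add: L2_set_def)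
    then show "(\<Sum>n\<in>F. (norm (f n))\<^sup>2) \<le> B\<^sup>2" by (simp add: sqrt_le_D)
  qed
qed

lemma L2_set_add_le:
  fixes f g :: "int \<Rightarrow> 'a::real_normed_vector"
  assumes f: "(\<lambda>n. (norm (f n))\<^sup>2) summable_on UNIV" and g: "(\<lambda>n. (norm (g n))\<^sup>2) summable_on UNIV"
    and F: "finite F"
  shows "L2_set (\<lambda>n. norm (f n + g n)) F
           \<le> sqrt (\<Sum>\<^sub>\<infinity>n. (norm (f n))\<^sup>2) + sqrt (\<Sum>\<^sub>\<infinity>n. (norm (g n))\<^sup>2)"
proof -
  have "L2_set (\<lambda>n. norm (f n + g n)) F \<le> L2_set (\<lambda>n. norm (f n) + norm (g n)) F"
    by (rule L2_set_mono) (auto intro: norm_triangle_ineq)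
  also have "\<dots> \<le> L2_set (\<lambda>n. norm (f n)) F + L2_set (\<lambda>n. norm (g n)) F"
    by (rule L2_set_triangle_ineq)
  also have "\<dots> \<le> sqrt (\<Sum>\<^sub>\<infinity>n. (norm (f n))\<^sup>2) + sqrt (\<Sum>\<^sub>\<infinity>n. (norm (g n))\<^sup>2)"
    by (intro add_mono L2_set_le_sqrt_infsum assms)
  finally show ?thesis .
qed

instantiation ell2Z :: (complex_hilbert) "{real_normed_vector, complex_vector}"
begin

lift_definition norm_ell2Z :: "'a ell2Z \<Rightarrow> real" is "\<lambda>f. sqrt (\<Sum>\<^sub>\<infinity>n. (norm (f n))\<^sup>2)" .

lift_definition zero_ell2Z :: "'a ell2Z" is "\<lambda>_. 0" by simp

lift_definition plus_ell2Z :: "'a ell2Z \<Rightarrow> 'a ell2Z \<Rightarrow> 'a ell2Z" is "\<lambda>f g n. f n + g n"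
  by (rule sq_summableI, rule L2_set_add_le)

lift_definition uminus_ell2Z :: "'a ell2Z \<Rightarrow> 'a ell2Z" is "\<lambda>f n. - f n" by simp

lift_definition minus_ell2Z :: "'a ell2Z \<Rightarrow> 'a ell2Z \<Rightarrow> 'a ell2Z" is "\<lambda>f g n. f n - g n"
  subgoal for f g
    using L2_set_add_le[of f "\<lambda>n. - g n"] by (intro sq_summableI) auto
  done

lift_definition scaleC_ell2Z :: "complex \<Rightarrow> 'a ell2Z \<Rightarrow> 'a ell2Z" is "\<lambda>c f n. c *\<^sub>C f n"
  by (simp add: norm_scaleC power_mult_distrib summable_on_cmult_right)

lift_definition scaleR_ell2Z :: "real \<Rightarrow> 'a ell2Z \<Rightarrow> 'a ell2Z" is "\<lambda>r f n. r *\<^sub>R f n"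
  by (simp add: power_mult_distrib summable_on_cmult_right)

definition dist_ell2Z :: "'a ell2Z \<Rightarrow> 'a ell2Z \<Rightarrow> real"
  where "dist_ell2Z a b = norm (a - b)"

definition [code del]:
  "(uniformity :: ('a ell2Z \<times> 'a ell2Z) filter) = (INF e\<in>{0 <..}. principal {(x, y). dist x y < e})"

definition open_ell2Z :: "'a ell2Z set \<Rightarrow> bool"
  where [code del]: "open_ell2Z S = (\<forall>x\<in>S. \<forall>\<^sub>F (x', y) in uniformity. x' = x \<longrightarrow> y \<in> S)"

definition sgn_ell2Z :: "'a ell2Z \<Rightarrow> 'a ell2Z"
  where "sgn_ell2Z x = scaleR (inverse (norm x)) x"

instance
proof
  fix x y z :: "'a ell2Z" and a b :: real and c d :: complex
  show "norm (x + y) \<le> norm x + norm y"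
    by transfer (rule sqrt_infsum_le, rule L2_set_add_le)
  show "norm (a *\<^sub>R x) = \<bar>a\<bar> * norm x"
    by transfer (simp add: power_mult_distrib infsum_cmult_right' real_sqrt_mult)
  show "norm x = 0 \<longleftrightarrow> x = 0"
  proof
    assume x: "norm x = 0"
    have "norm (coord x n) \<le> 0" for n
      using L2_set_le_sqrt_infsum[of "coord x" "{n}"] coord[of x] x by (simp add: norm_ell2Z.rep_eq)
    then have "coord x = coord 0" by (auto simp: zero_ell2Z.rep_eq)
    then show "x = 0" by (simp only: coord_inject)
  next
    assume "x = 0" then show "norm x = 0" by (simp add: norm_ell2Z.rep_eq zero_ell2Z.rep_eq)
  qed
  show "dist x y = norm (x - y)" by (rule dist_ell2Z_def)
  show "sgn x = inverse (norm x) *\<^sub>R x" by (rule sgn_ell2Z_def)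
  show "(uniformity :: ('a ell2Z \<times> 'a ell2Z) filter) = (INF e\<in>{0 <..}. principal {(x, y). dist x y < e})"
    by (rule uniformity_ell2Z_def)
  show "open U = (\<forall>x\<in>U. \<forall>\<^sub>F (x', y) in uniformity. x' = x \<longrightarrow> y \<in> U)" for U :: "'a ell2Z set"
    by (rule open_ell2Z_def)
  show "x + y + z = x + (y + z)" by transfer (simp add: add.assoc)
  show "x + y = y + x" by transfer (simp add: add.commute)
  show "0 + x = x" by transfer simp
  show "- x + x = 0" by transfer simp
  show "x - y = x + - y" by transfer simp
  show "a *\<^sub>R (x + y) = a *\<^sub>R x + a *\<^sub>R y" by transfer (simp add: scaleR_add_right)
  show "(a + b) *\<^sub>R x = a *\<^sub>R x + b *\<^sub>R x" by transfer (simp add: scaleR_add_left)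
  show "a *\<^sub>R b *\<^sub>R x = (a * b) *\<^sub>R x" by transfer simp
  show "1 *\<^sub>R x = x" by transfer simp
  show "c *\<^sub>C (x + y) = c *\<^sub>C x + c *\<^sub>C y" by transfer (simp add: scaleC_add_right)
  show "(c + d) *\<^sub>C x = c *\<^sub>C x + d *\<^sub>C x" by transfer (simp add: scaleC_add_left)
  show "c *\<^sub>C d *\<^sub>C x = (c * d) *\<^sub>C x" by transfer (simp add: scaleC_scaleC)
  show "a *\<^sub>R x = complex_of_real a *\<^sub>C x" by transfer (rule ext, rule scaleR_scaleC)
qed

end

lemma coord_simps [simp]:
  "coord 0 n = 0" "coord (x + y) n = coord x n + coord y n" "coord (x - y) n = coord x n - coord y n"
  "coord (c *\<^sub>C x) n = c *\<^sub>C coord x n" "coord (r *\<^sub>R x) n = r *\<^sub>R coord x n"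
  by (simp_all add: zero_ell2Z.rep_eq plus_ell2Z.rep_eq minus_ell2Z.rep_eq scaleC_ell2Z.rep_eq
      scaleR_ell2Z.rep_eq)

lemma ell2Z_eqI: "(\<And>n. coord x n = coord y n) \<Longrightarrow> x = y"
  by transfer auto

lemma L2_set_coord_le: "finite F \<Longrightarrow> L2_set (\<lambda>n. norm (coord x n)) F \<le> norm x"
  using L2_set_le_sqrt_infsum[of "coord x" F] coord[of x] by (simp add: norm_ell2Z.rep_eq)

lemma norm_coord_le: "norm (coord x n) \<le> norm x"
  using L2_set_coord_le[of "{n}" x] by simp

lemma norm_ell2Z_le:
  "(\<And>F. finite F \<Longrightarrow> L2_set (\<lambda>n. norm (coord x n)) F \<le> B) \<Longrightarrow> norm x \<le> B"
  by (simp add: norm_ell2Z.rep_eq sqrt_infsum_le)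

lemma summable_cinner_coord: "(\<lambda>n. cinner (coord x n) (coord y n)) summable_on UNIV"
proof -
  have "(\<lambda>n. (norm (coord x n))\<^sup>2 + (norm (coord y n))\<^sup>2) summable_on UNIV"
    using coord[of x] coord[of y] by (intro summable_on_add) auto
  then have "(\<lambda>n. norm ((norm (coord x n))\<^sup>2 + (norm (coord y n))\<^sup>2)) summable_on UNIV"
    by simp
  then have "(\<lambda>n. norm (cinner (coord x n) (coord y n))) summable_on UNIV"
  proof (rule Infinite_Sum.abs_summable_on_comparison_test)
    fix n
    have "norm (cinner (coord x n) (coord y n)) \<le> norm (coord x n) * norm (coord y n)"
      by (rule cinner_Cauchy_Schwarz)
    also have "\<dots> \<le> (norm (coord x n))\<^sup>2 + (norm (coord y n))\<^sup>2"
      using sum_squares_bound[of "norm (coord x n)" "norm (coord y n)"]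
        mult_nonneg_nonneg[of "norm (coord x n)" "norm (coord y n)"] by (simp del: mult_nonneg_nonneg)
    finally show "norm (cinner (coord x n) (coord y n))
        \<le> norm ((norm (coord x n))\<^sup>2 + (norm (coord y n))\<^sup>2)" by simp
  qed
  then show ?thesis by (rule Infinite_Sum.abs_summable_summable)
qed

instance ell2Z :: (complex_hilbert) banach
proof
  fix X :: "nat \<Rightarrow> 'a ell2Z" assume X: "Cauchy X"
  have "Cauchy (\<lambda>k. coord (X k) n)" for n
  proof (rule CauchyI)
    fix e :: real assume "e > 0"
    then obtain K where K: "\<And>i j. i \<ge> K \<Longrightarrow> j \<ge> K \<Longrightarrow> norm (X i - X j) < e"
      using CauchyD[OF X] by blast
    have "norm (coord (X i) n - coord (X j) n) < e" if "i \<ge> K" "j \<ge> K" for i j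
      using norm_coord_le[of "X i - X j" n] K[OF that] by simp
    then show "\<exists>K. \<forall>i\<ge>K. \<forall>j\<ge>K. norm (coord (X i) n - coord (X j) n) < e" by blast
  qed
  then have "\<exists>l. (\<lambda>k. coord (X k) n) \<longlonglongrightarrow> l" for n
    using convergent_eq_Cauchy convergent_def by blast
  then obtain f where f: "\<And>n. (\<lambda>k. coord (X k) n) \<longlonglongrightarrow> f n" by metis
  have close: "\<exists>K. \<forall>i\<ge>K. \<forall>F. finite F \<longrightarrow> L2_set (\<lambda>n. norm (coord (X i) n - f n)) F \<le> e"
    if e: "e > 0" for e
  proof -
    obtain K where K: "\<And>i j. i \<ge> K \<Longrightarrow> j \<ge> K \<Longrightarrow> norm (X i - X j) < e"
      using CauchyD[OF X e] by blast
    have "L2_set (\<lambda>n. norm (coord (X i) n - f n)) F \<le> e" if i: "i \<ge> K" and F: "finite F" for i F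
    proof (rule tendsto_upperbound)
      show "(\<lambda>j. L2_set (\<lambda>n. norm (coord (X i) n - coord (X j) n)) F)
          \<longlonglongrightarrow> L2_set (\<lambda>n. norm (coord (X i) n - f n)) F"
        unfolding L2_set_def by (intro tendsto_intros f)
      have "L2_set (\<lambda>n. norm (coord (X i) n - coord (X j) n)) F \<le> e" if "j \<ge> K" for j
        using L2_set_coord_le[OF F, of "X i - X j"] K[OF i that] by simp
      then show "\<forall>\<^sub>F j in sequentially. L2_set (\<lambda>n. norm (coord (X i) n - coord (X j) n)) F \<le> e"
        by (auto simp: eventually_sequentially)
    qed simp
    then show ?thesis by blast
  qed
  obtain K where K: "\<And>F. finite F \<Longrightarrow> L2_set (\<lambda>n. norm (coord (X K) n - f n)) F \<le> 1"
    using close[of 1] by auto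
  have "(\<lambda>n. (norm (coord (X K) n - f n))\<^sup>2) summable_on UNIV"
    by (rule sq_summableI[OF K])
  then have g: "coord (Ell2Z (\<lambda>n. coord (X K) n - f n)) = (\<lambda>n. coord (X K) n - f n)"
    by (simp add: Ell2Z_inverse)
  define L where "L = X K - Ell2Z (\<lambda>n. coord (X K) n - f n)"
  have L: "coord L n = f n" for n by (simp add: L_def g)
  have "X \<longlonglongrightarrow> L"
  proof (rule LIMSEQ_I)
    fix e :: real assume "e > 0"
    then obtain K where K: "\<And>i F. i \<ge> K \<Longrightarrow> finite F \<Longrightarrow> L2_set (\<lambda>n. norm (coord (X i) n - f n)) F \<le> e / 2"
      using close[of "e / 2"] by auto
    have "norm (X i - L) < e" if "i \<ge> K" for i
      using norm_ell2Z_le[of "X i - L" "e / 2"] K[OF that] \<open>e > 0\<close> by (simp add: L)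
    then show "\<exists>K. \<forall>i\<ge>K. norm (X i - L) < e" by blast
  qed
  then show "convergent X" by (auto simp: convergent_def)
qed

instantiation ell2Z :: (complex_hilbert) complex_hilbert
begin

definition "cinner_ell2Z x y = (\<Sum>\<^sub>\<infinity>n. cinner (coord x n) (coord y n))"

instance
proof
  fix x y z :: "'a ell2Z" and c :: complex
  show "cinner x y = cnj (cinner y x)"
    unfolding cinner_ell2Z_def infsum_cnj[symmetric]
    by (rule infsum_cong) (rule cinner_commute)
  show "cinner (x + y) z = cinner x z + cinner y z"
    unfolding cinner_ell2Z_def coord_simps cinner_add_left
    by (intro infsum_add summable_cinner_coord)
  show "cinner (c *\<^sub>C x) y = c * cinner x y"
    unfolding cinner_ell2Z_def coord_simps cinner_scaleC_left
    by (intro infsum_cmult_right summable_cinner_coord)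
  show "norm x = sqrt (Re (cinner x x))"
    unfolding cinner_ell2Z_def cinner_self norm_ell2Z.rep_eq
    using coord[of x] by (subst infsumI[OF has_sum_of_real_iff[THEN iffD2, OF has_sum_infsum]])
      (simp_all del: of_real_power)
qed

end

section \<open>Crossed products\<close>

lift_definition single :: "int \<Rightarrow> 'a \<Rightarrow> 'a::complex_hilbert ell2Z" is
  "\<lambda>m \<xi> n. if n = m then \<xi> else 0"
  subgoal for m \<xi>
    by (rule finite_nonzero_values_imp_summable_on, rule finite_subset[of _ "{m}"]) auto
  done

text \<open>\<open>\<Lambda>\<close> exhibits the Hilbert space \<open>'l\<close> as (a model of) the completion of \<open>N\<close> with respect to the
  inner product given by \<open>tr\<close>; it sends \<open>x\<close> to the vector usually denoted by \<open>x\<close> with a hat.\<close>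

definition is_L2 ::
    "'h::complex_hilbert bop set \<Rightarrow> ('h bop \<Rightarrow> complex) \<Rightarrow> ('h bop \<Rightarrow> 'l::complex_hilbert) \<Rightarrow> bool" where
  "is_L2 N tr \<Lambda> \<longleftrightarrow> clinear_on N \<Lambda> \<and> (\<forall>x\<in>N. \<forall>y\<in>N. cinner (\<Lambda> x) (\<Lambda> y) = tr (adj y * x))
     \<and> closure (\<Lambda> ` N) = UNIV"

text \<open>The representation of \<open>N\<close> on its \<open>L\<^sup>2\<close>-space by left multiplication.  This and the operators
  given by definite descriptions below exist and are unique: see \<open>left_mult_\<Lambda>\<close>, \<open>coord_cp_rep\<close> and
  \<open>coord_cp_unitary\<close>.  The covariance relation is \<open>cp_rep_covariant\<close>.\<close>

definition left_mult ::
    "'h::complex_hilbert bop set \<Rightarrow> ('h bop \<Rightarrow> 'l::complex_hilbert) \<Rightarrow> 'h bop \<Rightarrow> 'l bop" where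
  "left_mult N \<Lambda> x = (THE T. \<forall>y\<in>N. app T (\<Lambda> y) = \<Lambda> (x * y))"

definition cp_rep ::
    "'h::complex_hilbert bop set \<Rightarrow> ('h bop \<Rightarrow> 'h bop) \<Rightarrow> ('h bop \<Rightarrow> 'l::complex_hilbert) \<Rightarrow>
     'h bop \<Rightarrow> 'l ell2Z bop" where
  "cp_rep N \<theta> \<Lambda> x = (THE T. \<forall>\<xi> n. coord (app T \<xi>) n
     = app (left_mult N \<Lambda> (autpow N \<theta> (- n) x)) (coord \<xi> n))"

definition cp_unitary :: "'l::complex_hilbert ell2Z bop" where
  "cp_unitary = (THE T. \<forall>\<xi> n. coord (app T \<xi>) n = coord \<xi> (n - 1))"

definition crossed_product ::
    "'h::complex_hilbert bop set \<Rightarrow> ('h bop \<Rightarrow> 'h bop) \<Rightarrow> ('h bop \<Rightarrow> 'l::complex_hilbert) \<Rightarrow>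
     'l ell2Z bop set" where
  "crossed_product N \<theta> \<Lambda> = von_neumann_algebra hull (insert cp_unitary (cp_rep N \<theta> \<Lambda> ` N))"

text \<open>The trace on the crossed product is the vector state of the class of \<open>1\<close> placed at index 0.
  On an element with Fourier series \<open>\<Sum>\<^sub>n \<pi>(x\<^sub>n) u\<^sup>n\<close> its value is \<open>tr x\<^sub>0\<close>: see \<open>cp_trace_Fourier\<close> and
  \<open>cp_trace_monomial\<close>.\<close>

definition cp_trace :: "('h::complex_hilbert bop \<Rightarrow> 'l::complex_hilbert) \<Rightarrow> 'l ell2Z bop \<Rightarrow> complex" where
  "cp_trace \<Lambda> T = cinner (app T (single 0 (\<Lambda> 1))) (single 0 (\<Lambda> 1))"

section \<open>Well-definedness of the constructions\<close>

lemma bop_eqI: "(\<And>\<xi>. app S \<xi> = app T \<xi>) \<Longrightarrow> S = T"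
  by transfer auto

lemma app_bop_simps [simp]:
  "app (S * T) \<xi> = app S (app T \<xi>)" "app 1 \<xi> = \<xi>" "app 0 \<xi> = 0"
  "app (S + T) \<xi> = app S \<xi> + app T \<xi>" "app (S - T) \<xi> = app S \<xi> - app T \<xi>"
  "app (c *\<^sub>C T) \<xi> = c *\<^sub>C app T \<xi>"
  by (simp_all add: times_bop.rep_eq one_bop.rep_eq zero_bop.rep_eq plus_bop.rep_eq
      minus_bop.rep_eq scaleC_bop.rep_eq)

lemma bounded_linear_app: "bounded_linear (app T)"
  using app[of T] by simp

lemma app_add: "app T (\<xi> + \<eta>) = app T \<xi> + app T \<eta>"
  by (simp add: bounded_linear_app bounded_linear.linear linear_add)

lemma app_scaleC: "app T (c *\<^sub>C \<xi>) = c *\<^sub>C app T \<xi>"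
  using app[of T] by simp

lemma app_zero_right [simp]: "app T 0 = 0"
  using app_scaleC[of T 0 0] by simp

lemma norm_app_le: "norm (app T \<xi>) \<le> norm T * norm \<xi>"
  unfolding norm_bop.rep_eq by (rule onorm[OF bounded_linear_app])

lemma app_Bop:
  assumes "\<And>\<xi> \<eta>. f (\<xi> + \<eta>) = f \<xi> + f \<eta>" "\<And>c \<xi>. f (c *\<^sub>C \<xi>) = c *\<^sub>C f \<xi>"
    "\<And>\<xi>. norm (f \<xi>) \<le> K * norm \<xi>"
  shows "app (Bop f) = f"
proof (rule Bop_inverse, safe)
  show "bounded_linear f"
    by (rule bounded_linear_intro[of _ K]) (simp_all add: assms scaleR_scaleC mult.commute)
qed (rule assms)

lemma norm_add_square:
  "(norm (x + y))\<^sup>2 = (norm x)\<^sup>2 + 2 * Re (cinner x y) + (norm (y::'a::complex_hilbert))\<^sup>2"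
  using norm_diff_square[of x "-y"] by (simp add: cinner_minus_right)

lemma Riesz_representation:
  fixes f :: "'a::complex_hilbert \<Rightarrow> complex"
  assumes f: "bounded_linear f" and fC: "\<And>c x. f (c *\<^sub>C x) = c * f x"
  shows "\<exists>z. \<forall>x. f x = cinner x z"
proof (cases "\<forall>x. f x = 0")
  case True
  then show ?thesis by (intro exI[of _ 0]) simp
next
  case False
  interpret f: bounded_linear f by (rule f)
  obtain x0 where x0: "f x0 \<noteq> 0" using False by blast
  define S where "S = {x. f x = 1}"
  have "inverse (f x0) *\<^sub>C x0 \<in> S" using x0 by (simp add: S_def fC)
  then have Sne: "S \<noteq> {}" by blast
  define d where "d = (INF x\<in>S. norm x)"
  have bdd: "bdd_below (norm ` S)" by (rule bdd_belowI2[of _ 0]) simp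
  have dle: "d \<le> norm x" if "x \<in> S" for x unfolding d_def by (rule cINF_lower[OF bdd that])
  have d0: "0 \<le> d" unfolding d_def by (rule cINF_greatest[OF Sne]) simp
  have "\<exists>x\<in>S. norm x < d + 1 / real (Suc n)" for n
    using cINF_less_iff[OF Sne bdd, of "d + 1 / real (Suc n)"] unfolding d_def by simp
  then obtain X where X: "\<And>n. X n \<in> S" "\<And>n. norm (X n) < d + 1 / real (Suc n)" by metis
  have par: "(norm (x - y))\<^sup>2 \<le> 2 * (norm x)\<^sup>2 + 2 * (norm y)\<^sup>2 - 4 * d\<^sup>2" if "x \<in> S" "y \<in> S" for x y
  proof -
    have "(1/2) *\<^sub>R (x + y) \<in> S" using that by (simp add: S_def f.scaleR f.add scaleR_conv_of_real)
    then have "d \<le> norm (x + y) / 2" using dle[of "(1/2) *\<^sub>R (x + y)"] by simp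
    then have "(2 * d)\<^sup>2 \<le> (norm (x + y))\<^sup>2" using d0 by (intro power_mono) auto
    then show ?thesis using norm_add_square[of x y] norm_diff_square[of x y] by simp
  qed
  have lim: "(\<lambda>n. norm (X n)) \<longlonglongrightarrow> d"
  proof (rule tendsto_sandwich[of "\<lambda>_. d" _ _ "\<lambda>n. d + 1 / real (Suc n)"])
    show "(\<lambda>n. d + 1 / real (Suc n)) \<longlonglongrightarrow> d"
      using tendsto_add[OF tendsto_const LIMSEQ_inverse_real_of_nat, of d] by (simp add: inverse_eq_divide)
    show "\<forall>\<^sub>F n in sequentially. d \<le> norm (X n)" using dle[OF X(1)] by simp
    show "\<forall>\<^sub>F n in sequentially. norm (X n) \<le> d + 1 / real (Suc n)"
      using less_imp_le[OF X(2)] by simp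
  qed simp
  have "Cauchy X"
  proof (rule CauchyI)
    fix e :: real assume e: "e > 0"
    have "(\<lambda>n. (norm (X n))\<^sup>2) \<longlonglongrightarrow> d\<^sup>2" by (intro tendsto_intros lim)
    then have "\<forall>\<^sub>F n in sequentially. (norm (X n))\<^sup>2 < d\<^sup>2 + e\<^sup>2 / 4"
      by (rule order_tendstoD) (use e in simp)
    then obtain K where K: "\<And>n. n \<ge> K \<Longrightarrow> (norm (X n))\<^sup>2 < d\<^sup>2 + e\<^sup>2 / 4"
      by (auto simp: eventually_sequentially)
    have "norm (X i - X j) < e" if "i \<ge> K" "j \<ge> K" for i j
    proof -
      have "(norm (X i - X j))\<^sup>2 < e\<^sup>2"
        using par[OF X(1) X(1), of i j] K[OF that(1)] K[OF that(2)] by simp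
      then show ?thesis using e by (simp add: power_less_imp_less_base)
    qed
    then show "\<exists>K. \<forall>i\<ge>K. \<forall>j\<ge>K. norm (X i - X j) < e" by blast
  qed
  then obtain z where z: "X \<longlonglongrightarrow> z" using convergent_eq_Cauchy convergent_def by blast
  have "(\<lambda>n. f (X n)) \<longlonglongrightarrow> f z" by (rule f.tendsto[OF z])
  moreover have "f (X n) = 1" for n using X(1)[of n] by (simp add: S_def)
  ultimately have fz: "f z = 1" by (simp add: LIMSEQ_const_iff)
  have nz: "norm z = d" using tendsto_norm[OF z] lim LIMSEQ_unique by blast
  have z0: "z \<noteq> 0" using fz f.zero by auto
  have orth: "cinner h z = 0" if h: "f h = 0" for h
  proof (rule ccontr)
    assume c0: "cinner h z \<noteq> 0"
    then have h0: "h \<noteq> 0" by auto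
    define c where "c = cnj (cinner h z) / complex_of_real ((norm h)\<^sup>2)"
    have cc: "cnj c * cinner z h = complex_of_real ((cmod (cinner h z))\<^sup>2 / (norm h)\<^sup>2)"
      unfolding c_def using complex_norm_square[of "cinner h z"] cinner_commute[of z h]
      by (simp del: of_real_power)
    have nc: "(cmod c * norm h)\<^sup>2 = (cmod (cinner h z))\<^sup>2 / (norm h)\<^sup>2"
      unfolding c_def using h0
      by (simp add: norm_divide power_mult_distrib power_divide norm_power del: of_real_power)
        (simp add: power2_eq_square power4_eq_xxxx)
    have "z - c *\<^sub>C h \<in> S" using fz h by (simp add: S_def f.diff fC)
    then have "d\<^sup>2 \<le> (norm (z - c *\<^sub>C h))\<^sup>2" using dle d0 by (intro power_mono) auto
    also have "\<dots> = d\<^sup>2 - (cmod (cinner h z))\<^sup>2 / (norm h)\<^sup>2"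
      unfolding norm_diff_square cinner_scaleC_right norm_scaleC cc nc nz by simp
    finally show False using c0 h0 by (simp add: divide_le_0_iff)
  qed
  have "f x = cinner x (complex_of_real (inverse ((norm z)\<^sup>2)) *\<^sub>C z)" for x
  proof -
    have "f (x - f x *\<^sub>C z) = 0" by (simp add: f.diff fC fz)
    then have "cinner x z = f x * cinner z z"
      using orth[of "x - f x *\<^sub>C z"] by (simp add: cinner_diff_left cinner_scaleC_left)
    then show ?thesis using z0 by (simp add: cinner_scaleC_right cinner_self)
  qed
  then show ?thesis by blast
qed

lemma cinner_eqI:
  assumes "\<And>\<xi>. cinner \<xi> x = cinner \<xi> (y::'a::complex_hilbert)"
  shows "x = y"
proof -
  have "cinner (x - y) (x - y) = 0" using assms[of "x - y"] by (simp add: cinner_diff_right)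
  then show ?thesis unfolding cinner_self by simp
qed

lemma adj_eqI:
  assumes "\<And>\<xi> \<eta>. cinner (app T \<xi>) \<eta> = cinner \<xi> (app S \<eta>)"
  shows "adj T = S"
  unfolding adj_def
proof (rule the_equality)
  fix S' assume S': "\<forall>\<xi> \<eta>. cinner (app T \<xi>) \<eta> = cinner \<xi> (app S' \<eta>)"
  show "S' = S"
  proof (rule bop_eqI, rule cinner_eqI)
    fix \<xi> \<eta>
    show "cinner \<xi> (app S' \<eta>) = cinner \<xi> (app S \<eta>)" 
      by (rule trans[OF S'[rule_format, symmetric] assms])
  qed
qed (intro allI assms)

lemma cinner_adj_right: "cinner \<xi> (app (adj T) \<eta>) = cinner (app T \<xi>) \<eta>"
proof -
  have "\<exists>z. \<forall>\<xi>. cinner (app T \<xi>) \<eta> = cinner \<xi> z" for \<eta>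
  proof (rule Riesz_representation)
    show "bounded_linear (\<lambda>\<xi>. cinner (app T \<xi>) \<eta>)"
    proof (rule bounded_linear_intro[of _ "norm T * norm \<eta>"])
      fix \<xi>
      have "norm (cinner (app T \<xi>) \<eta>) \<le> norm (app T \<xi>) * norm \<eta>" by (rule cinner_Cauchy_Schwarz)
      also have "\<dots> \<le> norm T * norm \<xi> * norm \<eta>" by (intro mult_right_mono norm_app_le) simp
      finally show "norm (cinner (app T \<xi>) \<eta>) \<le> norm \<xi> * (norm T * norm \<eta>)" by (simp add: ac_simps)
    qed (simp_all add: app_add cinner_add_left scaleR_scaleC app_scaleC cinner_scaleC_left
        scaleC_complex_def)
  qed (simp add: app_scaleC cinner_scaleC_left)
  then obtain S where S: "\<And>\<xi> \<eta>. cinner (app T \<xi>) \<eta> = cinner \<xi> (S \<eta>)" by metis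
  have "app (Bop S) = S"
  proof (rule app_Bop)
    show "S (x + y) = S x + S y" for x y
      by (rule cinner_eqI) (simp add: cinner_add_right S[symmetric])
    show "S (c *\<^sub>C x) = c *\<^sub>C S x" for c x
      by (rule cinner_eqI) (simp add: cinner_scaleC_right S[symmetric])
    show "norm (S x) \<le> norm T * norm x" for x
    proof (cases "S x = 0")
      case False
      have "(norm (S x))\<^sup>2 = cmod (cinner (S x) (S x))"
        unfolding cinner_self norm_of_real by simp
      also have "\<dots> = cmod (cinner (app T (S x)) x)" by (simp add: S)
      also have "\<dots> \<le> norm (app T (S x)) * norm x" by (rule cinner_Cauchy_Schwarz)
      also have "\<dots> \<le> norm T * norm (S x) * norm x" by (intro mult_right_mono norm_app_le) simp
      finally show ?thesis using False by (simp add: power2_eq_square)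
    qed simp
  qed
  then have "adj T = Bop S" by (intro adj_eqI) (simp add: S)
  with \<open>app (Bop S) = S\<close> show ?thesis by (simp add: S)
qed

lemma cinner_adj_left: "cinner (app (adj T) \<xi>) \<eta> = cinner \<xi> (app T \<eta>)"
proof -
  have "cinner (app (adj T) \<xi>) \<eta> = cnj (cinner \<eta> (app (adj T) \<xi>))" by (rule cinner_commute)
  also have "\<dots> = cinner \<xi> (app T \<eta>)" by (simp add: cinner_adj_right cinner_commute[of \<xi>])
  finally show ?thesis .
qed

lemma adj_mult: "adj (S * T) = adj T * adj S"
  by (rule adj_eqI) (simp add: cinner_adj_right)

lemma adj_adj [simp]: "adj (adj T) = T"
  by (rule adj_eqI) (simp add: cinner_adj_left)

lemma adj_one [simp]: "adj 1 = 1"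
  by (rule adj_eqI) simp

lemma pos_op_iff: "pos_op T \<longleftrightarrow> (\<forall>\<xi>. Im (cinner (app T \<xi>) \<xi>) = 0 \<and> 0 \<le> Re (cinner (app T \<xi>) \<xi>))"
  unfolding pos_op_def complex_nonneg_Reals_iff by blast

lemma scaleC_mult_left: "(c *\<^sub>C S) * T = c *\<^sub>C (S * T :: 'a::complex_hilbert bop)"
  by (rule bop_eqI) simp

lemma scaleC_mult_right: "S * (c *\<^sub>C T) = c *\<^sub>C (S * T :: 'a::complex_hilbert bop)"
  by (rule bop_eqI) (simp add: app_scaleC)

lemma von_neumann_algebra_closed:
  assumes "von_neumann_algebra A"
  shows "1 \<in> A" "0 \<in> A" "\<And>x y. x \<in> A \<Longrightarrow> y \<in> A \<Longrightarrow> x + y \<in> A" "\<And>x y. x \<in> A \<Longrightarrow> y \<in> A \<Longrightarrow> x * y \<in> A"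
    "\<And>c x. x \<in> A \<Longrightarrow> c *\<^sub>C x \<in> A" "\<And>x. x \<in> A \<Longrightarrow> adj x \<in> A"
proof -
  have A: "x \<in> A \<longleftrightarrow> (\<forall>t\<in>commutant A. x * t = t * x)" for x
    using assms unfolding von_neumann_algebra_def commutant_def by blast
  show "1 \<in> A" "0 \<in> A" by (simp_all add: A)
  show "x + y \<in> A" if "x \<in> A" "y \<in> A" for x y
    using that by (simp add: A distrib_left distrib_right)
  show "x * y \<in> A" if "x \<in> A" "y \<in> A" for x y
    unfolding A
  proof
    fix t assume "t \<in> commutant A"
    then have "x * t = t * x" "y * t = t * y" using that by (simp_all add: A)
    then show "x * y * t = t * (x * y)" by (metis mult.assoc)
  qed
  show "c *\<^sub>C x \<in> A" if "x \<in> A" for c x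
    using that by (simp add: A scaleC_mult_left scaleC_mult_right)
  show "adj x \<in> A" if "x \<in> A" for x
    using that assms by (auto simp: von_neumann_algebra_def)
qed

lemma coord_single: "coord (single m \<xi>) n = (if n = m then \<xi> else 0)"
  by (simp add: single.rep_eq)

lemma cinner_single: "cinner x (single m \<xi>) = cinner (coord x m) \<xi>"
proof -
  have "cinner x (single m \<xi>) = (\<Sum>\<^sub>\<infinity>n\<in>{m}. cinner (coord x n) (coord (single m \<xi>) n))"
    unfolding cinner_ell2Z_def by (rule infsum_cong_neutral) (auto simp: coord_single)
  then show ?thesis by (simp add: coord_single)
qed

lemma ell2Z_translation: "\<exists>T. \<forall>(\<xi>::'a::complex_hilbert ell2Z) n. coord (app T \<xi>) n = coord \<xi> (n + k)"
proof -
  define S where "S \<xi> = Ell2Z (\<lambda>n. coord \<xi> (n + k))" for \<xi> :: "'a ell2Z"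
  have bij: "bij_betw (\<lambda>n. n + k) UNIV (UNIV :: int set)"
    by (rule bij_betwI[of _ _ _ "\<lambda>n. n - k"]) auto
  have S: "coord (S \<xi>) n = coord \<xi> (n + k)" for \<xi> n
    unfolding S_def using coord[of \<xi>]
    by (subst Ell2Z_inverse) (simp_all add: summable_on_reindex_bij_betw[OF bij, of "\<lambda>n. (norm (coord \<xi> n))\<^sup>2"])
  have "app (Bop S) = S"
  proof (rule app_Bop)
    show "norm (S \<xi>) \<le> 1 * norm \<xi>" for \<xi>
      by (simp add: norm_ell2Z.rep_eq S infsum_reindex_bij_betw[OF bij, of "\<lambda>n. (norm (coord \<xi> n))\<^sup>2"])
  qed (auto intro!: ell2Z_eqI simp: S)
  then show ?thesis by (metis S)
qed

lemma coord_cp_unitary: "coord (app cp_unitary \<xi>) n = coord \<xi> (n - 1)"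
proof -
  obtain T :: "'a ell2Z bop" where T: "\<forall>\<xi> n. coord (app T \<xi>) n = coord \<xi> (n - 1)"
    using ell2Z_translation[of "-1"] by auto
  have "cp_unitary = T"
    unfolding cp_unitary_def
  proof (rule the_equality)
    show "\<forall>\<xi> n. coord (app T \<xi>) n = coord \<xi> (n - 1)" by (rule T)
    fix T' :: "'a ell2Z bop" assume T': "\<forall>\<xi> n. coord (app T' \<xi>) n = coord \<xi> (n - 1)"
    show "T' = T" by (rule bop_eqI, rule ell2Z_eqI) (simp only: T[rule_format] T'[rule_format])
  qed
  then show ?thesis using T by simp
qed

lemma coord_adj_cp_unitary: "coord (app (adj cp_unitary) \<xi>) n = coord \<xi> (n + 1)"
proof -
  obtain T :: "'a ell2Z bop" where T: "\<And>\<xi> n. coord (app T \<xi>) n = coord \<xi> (n + 1)"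
    using ell2Z_translation[of 1] by auto
  have "adj cp_unitary = T"
  proof (rule adj_eqI)
    fix \<xi> \<eta> :: "'a ell2Z"
    have bij: "bij_betw (\<lambda>n. n + 1) UNIV (UNIV :: int set)"
      by (rule bij_betwI[of _ _ _ "\<lambda>n. n - 1"]) auto
    show "cinner (app cp_unitary \<xi>) \<eta> = cinner \<xi> (app T \<eta>)"
      unfolding cinner_ell2Z_def coord_cp_unitary T
      using infsum_reindex_bij_betw[OF bij, of "\<lambda>n. cinner (coord \<xi> (n - 1)) (coord \<eta> n)"] by simp
  qed
  then show ?thesis by (simp add: T)
qed

lemma unitary_cp_unitary: "unitary_op (cp_unitary :: 'a::complex_hilbert ell2Z bop)"
  unfolding unitary_op_def
  by (auto intro!: bop_eqI ell2Z_eqI simp: coord_cp_unitary coord_adj_cp_unitary)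

lemma coord_upower_cp_unitary: "coord (app (upower cp_unitary m) \<xi>) n = coord \<xi> (n - m)"
proof -
  have 1: "coord (app (cp_unitary ^ k) \<xi>) n = coord \<xi> (n - int k)" for k n
    by (induction k arbitrary: n) (simp_all add: coord_cp_unitary algebra_simps)
  have 2: "coord (app (adj cp_unitary ^ k) \<xi>) n = coord \<xi> (n + int k)" for k n
    by (induction k arbitrary: n) (simp_all add: coord_adj_cp_unitary algebra_simps)
  show ?thesis by (simp add: upower_def 1 2)
qed

lemma automorphism_inv:
  assumes N: "von_neumann_algebra N" and \<theta>: "automorphism N \<theta>"
  shows "automorphism N (inv_into N \<theta>)"
proof -
  let ?i = "inv_into N \<theta>"
  have bij: "bij_betw \<theta> N N" using \<theta> by (simp add: automorphism_def)
  have i: "?i x \<in> N" "\<theta> (?i x) = x" if "x \<in> N" for x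
    using bij that by (auto simp: bij_betw_def f_inv_into_f inv_into_into)
  have eq: "?i x = y" if "y \<in> N" "\<theta> y = x" for x y
    using bij that by (auto simp: bij_betw_def)
  note c = von_neumann_algebra_closed[OF N]
  have h: "\<theta> (x + y) = \<theta> x + \<theta> y" "\<theta> (x * y) = \<theta> x * \<theta> y" "\<theta> (c *\<^sub>C x) = c *\<^sub>C \<theta> x" "\<theta> (adj x) = adj (\<theta> x)"
    if "x \<in> N" "y \<in> N" for x y c using \<theta> that by (auto simp: automorphism_def clinear_on_def)
  show ?thesis
    unfolding automorphism_def clinear_on_def
  proof (intro conjI ballI allI)
    show "bij_betw ?i N N" by (rule bij_betw_inv_into[OF bij])
  qed (rule eq; simp add: h i c)+
qed

lemma automorphism_funpow: "automorphism N \<theta> \<Longrightarrow> automorphism N (\<theta> ^^ k)"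
proof (induction k)
  case 0 then show ?case by (simp add: automorphism_def clinear_on_def bij_betw_def)
next
  case (Suc k)
  then have a: "automorphism N \<theta>" and b: "automorphism N (\<theta> ^^ k)" by auto
  have N: "(\<theta> ^^ k) x \<in> N" if "x \<in> N" for x
    using b that by (auto simp: automorphism_def bij_betw_def)
  have "bij_betw (\<theta> ^^ Suc k) N N"
    using a b by (auto simp: automorphism_def intro: bij_betw_trans)
  then show ?case
    using a b N by (simp add: automorphism_def clinear_on_def comp_def)
qed

lemma automorphism_autpow:
  "von_neumann_algebra N \<Longrightarrow> automorphism N \<theta> \<Longrightarrow> automorphism N (autpow N \<theta> n)"
  by (simp add: autpow_def automorphism_funpow automorphism_inv)

lemma automorphism_in: "automorphism N \<theta> \<Longrightarrow> x \<in> N \<Longrightarrow> \<theta> x \<in> N"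
  by (auto simp: automorphism_def bij_betw_def)

lemma trace_preserving_funpow:
  "automorphism N \<theta> \<Longrightarrow> trace_preserving N tr \<theta> \<Longrightarrow> trace_preserving N tr (\<theta> ^^ k)"
  by (induction k) (simp_all add: trace_preserving_def automorphism_in[OF automorphism_funpow])

lemma trace_preserving_autpow:
  assumes N: "von_neumann_algebra N" and \<theta>: "automorphism N \<theta>" and tr: "trace_preserving N tr \<theta>"
  shows "trace_preserving N tr (autpow N \<theta> n)"
proof -
  have "trace_preserving N tr (inv_into N \<theta>)"
    unfolding trace_preserving_def
  proof
    fix x assume x: "x \<in> N"
    have "\<theta> (inv_into N \<theta> x) = x"
      using \<theta> x by (auto simp: automorphism_def bij_betw_def f_inv_into_f)
    then show "tr (inv_into N \<theta> x) = tr x"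
      using tr automorphism_in[OF automorphism_inv[OF N \<theta>] x] unfolding trace_preserving_def by metis
  qed
  then show ?thesis
    by (simp add: autpow_def trace_preserving_funpow automorphism_inv N \<theta> tr)
qed

lemma autpow_shift:
  assumes "automorphism N \<theta>" "x \<in> N"
  shows "autpow N \<theta> k (\<theta> x) = autpow N \<theta> (k + 1) x"
proof (cases "k \<ge> 0")
  case True
  then show ?thesis by (simp add: autpow_def nat_add_distrib funpow_swap1)
next
  case False
  define j where "j = nat (- k - 1)"
  have k: "k = - int (Suc j)" using False by (simp add: j_def)
  have "inv_into N \<theta> (\<theta> x) = x" using assms by (simp add: automorphism_def bij_betw_def)
  then show ?thesis by (cases j) (simp_all add: k autpow_def funpow_swap1 nat_add_distrib)
qed

context
  fixes N :: "'h::complex_hilbert bop set" and tr :: "'h bop \<Rightarrow> complex" and \<theta> :: "'h bop \<Rightarrow> 'h bop"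
    and \<Lambda> :: "'h bop \<Rightarrow> 'l::complex_hilbert"
  assumes N: "von_neumann_algebra N" and tr: "faithful_normal_trace N tr"
    and \<theta>: "automorphism N \<theta>" and tp: "trace_preserving N tr \<theta>" and L2: "is_L2 N tr \<Lambda>"
begin

private lemmas closed = von_neumann_algebra_closed[OF N]

private lemma tr_lin: "x \<in> N \<Longrightarrow> y \<in> N \<Longrightarrow> tr (x + y) = tr x + tr y" "x \<in> N \<Longrightarrow> tr (c *\<^sub>C x) = c * tr x"
  using tr by (auto simp: faithful_normal_trace_def clinear_on_def scaleC_complex_def)

private lemma \<Lambda>_lin: "x \<in> N \<Longrightarrow> y \<in> N \<Longrightarrow> \<Lambda> (x + y) = \<Lambda> x + \<Lambda> y" "x \<in> N \<Longrightarrow> \<Lambda> (c *\<^sub>C x) = c *\<^sub>C \<Lambda> x"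
  using L2 by (auto simp: is_L2_def clinear_on_def)

private lemma \<Lambda>_cinner: "x \<in> N \<Longrightarrow> y \<in> N \<Longrightarrow> cinner (\<Lambda> x) (\<Lambda> y) = tr (adj y * x)"
  using L2 by (auto simp: is_L2_def)

private lemma \<Lambda>_diff: "x \<in> N \<Longrightarrow> y \<in> N \<Longrightarrow> \<Lambda> (x + (-1) *\<^sub>C y) = \<Lambda> x - \<Lambda> y"
  using \<Lambda>_lin(1)[of x "(-1) *\<^sub>C y"] \<Lambda>_lin(2)[of y "-1"] closed(5)[of y "-1"] by simp

private lemma norm_\<Lambda>: "x \<in> N \<Longrightarrow> (norm (\<Lambda> x))\<^sup>2 = Re (tr (adj x * x))"
  unfolding \<Lambda>_cinner[of x x, symmetric] cinner_self by simp

private lemma norm_left_mult_le: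
  assumes x: "x \<in> N" and y: "y \<in> N"
  shows "norm (\<Lambda> (x * y)) \<le> norm x * norm (\<Lambda> y)"
proof -
  let ?c = "complex_of_real ((norm x)\<^sup>2)"
  let ?a = "?c *\<^sub>C (adj y * y)" and ?b = "(-1) *\<^sub>C (adj (x * y) * (x * y))"
  have "pos_op (?a + ?b)"
    unfolding pos_op_iff
  proof (intro allI)
    fix \<xi>
    have "cinner (app (?a + ?b) \<xi>) \<xi>
        = complex_of_real ((norm x)\<^sup>2 * (norm (app y \<xi>))\<^sup>2 - (norm (app x (app y \<xi>)))\<^sup>2)"
      by (simp add: cinner_add_left cinner_minus_left cinner_scaleC_left cinner_adj_left adj_mult
          cinner_self cinner_diff_left del: of_real_power scaleC_minus1)
    moreover have "(norm (app x (app y \<xi>)))\<^sup>2 \<le> (norm x * norm (app y \<xi>))\<^sup>2"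
      by (intro power_mono norm_app_le) simp
    ultimately show "Im (cinner (app (?a + ?b) \<xi>) \<xi>) = 0 \<and> 0 \<le> Re (cinner (app (?a + ?b) \<xi>) \<xi>)"
      by (simp add: power_mult_distrib)
  qed
  moreover have ab: "?a \<in> N" "?b \<in> N" using x y by (simp_all only: closed)
  moreover have "\<forall>z\<in>N. pos_op z \<longrightarrow> tr z \<in> \<real>\<^sub>\<ge>\<^sub>0"
    using tr unfolding faithful_normal_trace_def by (elim conjE)
  ultimately have "tr (?a + ?b) \<in> \<real>\<^sub>\<ge>\<^sub>0" using closed(3)[OF ab] by metis
  then have "0 \<le> Re (tr (?a + ?b))" by (simp add: complex_nonneg_Reals_iff)
  also have "tr (?a + ?b) = ?c * tr (adj y * y) - tr (adj (x * y) * (x * y))"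
    unfolding tr_lin(1)[OF ab] using x y by (simp only: tr_lin(2) closed) simp
  finally have "(norm (\<Lambda> (x * y)))\<^sup>2 \<le> (norm x * norm (\<Lambda> y))\<^sup>2"
    unfolding power_mult_distrib norm_\<Lambda>[OF y] norm_\<Lambda>[OF closed(4)[OF x y]]
    by (simp del: of_real_power)
  then show ?thesis by (rule power2_le_imp_le) simp
qed

private lemma norm_autpow_mult_le:
  assumes x: "x \<in> N" and y: "y \<in> N"
  shows "norm (\<Lambda> (autpow N \<theta> m x * y)) \<le> norm x * norm (\<Lambda> y)"
proof -
  let ?t = "autpow N \<theta> m"
  have t: "automorphism N ?t" by (rule automorphism_autpow[OF N \<theta>])
  have t_mult: "?t (v * w) = ?t v * ?t w" if "v \<in> N" "w \<in> N" for v w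
    using t that unfolding automorphism_def by (elim conjE) blast
  have t_adj: "?t (adj v) = adj (?t v)" if "v \<in> N" for v
    using t that unfolding automorphism_def by (elim conjE) blast
  have t_tr: "tr (?t v) = tr v" if "v \<in> N" for v
    using trace_preserving_autpow[OF N \<theta> tp, of m] that unfolding trace_preserving_def by blast
  have iso: "norm (\<Lambda> (?t z)) = norm (\<Lambda> z)" if z: "z \<in> N" for z
  proof -
    have "adj (?t z) * ?t z = ?t (adj z * z)"
      using t_mult t_adj z closed(6)[OF z] by simp
    then have "(norm (\<Lambda> (?t z)))\<^sup>2 = (norm (\<Lambda> z))\<^sup>2"
      using t_tr[OF closed(4)[OF closed(6)[OF z] z]]
      by (simp only: norm_\<Lambda>[OF automorphism_in[OF t z]] norm_\<Lambda>[OF z])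
    then show ?thesis by simp
  qed
  obtain y' where y': "y' \<in> N" "y = ?t y'"
    using t y unfolding automorphism_def bij_betw_def by blast
  have "?t x * y = ?t (x * y')" using t_mult[OF x y'(1)] y'(2) by simp
  then show ?thesis
    using norm_left_mult_le[OF x y'(1)] iso[OF y'(1)] iso[OF closed(4)[OF x y'(1)]] y'(2) by simp
qed

private lemma dense: "\<exists>y. (\<forall>k. y k \<in> N) \<and> (\<lambda>k. \<Lambda> (y k)) \<longlonglongrightarrow> \<xi>"
proof -
  have "\<xi> \<in> closure (\<Lambda> ` N)" using L2 by (simp add: is_L2_def)
  then obtain z where z: "\<forall>k. z k \<in> \<Lambda> ` N" "z \<longlonglongrightarrow> \<xi>" unfolding closure_sequential by blast
  have "\<forall>k. \<exists>v. v \<in> N \<and> z k = \<Lambda> v" using z(1) by blast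
  then obtain y where y: "\<forall>k. y k \<in> N \<and> z k = \<Lambda> (y k)" using choice by metis
  have "z = (\<lambda>k. \<Lambda> (y k))" by (rule ext) (simp add: y)
  then show ?thesis using z(2) y by blast
qed

private lemma left_mult_ext:
  assumes x: "x \<in> N" and K: "\<And>y. y \<in> N \<Longrightarrow> norm (\<Lambda> (x * y)) \<le> K * norm (\<Lambda> y)"
  shows "(\<forall>y\<in>N. app (left_mult N \<Lambda> x) (\<Lambda> y) = \<Lambda> (x * y))
       \<and> (\<forall>\<xi>. norm (app (left_mult N \<Lambda> x) \<xi>) \<le> K * norm \<xi>)"
proof -
  define R where "R \<xi> l \<longleftrightarrow> (\<exists>y. (\<forall>k. y k \<in> N) \<and> (\<lambda>k. \<Lambda> (y k)) \<longlonglongrightarrow> \<xi> \<and> (\<lambda>k. \<Lambda> (x * y k)) \<longlonglongrightarrow> l)" for \<xi> l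
  have K': "norm (\<Lambda> (x * y) - \<Lambda> (x * z)) \<le> K * norm (\<Lambda> y - \<Lambda> z)" if "y \<in> N" "z \<in> N" for y z
  proof -
    have "x * (y + (-1) *\<^sub>C z) = x * y + (-1) *\<^sub>C (x * z)"
      by (simp add: distrib_left scaleC_mult_right del: scaleC_minus1)
    then show ?thesis
      using K[of "y + (-1) *\<^sub>C z"] that x by (simp add: \<Lambda>_diff closed del: scaleC_minus1)
  qed
  have R_add: "R (\<xi> + \<xi>') (l + l')" if "R \<xi> l" "R \<xi>' l'" for \<xi> \<xi>' l l'
  proof -
    obtain y y' where y: "\<And>k. y k \<in> N" "(\<lambda>k. \<Lambda> (y k)) \<longlonglongrightarrow> \<xi>" "(\<lambda>k. \<Lambda> (x * y k)) \<longlonglongrightarrow> l"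
      and y': "\<And>k. y' k \<in> N" "(\<lambda>k. \<Lambda> (y' k)) \<longlonglongrightarrow> \<xi>'" "(\<lambda>k. \<Lambda> (x * y' k)) \<longlonglongrightarrow> l'"
      using \<open>R \<xi> l\<close> \<open>R \<xi>' l'\<close> unfolding R_def by blast
    show ?thesis unfolding R_def
      by (rule exI[of _ "\<lambda>k. y k + y' k"])
        (use tendsto_add[OF y(2) y'(2)] tendsto_add[OF y(3) y'(3)] in
          \<open>simp add: y(1) y'(1) x closed \<Lambda>_lin distrib_left\<close>)
  qed
  have bl: "bounded_linear (\<lambda>\<xi>::'l. c *\<^sub>C \<xi>)" for c by (rule bounded_linear_scaleC)
  have R_scale: "R (c *\<^sub>C \<xi>) (c *\<^sub>C l)" if R: "R \<xi> l" for c \<xi> l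
  proof -
    obtain y where y: "\<And>k. y k \<in> N" "(\<lambda>k. \<Lambda> (y k)) \<longlonglongrightarrow> \<xi>" "(\<lambda>k. \<Lambda> (x * y k)) \<longlonglongrightarrow> l"
      using R unfolding R_def by blast
    show ?thesis unfolding R_def
      by (rule exI[of _ "\<lambda>k. c *\<^sub>C y k"])
        (use bounded_linear.tendsto[OF bl y(2)] bounded_linear.tendsto[OF bl y(3)] in
          \<open>simp add: y(1) x closed \<Lambda>_lin scaleC_mult_right\<close>)
  qed
  have R_norm: "norm l \<le> K * norm \<xi>" if R: "R \<xi> l" for \<xi> l
  proof -
    obtain y where y: "\<And>k. y k \<in> N" "(\<lambda>k. \<Lambda> (y k)) \<longlonglongrightarrow> \<xi>" "(\<lambda>k. \<Lambda> (x * y k)) \<longlonglongrightarrow> l"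
      using R unfolding R_def by blast
    show ?thesis
      by (rule LIMSEQ_le[OF tendsto_norm[OF y(3)] tendsto_mult_left[OF tendsto_norm[OF y(2)]]])
        (use K y(1) in blast)
  qed
  have R_unique: "l = l'" if "R \<xi> l" "R \<xi> l'" for \<xi> l l'
    using R_norm[OF R_add[OF that(1) R_scale[OF that(2), of "-1"]]] by simp
  have R_ex: "\<exists>l. R \<xi> l" for \<xi>
  proof -
    obtain y where y: "\<And>k. y k \<in> N" "(\<lambda>k. \<Lambda> (y k)) \<longlonglongrightarrow> \<xi>" using dense by blast
    have cau: "Cauchy (\<lambda>k. \<Lambda> (y k))" using y(2) by (rule LIMSEQ_imp_Cauchy)
    have "Cauchy (\<lambda>k. \<Lambda> (x * y k))"
    proof (rule CauchyI)
      fix e :: real assume e: "e > 0"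
      define L where "L = max K 1"
      have L: "L > 0" "K \<le> L" by (auto simp: L_def)
      obtain M where M: "\<And>i j. i \<ge> M \<Longrightarrow> j \<ge> M \<Longrightarrow> norm (\<Lambda> (y i) - \<Lambda> (y j)) < e / L"
        using CauchyD[OF cau, of "e / L"] e L by auto
      have "norm (\<Lambda> (x * y i) - \<Lambda> (x * y j)) < e" if "i \<ge> M" "j \<ge> M" for i j
      proof -
        have "norm (\<Lambda> (x * y i) - \<Lambda> (x * y j)) \<le> L * norm (\<Lambda> (y i) - \<Lambda> (y j))"
          using K'[OF y(1) y(1), of i j] mult_right_mono[OF L(2) norm_ge_zero[of "\<Lambda> (y i) - \<Lambda> (y j)"]] by linarith
        also have "\<dots> < L * (e / L)" by (rule mult_strict_left_mono[OF M[OF that] L(1)])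
        finally show ?thesis using L by simp
      qed
      then show "\<exists>M. \<forall>i\<ge>M. \<forall>j\<ge>M. norm (\<Lambda> (x * y i) - \<Lambda> (x * y j)) < e" by blast
    qed
    then obtain l where "(\<lambda>k. \<Lambda> (x * y k)) \<longlonglongrightarrow> l" using convergent_eq_Cauchy convergent_def by blast
    then show ?thesis unfolding R_def using y by blast
  qed
  obtain S where S: "\<And>\<xi>. R \<xi> (S \<xi>)" using R_ex by metis
  have S_eq: "S \<xi> = l" if "R \<xi> l" for \<xi> l using R_unique[OF S that] .
  have app_S: "app (Bop S) = S"
    by (rule app_Bop[of _ K]) (use S_eq[OF R_add[OF S S]] S_eq[OF R_scale[OF S]] R_norm[OF S] in auto)
  have S_\<Lambda>: "S (\<Lambda> y) = \<Lambda> (x * y)" if "y \<in> N" for y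
    by (rule S_eq, unfold R_def, rule exI[of _ "\<lambda>_. y"]) (simp add: that)
  have "left_mult N \<Lambda> x = Bop S"
    unfolding left_mult_def
  proof (rule the_equality)
    fix T assume T: "\<forall>y\<in>N. app T (\<Lambda> y) = \<Lambda> (x * y)"
    show "T = Bop S"
    proof (rule bop_eqI)
      fix \<xi>
      obtain y where y: "\<And>k. y k \<in> N" "(\<lambda>k. \<Lambda> (y k)) \<longlonglongrightarrow> \<xi>" using dense by blast
      have "(\<lambda>k. app T (\<Lambda> (y k))) \<longlonglongrightarrow> app T \<xi>"
        by (rule bounded_linear.tendsto[OF bounded_linear_app y(2)])
      then have "R \<xi> (app T \<xi>)" unfolding R_def using y T by auto
      then show "app T \<xi> = app (Bop S) \<xi>" using S_eq app_S by simp
    qed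
  qed (simp add: app_S S_\<Lambda>)
  then show ?thesis using R_norm[OF S] by (simp add: app_S S_\<Lambda>)
qed

lemma left_mult_\<Lambda>: "x \<in> N \<Longrightarrow> y \<in> N \<Longrightarrow> app (left_mult N \<Lambda> x) (\<Lambda> y) = \<Lambda> (x * y)"
  using left_mult_ext[OF _ norm_left_mult_le] by blast

lemma norm_left_mult_autpow_le:
  "x \<in> N \<Longrightarrow> norm (app (left_mult N \<Lambda> (autpow N \<theta> m x)) \<xi>) \<le> norm x * norm \<xi>"
  using left_mult_ext[OF automorphism_in[OF automorphism_autpow[OF N \<theta>]] norm_autpow_mult_le] by blast

lemma coord_cp_rep:
  assumes x: "x \<in> N"
  shows "coord (app (cp_rep N \<theta> \<Lambda> x) \<xi>) n = app (left_mult N \<Lambda> (autpow N \<theta> (- n) x)) (coord \<xi> n)"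
proof -
  define L where "L n = left_mult N \<Lambda> (autpow N \<theta> (- n) x)" for n
  define S where "S \<xi> = Ell2Z (\<lambda>n. app (L n) (coord \<xi> n))" for \<xi>
  have le: "L2_set (\<lambda>n. norm (app (L n) (coord \<xi> n))) F \<le> norm x * norm \<xi>" if "finite F" for F \<xi>
  proof -
    have "L2_set (\<lambda>n. norm (app (L n) (coord \<xi> n))) F \<le> L2_set (\<lambda>n. norm x * norm (coord \<xi> n)) F"
      unfolding L_def by (rule L2_set_mono) (simp_all add: norm_left_mult_autpow_le x)
    also have "\<dots> = norm x * L2_set (\<lambda>n. norm (coord \<xi> n)) F"
      by (rule L2_set_right_distrib[symmetric]) simp
    also have "\<dots> \<le> norm x * norm \<xi>" by (intro mult_left_mono L2_set_coord_le that) simp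
    finally show ?thesis .
  qed
  have S: "coord (S \<xi>) n = app (L n) (coord \<xi> n)" for \<xi> n
    unfolding S_def using sq_summableI[OF le, of \<xi>] by (simp add: Ell2Z_inverse)
  have app_S: "app (Bop S) = S"
  proof (rule app_Bop)
    show "norm (S \<xi>) \<le> norm x * norm \<xi>" for \<xi>
      by (rule norm_ell2Z_le) (simp add: S le)
  qed (auto intro!: ell2Z_eqI simp: S app_add app_scaleC)
  have "cp_rep N \<theta> \<Lambda> x = Bop S"
    unfolding cp_rep_def L_def[symmetric]
  proof (rule the_equality)
    fix T assume T: "\<forall>\<xi> n. coord (app T \<xi>) n = app (L n) (coord \<xi> n)"
    show "T = Bop S" by (rule bop_eqI, rule ell2Z_eqI) (simp add: T app_S S)
  qed (simp add: app_S S)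
  then show ?thesis by (simp add: app_S S L_def)
qed

lemma cp_rep_covariant:
  assumes "x \<in> N"
  shows "cp_rep N \<theta> \<Lambda> (\<theta> x) = cp_unitary * cp_rep N \<theta> \<Lambda> x * adj cp_unitary"
proof (rule bop_eqI, rule ell2Z_eqI)
  fix \<xi> n
  have "autpow N \<theta> (- n) (\<theta> x) = autpow N \<theta> (- (n - 1)) x"
    using autpow_shift[OF \<theta> assms, of "- n"] by simp
  then show "coord (app (cp_rep N \<theta> \<Lambda> (\<theta> x)) \<xi>) n
      = coord (app (cp_unitary * cp_rep N \<theta> \<Lambda> x * adj cp_unitary) \<xi>) n"
    by (simp add: coord_cp_rep coord_cp_unitary coord_adj_cp_unitary assms automorphism_in[OF \<theta>])
qed

text \<open>If \<open>T\<close> has the (possibly infinite) Fourier series with coefficients \<open>x n\<close>, then it maps the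
  vector \<open>single 0 (\<Lambda> 1)\<close> to the square summable family \<open>\<Lambda> (\<theta>\<^sup>-\<^sup>n (x n))\<close>; its trace is \<open>tr (x 0)\<close>.\<close>

lemma cp_trace_Fourier:
  assumes "x 0 \<in> N" "\<And>n. coord (app T (single 0 (\<Lambda> 1))) n = \<Lambda> (autpow N \<theta> (- n) (x n))"
  shows "cp_trace \<Lambda> T = tr (x 0)"
  using assms(1) assms(2)[of 0] closed(1)
  by (simp add: cp_trace_def cinner_single autpow_def \<Lambda>_cinner)

lemma cp_rep_upower_vacuum:
  assumes "x \<in> N"
  shows "app (cp_rep N \<theta> \<Lambda> x * upower cp_unitary m) (single 0 (\<Lambda> 1)) = single m (\<Lambda> (autpow N \<theta> (- m) x))"
  using automorphism_in[OF automorphism_autpow[OF N \<theta>] assms, of "- m"] closed(1)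
  by (intro ell2Z_eqI) (simp add: coord_cp_rep assms coord_upower_cp_unitary coord_single left_mult_\<Lambda>)

lemma cp_trace_monomial:
  assumes "x \<in> N"
  shows "cp_trace \<Lambda> (cp_rep N \<theta> \<Lambda> x * upower cp_unitary m) = (if m = 0 then tr x else 0)"
  unfolding cp_trace_def cp_rep_upower_vacuum[OF assms]
  using assms closed(1) by (simp add: cinner_single coord_single autpow_def \<Lambda>_cinner)

end

end

theory Submission
  imports Defs
begin

text \<open>The vector \<open>\<Omega>\<close>, the class of \<open>1\<close> placed at index 0, is cyclic and separating for the crossed
  product and induces the trace, so questions about 2-norms become questions about vectors.  The
  conditional expectation onto the algebra of the shift is the strong limit of Fejer means formed
  from the scalar coefficients \<open>\<langle>T u\<^sup>j\<Omega>, u\<^sup>i\<Omega>\<rangle>\<close>; boundedness and positivity of these means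
  come from the fact that a bounded (positive) scalar matrix stays bounded (positive) when it acts on
  tuples of vectors.  On monomials the defect of the homomorphism property is exactly
  \<open>tr (a \<theta>\<^sup>k\<^sup>+\<^sup>n(b)) - tr a tr b\<close> times a unit vector, which gives the equivalence with strong
  mixing by bilinearity and 2-norm density.  If \<open>x\<close> commutes with \<open>u\<close> and \<open>y = x - E(x)\<close>, then
  \<open>E(y u\<^sup>n y\<^sup>*) = u\<^sup>n E(y y\<^sup>*)\<close> has constant 2-norm, which must vanish, so the algebra is a masa.
  Strong singularity is seen by testing on \<open>w u\<^sup>k w\<^sup>*\<close> for large \<open>k\<close>.\<close>

section \<open>Operators on a Hilbert space\<close>

text \<open>\<open>cond_exp\<close> is a definite description, so existence and uniqueness must be
  settled before anything else can be said about it. Projecting \<open>T \<Omega>\<close> onto the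
  closed span of the vectors \<open>u\<^sup>n \<Omega>\<close> is easy; the obstacle is that the
  projected vector must come from a bounded operator. Truncated Fourier series have no uniform
  operator bound, whereas the Fejer means are bounded by \<open>norm T\<close>. Strong singularity
  also involves the expectation onto a unitary conjugate of \<open>B\<close>, hence a locale for a
  general subalgebra. The generators give direct access only to the span of the monomials, while
  \<open>M\<close> is its bicommutant: right multiplications by elements of the span lie in the
  commutant and carry traciality, faithfulness and convergence from the span, or from the single
  vector \<open>\<Omega>\<close>, to all of \<open>M\<close>. Finally, the defect is controlled by
  the 2-norm of one argument and the operator norm of the other, so the two arguments are
  approximated in turn. In strong singularity the 2-norm of \<open>w - E w\<close> enters as
  \<open>sqrt (1 - r\<^sup>2)\<close>, with \<open>r\<close> the 2-norm of
  \<open>E w\<close>.\<close>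

lemma bounded_bilinear_cinner: "bounded_bilinear (cinner :: 'a::complex_hilbert \<Rightarrow> 'a \<Rightarrow> complex)"
proof
  show "\<exists>K. \<forall>x y::'a. norm (cinner x y) \<le> norm x * norm y * K"
    by (intro exI[of _ 1] allI) (simp add: cinner_Cauchy_Schwarz)
qed (simp_all add: cinner_add_left cinner_add_right scaleR_scaleC cinner_scaleC_left
    cinner_scaleC_right scaleC_complex_def)

lemmas tendsto_cinner = bounded_bilinear.tendsto[OF bounded_bilinear_cinner]

lemmas tendsto_app = bounded_linear.tendsto[OF bounded_linear_app]

lemma cinner_sum_left: "cinner (sum f F) y = (\<Sum>i\<in>F. cinner (f i) (y::'a::complex_hilbert))"
  by (rule bounded_bilinear.sum_left[OF bounded_bilinear_cinner])

lemma cinner_sum_right: "cinner y (sum f F) = (\<Sum>i\<in>F. cinner (y::'a::complex_hilbert) (f i))"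
  by (rule bounded_bilinear.sum_right[OF bounded_bilinear_cinner])

lemma scaleC_sum_left: "sum f F *\<^sub>C x = (\<Sum>i\<in>F. f i *\<^sub>C (x :: 'a::complex_vector))"
  by (induction F rule: infinite_finite_induct) (simp_all add: scaleC_add_left)

lemma scaleC_diff_left: "(c - d) *\<^sub>C x = c *\<^sub>C x - d *\<^sub>C (x :: 'a::complex_vector)"
  using scaleC_add_left[of "c - d" d x] by simp

lemma app_diff: "app T (\<xi> - \<eta>) = app T \<xi> - app T \<eta>"
  by (simp add: bounded_linear_app bounded_linear.linear linear_diff)

lemma app_sum_left: "app (sum S F) \<xi> = (\<Sum>i\<in>F. app (S i) \<xi>)"
  by (induction F rule: infinite_finite_induct) simp_all

lemma app_scaleR_left: "app (r *\<^sub>R T) \<xi> = r *\<^sub>R app T \<xi>"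
  by (simp add: scaleR_scaleC)

lemma adj_add: "adj (S + T) = adj S + adj T"
  by (rule adj_eqI) (simp add: cinner_add_left cinner_add_right cinner_adj_right)

lemma adj_diff: "adj (S - T) = adj S - adj T"
  by (rule adj_eqI) (simp add: cinner_diff_left cinner_diff_right cinner_adj_right)

section \<open>Density arguments, limits and extensions of operators\<close>

lemma closure_UNIV_sequence:
  assumes "closure D = UNIV"
  obtains y where "\<And>k. y k \<in> D" "y \<longlonglongrightarrow> (\<xi>::'a::metric_space)"
proof -
  have "\<xi> \<in> closure D" by (simp add: assms)
  then show ?thesis using that unfolding closure_sequential by blast
qed

lemma bop_eq_dense:
  assumes D: "closure D = UNIV" and eq: "\<And>\<xi>. \<xi> \<in> D \<Longrightarrow> app S \<xi> = app T \<xi>"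
  shows "S = T"
proof (rule bop_eqI)
  fix \<xi>
  obtain y where y: "\<And>k. y k \<in> D" "y \<longlonglongrightarrow> \<xi>" by (rule closure_UNIV_sequence[OF D]) blast
  have "(\<lambda>k. app S (y k)) \<longlonglongrightarrow> app T \<xi>"
    unfolding eq[OF y(1)] by (rule tendsto_app[OF y(2)])
  then show "app S \<xi> = app T \<xi>" using tendsto_app[OF y(2)] LIMSEQ_unique by blast
qed

lemma vector_eq_dense:
  assumes D: "closure D = UNIV" and eq: "\<And>\<xi>. \<xi> \<in> D \<Longrightarrow> cinner \<xi> x = cinner \<xi> y"
  shows "x = (y::'a::complex_hilbert)"
proof (rule cinner_eqI)
  fix \<xi>
  obtain z where z: "\<And>k. z k \<in> D" "z \<longlonglongrightarrow> \<xi>" by (rule closure_UNIV_sequence[OF D]) blast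
  have "(\<lambda>k. cinner (z k) x) \<longlonglongrightarrow> cinner \<xi> y"
    unfolding eq[OF z(1)] by (intro tendsto_cinner z(2) tendsto_const)
  moreover have "(\<lambda>k. cinner (z k) x) \<longlonglongrightarrow> cinner \<xi> x"
    by (intro tendsto_cinner z(2) tendsto_const)
  ultimately show "cinner \<xi> x = cinner \<xi> y" using LIMSEQ_unique by blast
qed

text \<open>The approximation is uniform in \<open>n\<close>, so the error survives the limit. This
  carries the vanishing of defects from a dense subalgebra to the whole algebra.\<close>

lemma tendsto_zero_approx:
  fixes f :: "'i \<Rightarrow> 'v::real_normed_vector"
  assumes "\<And>e. e > 0 \<Longrightarrow> \<exists>g. (g \<longlongrightarrow> 0) F \<and> (\<forall>n. norm (f n - g n) < e)"
  shows "(f \<longlongrightarrow> 0) F"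
  unfolding tendsto_iff
proof (intro allI impI)
  fix e :: real assume e: "e > 0"
  then obtain g where g: "(g \<longlongrightarrow> 0) F" "\<And>n. norm (f n - g n) < e / 2" using assms[of "e / 2"] by auto
  have "\<forall>\<^sub>F n in F. dist (g n) 0 < e / 2" by (rule tendstoD[OF g(1)]) (use e in simp)
  then show "\<forall>\<^sub>F n in F. dist (f n) 0 < e"
  proof eventually_elim
    case (elim n)
    then show ?case using g(2)[of n] norm_triangle_sub[of "f n" "g n"] by simp
  qed
qed

lemma bop_limit:
  assumes lim: "\<And>\<xi>. \<exists>l. (\<lambda>k. app (S k) \<xi>) \<longlonglongrightarrow> l" and K: "\<And>k \<xi>. norm (app (S k) \<xi>) \<le> K * norm \<xi>"
  shows "\<exists>T. \<forall>\<xi>. (\<lambda>k. app (S k) \<xi>) \<longlonglongrightarrow> app T \<xi>"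
proof -
  obtain g where g: "\<And>\<xi>. (\<lambda>k. app (S k) \<xi>) \<longlonglongrightarrow> g \<xi>" using lim by metis
  have "app (Bop g) = g"
  proof (rule app_Bop)
    fix \<xi> \<eta> c
    have "(\<lambda>k. app (S k) (\<xi> + \<eta>)) \<longlonglongrightarrow> g \<xi> + g \<eta>"
      unfolding app_add by (intro tendsto_add g)
    then show "g (\<xi> + \<eta>) = g \<xi> + g \<eta>" using g LIMSEQ_unique by blast
    have "(\<lambda>k. app (S k) (c *\<^sub>C \<xi>)) \<longlonglongrightarrow> c *\<^sub>C g \<xi>"
      unfolding app_scaleC by (intro bounded_linear.tendsto[OF bounded_linear_scaleC] g)
    then show "g (c *\<^sub>C \<xi>) = c *\<^sub>C g \<xi>" using g LIMSEQ_unique by blast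
    show "norm (g \<xi>) \<le> K * norm \<xi>"
      by (rule tendsto_upperbound[OF tendsto_norm[OF g]]) (simp_all add: K)
  qed
  then show ?thesis using g by metis
qed

text \<open>The common bound \<open>K\<close> makes the family equicontinuous, so convergence on a
  dense set spreads to every vector by splitting the error into three parts.\<close>

lemma bop_strong_limit:
  fixes S :: "nat \<Rightarrow> 'a::complex_hilbert bop"
  assumes D: "closure D = UNIV" and lim: "\<And>\<xi>. \<xi> \<in> D \<Longrightarrow> \<exists>l. (\<lambda>k. app (S k) \<xi>) \<longlonglongrightarrow> l"
    and K: "\<And>k \<xi>. norm (app (S k) \<xi>) \<le> K * norm \<xi>"
  shows "\<exists>T. \<forall>\<xi>. (\<lambda>k. app (S k) \<xi>) \<longlonglongrightarrow> app T \<xi>"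
proof (rule bop_limit[OF _ K])
  fix \<xi> :: 'a
  have "Cauchy (\<lambda>k. app (S k) \<xi>)"
  proof (rule CauchyI)
    fix e :: real assume e: "e > 0"
    \<comment> \<open>\<open>K\<close> may be zero or negative; \<open>L\<close> can safely be
      divided by.\<close>
    define L where "L = max K 1"
    have L: "L > 0" "K \<le> L" by (auto simp: L_def)
    have "\<xi> \<in> closure D" by (simp add: D)
    moreover have "e / (3 * L) > 0" using e L by simp
    ultimately obtain \<eta> where \<eta>: "\<eta> \<in> D" "dist \<eta> \<xi> < e / (3 * L)"
      unfolding closure_approachable by blast
    have near: "norm (app (S k) \<xi> - app (S k) \<eta>) < e / 3" for k
    proof -
      have "norm (app (S k) \<xi> - app (S k) \<eta>) \<le> K * norm (\<xi> - \<eta>)"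
        using K[of k "\<xi> - \<eta>"] by (simp add: app_diff)
      also have "\<dots> \<le> L * norm (\<xi> - \<eta>)" using L(2) by (rule mult_right_mono) simp
      also have "\<dots> < L * (e / (3 * L))"
        using \<eta>(2) L(1) by (intro mult_strict_left_mono) (simp_all add: dist_norm norm_minus_commute)
      finally show ?thesis using L(1) by simp
    qed
    have "Cauchy (\<lambda>k. app (S k) \<eta>)" using lim[OF \<eta>(1)] LIMSEQ_imp_Cauchy by blast
    then obtain M where M: "\<And>i j. i \<ge> M \<Longrightarrow> j \<ge> M \<Longrightarrow> norm (app (S i) \<eta> - app (S j) \<eta>) < e / 3"
      using CauchyD[of "\<lambda>k. app (S k) \<eta>" "e / 3"] e by auto
    have "norm (app (S i) \<xi> - app (S j) \<xi>) < e" if "i \<ge> M" "j \<ge> M" for i j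
    proof -
      have "app (S i) \<xi> - app (S j) \<xi>
          = (app (S i) \<xi> - app (S i) \<eta>) - (app (S j) \<xi> - app (S j) \<eta>) + (app (S i) \<eta> - app (S j) \<eta>)"
        by simp
      also have "norm \<dots> \<le> norm (app (S i) \<xi> - app (S i) \<eta>) + norm (app (S j) \<xi> - app (S j) \<eta>)
          + norm (app (S i) \<eta> - app (S j) \<eta>)"
        by (rule order_trans[OF norm_triangle_ineq]) (simp add: norm_triangle_ineq4)
      finally show ?thesis using near[of i] near[of j] M[OF that] by simp
    qed
    then show "\<exists>M. \<forall>i\<ge>M. \<forall>j\<ge>M. norm (app (S i) \<xi> - app (S j) \<xi>) < e" by blast
  qed
  then show "\<exists>l. (\<lambda>k. app (S k) \<xi>) \<longlonglongrightarrow> l" using convergent_eq_Cauchy convergent_def by blast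
qed

text \<open>Additivity and the bound make \<open>f\<close> Lipschitz on \<open>D\<close>, so it
  extends by uniform continuity. The values of \<open>f\<close> outside \<open>D\<close> are
  arbitrary.\<close>

lemma bop_extension:
  fixes f :: "'a::complex_hilbert \<Rightarrow> 'a"
  assumes D: "closure D = UNIV"
    and add: "\<And>x y. x \<in> D \<Longrightarrow> y \<in> D \<Longrightarrow> x + y \<in> D \<and> f (x + y) = f x + f y"
    and scale: "\<And>c x. x \<in> D \<Longrightarrow> c *\<^sub>C x \<in> D \<and> f (c *\<^sub>C x) = c *\<^sub>C f x"
    and K: "\<And>x. x \<in> D \<Longrightarrow> norm (f x) \<le> K * norm x"
  shows "\<exists>T. \<forall>x\<in>D. app T x = f x"
proof -
  have diff: "norm (f x - f y) \<le> K * norm (x - y)" if "x \<in> D" "y \<in> D" for x y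
    using K[of "x + (-1) *\<^sub>C y"] add[of x "(-1) *\<^sub>C y"] scale[of y "-1"] that by simp
  have uc: "uniformly_continuous_on D f"
    unfolding uniformly_continuous_on_def
  proof (intro allI impI)
    fix e :: real assume e: "e > 0"
    define L where "L = max K 1"
    have L: "L > 0" "K \<le> L" by (auto simp: L_def)
    have "dist (f y) (f x) < e" if "x \<in> D" "y \<in> D" "dist y x < e / L" for x y
    proof -
      have "dist (f y) (f x) \<le> L * dist y x"
        using diff[OF that(2,1)] mult_right_mono[OF L(2) norm_ge_zero[of "y - x"]]
        by (simp add: dist_norm)
      also have "\<dots> < L * (e / L)" by (rule mult_strict_left_mono[OF that(3) L(1)])
      finally show ?thesis using L(1) by simp
    qed
    then show "\<exists>d>0. \<forall>x\<in>D. \<forall>y\<in>D. dist y x < d \<longrightarrow> dist (f y) (f x) < e"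
      using e L(1) by (intro exI[of _ "e / L"]) simp
  qed
  obtain g where g: "uniformly_continuous_on (closure D) g" "\<And>x. x \<in> D \<Longrightarrow> f x = g x"
    using uniformly_continuous_on_extension_on_closure[OF uc] by metis
  have g_lim: "(\<lambda>k. f (z k)) \<longlonglongrightarrow> g \<xi>" if "\<And>k. z k \<in> D" "z \<longlonglongrightarrow> \<xi>" for z \<xi>
  proof -
    have "continuous_on UNIV g" using g(1) D uniformly_continuous_imp_continuous by metis
    then have "(\<lambda>k. g (z k)) \<longlonglongrightarrow> g \<xi>" using that(2) by (simp add: continuous_on_eq_continuous_at isCont_tendsto_compose)
    then show ?thesis using g(2) that(1) by simp
  qed
  have "app (Bop g) = g"
  proof (rule app_Bop)
    fix \<xi> \<eta> c
    obtain x where x: "\<And>k. x k \<in> D" "x \<longlonglongrightarrow> \<xi>" by (rule closure_UNIV_sequence[OF D]) blast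
    obtain y where y: "\<And>k. y k \<in> D" "y \<longlonglongrightarrow> \<eta>" by (rule closure_UNIV_sequence[OF D]) blast
    have "(\<lambda>k. f (x k + y k)) \<longlonglongrightarrow> g (\<xi> + \<eta>)" using add x y by (intro g_lim tendsto_add) auto
    moreover have "(\<lambda>k. f (x k + y k)) \<longlonglongrightarrow> g \<xi> + g \<eta>"
      using tendsto_add[OF g_lim[OF x] g_lim[OF y]] add x(1) y(1) by simp
    ultimately show "g (\<xi> + \<eta>) = g \<xi> + g \<eta>" by (rule LIMSEQ_unique)
    have "(\<lambda>k. f (c *\<^sub>C x k)) \<longlonglongrightarrow> g (c *\<^sub>C \<xi>)"
      using scale x by (intro g_lim bounded_linear.tendsto[OF bounded_linear_scaleC]) auto
    moreover have "(\<lambda>k. f (c *\<^sub>C x k)) \<longlonglongrightarrow> c *\<^sub>C g \<xi>"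
      using bounded_linear.tendsto[OF bounded_linear_scaleC g_lim[OF x]] scale x(1) by simp
    ultimately show "g (c *\<^sub>C \<xi>) = c *\<^sub>C g \<xi>" by (rule LIMSEQ_unique)
    show "norm (g \<xi>) \<le> K * norm \<xi>"
      by (rule LIMSEQ_le[OF tendsto_norm[OF g_lim[OF x]] tendsto_mult_left[OF tendsto_norm[OF x(2)]]])
        (use K x(1) in blast)
  qed
  then show ?thesis using g(2) by metis
qed

section \<open>Adjoints, unitaries and their integer powers\<close>

lemma norm_bop_le: "0 \<le> K \<Longrightarrow> (\<And>\<xi>. norm (app T \<xi>) \<le> K * norm \<xi>) \<Longrightarrow> norm T \<le> K"
  unfolding norm_bop.rep_eq by (rule onorm_bound)

lemma norm_app_adj: "norm (app (adj T) \<xi>) \<le> norm T * norm \<xi>"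
proof (cases "app (adj T) \<xi> = 0")
  case False
  have "(norm (app (adj T) \<xi>))\<^sup>2 = cmod (cinner (app (adj T) \<xi>) (app (adj T) \<xi>))"
    unfolding cinner_self norm_of_real by simp
  also have "\<dots> = cmod (cinner \<xi> (app T (app (adj T) \<xi>)))" by (simp only: cinner_adj_left)
  also have "\<dots> \<le> norm \<xi> * norm (app T (app (adj T) \<xi>))" by (rule cinner_Cauchy_Schwarz)
  also have "\<dots> \<le> norm \<xi> * (norm T * norm (app (adj T) \<xi>))" by (intro mult_left_mono norm_app_le) simp
  finally show ?thesis using False by (simp add: power2_eq_square mult_ac)
qed simp

lemma unitary_isometry: "unitary_op v \<Longrightarrow> cinner (app v \<xi>) (app v \<eta>) = cinner \<xi> \<eta>"
  unfolding cinner_adj_left[symmetric] app_bop_simps(1)[symmetric] by (simp add: unitary_op_def)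

lemma unitary_norm: "unitary_op v \<Longrightarrow> norm (app v \<xi>) = norm \<xi>"
  by (simp add: norm_eq_sqrt_cinner unitary_isometry)

lemma unitary_adj: "unitary_op v \<Longrightarrow> unitary_op (adj v)"
  by (simp add: unitary_op_def)

lemma unitary_mult: "unitary_op v \<Longrightarrow> unitary_op w \<Longrightarrow> unitary_op (v * w)"
  by (simp add: unitary_op_def adj_mult mult.assoc) (simp add: mult.assoc[symmetric])

lemma adj_power: "adj (v ^ k) = adj v ^ k"
  by (induction k) (simp_all add: adj_mult power_commutes)

lemma unitary_upower: "unitary_op v \<Longrightarrow> unitary_op (upower v n)"
proof -
  have "unitary_op (v ^ k)" if "unitary_op v" for v :: "'a bop" and k
    by (induction k) (simp_all add: unitary_mult that, simp add: unitary_op_def)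
  then show "unitary_op v \<Longrightarrow> unitary_op (upower v n)" by (simp add: upower_def unitary_adj)
qed

lemma adj_upower: "adj (upower v n) = upower v (- n)"
  by (simp add: upower_def adj_power)

section \<open>Commutants\<close>

lemma commutant_antimono: "S \<subseteq> T \<Longrightarrow> commutant T \<subseteq> commutant S"
  by (auto simp: commutant_def)

lemma bicommutant_subset: "S \<subseteq> commutant (commutant S)"
  by (auto simp: commutant_def)

lemma commutant_adj: "adj ` S \<subseteq> S \<Longrightarrow> adj ` commutant S \<subseteq> commutant S"
  unfolding commutant_def by (auto simp: image_subset_iff) (metis adj_adj adj_mult)

lemma von_neumann_algebra_bicommutant:
  assumes "adj ` S \<subseteq> S"
  shows "von_neumann_algebra (commutant (commutant S))"
  unfolding von_neumann_algebra_def
  by (intro conjI commutant_adj assms subset_antisym commutant_antimono bicommutant_subset)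

lemma von_neumann_algebra_hull: "von_neumann_algebra (von_neumann_algebra hull G)"
proof (rule hull_in)
  fix \<F> :: "'a bop set set" assume \<F>: "\<forall>A\<in>\<F>. von_neumann_algebra A"
  show "von_neumann_algebra (\<Inter> \<F>)"
    unfolding von_neumann_algebra_def
  proof (intro conjI subset_antisym bicommutant_subset)
    show "adj ` \<Inter> \<F> \<subseteq> \<Inter> \<F>" using \<F> unfolding von_neumann_algebra_def by blast
    have "commutant (commutant (\<Inter> \<F>)) \<subseteq> A" if "A \<in> \<F>" for A
      using \<F>[rule_format, OF that] commutant_antimono[OF commutant_antimono[of "\<Inter> \<F>" A]] that
      by (auto simp: von_neumann_algebra_def)
    then show "commutant (commutant (\<Inter> \<F>)) \<subseteq> \<Inter> \<F>" by blast
  qed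
qed

text \<open>A bicommutant is known to be a von Neumann algebra here only if the set is closed under
  \<open>adj\<close>, and \<open>G\<close> need not be. Hence the intermediate set \<open>S\<close>:
  the shift with its adjoint in one application, the span of the monomials in the other.\<close>

lemma von_neumann_algebra_hull_eq:
  assumes "G \<subseteq> S" "S \<subseteq> von_neumann_algebra hull G" "adj ` S \<subseteq> S"
  shows "von_neumann_algebra hull G = commutant (commutant S)"
proof
  show "von_neumann_algebra hull G \<subseteq> commutant (commutant S)"
    using assms bicommutant_subset by (intro hull_minimal von_neumann_algebra_bicommutant) blast
  have "commutant (commutant (von_neumann_algebra hull G)) = von_neumann_algebra hull G"
    using von_neumann_algebra_hull[of G] by (simp add: von_neumann_algebra_def)
  then show "commutant (commutant S) \<subseteq> von_neumann_algebra hull G"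
    using commutant_antimono[OF commutant_antimono[OF assms(2)]] by simp
qed

text \<open>Multiplication by a fixed operator, on either side, passes to strong limits. This keeps
  the limit of the Fejer means inside \<open>B\<close>.\<close>

lemma commutant_strong_limit:
  assumes S: "\<And>k. S k \<in> commutant X" and lim: "\<And>\<xi>. (\<lambda>k. app (S k) \<xi>) \<longlonglongrightarrow> app T \<xi>"
  shows "T \<in> commutant X"
  unfolding commutant_def
proof (intro CollectI ballI bop_eqI)
  fix x \<xi> assume "x \<in> X"
  then have "app (S k) (app x \<xi>) = app x (app (S k) \<xi>)" for k
    using S[of k] unfolding commutant_def app_bop_simps(1)[symmetric] by simp
  then have "(\<lambda>k. app x (app (S k) \<xi>)) \<longlonglongrightarrow> app T (app x \<xi>)" using lim[of "app x \<xi>"] by simp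
  then show "app (T * x) \<xi> = app (x * T) \<xi>"
    using tendsto_app[OF lim[of \<xi>], of x] LIMSEQ_unique by fastforce
qed

section \<open>Algebras with a tracial cyclic vector\<close>

definition vector_state :: "'a::complex_hilbert \<Rightarrow> 'a bop \<Rightarrow> complex" where
  "vector_state \<Omega> T = cinner (app T \<Omega>) \<Omega>"

lemma vector_state_lin [simp]:
  "vector_state \<Omega> (S + T) = vector_state \<Omega> S + vector_state \<Omega> T"
  "vector_state \<Omega> (S - T) = vector_state \<Omega> S - vector_state \<Omega> T"
  "vector_state \<Omega> (c *\<^sub>C T) = c * vector_state \<Omega> T"
  by (simp_all add: vector_state_def cinner_add_left cinner_diff_left cinner_scaleC_left)

lemma vector_state_adj: "vector_state \<Omega> (adj T) = cnj (vector_state \<Omega> T)"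
  unfolding vector_state_def cinner_adj_left by (rule cinner_commute)

lemma vector_state_mult: "vector_state \<Omega> (S * T) = cinner (app T \<Omega>) (app (adj S) \<Omega>)"
  by (simp add: vector_state_def cinner_adj_right)

lemma norm2_vector_state: "norm2 (vector_state \<Omega>) x = norm (app x \<Omega>)"
  by (simp add: norm2_def vector_state_mult cinner_self)

text \<open>No topological closedness is assumed, so that the locale applies first to the span of
  the monomials and then to its bicommutant.\<close>

locale cyclic_tracial =
  fixes A :: "'a::complex_hilbert bop set" and \<Omega> :: 'a
  assumes one: "1 \<in> A" and add: "x \<in> A \<Longrightarrow> y \<in> A \<Longrightarrow> x + y \<in> A"
    and mult: "x \<in> A \<Longrightarrow> y \<in> A \<Longrightarrow> x * y \<in> A" and scaleC: "x \<in> A \<Longrightarrow> c *\<^sub>C x \<in> A"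
    and adj: "x \<in> A \<Longrightarrow> adj x \<in> A"
    and trace: "x \<in> A \<Longrightarrow> y \<in> A \<Longrightarrow> vector_state \<Omega> (x * y) = vector_state \<Omega> (y * x)"
    and cyclic: "closure ((\<lambda>a. app a \<Omega>) ` A) = UNIV"
begin

lemma diff: "x \<in> A \<Longrightarrow> y \<in> A \<Longrightarrow> x - y \<in> A"
  using add[of x "(-1) *\<^sub>C y"] scaleC[of y "-1"] by simp

lemma cinner_adj_vacuum:
  assumes "x \<in> A" "y \<in> A"
  shows "cinner (app x \<Omega>) (app y \<Omega>) = cinner (app (adj y) \<Omega>) (app (adj x) \<Omega>)"
  using trace[OF adj[OF assms(2)] assms(1)] by (simp add: vector_state_mult)

lemma norm_adj_vacuum: "x \<in> A \<Longrightarrow> norm (app (adj x) \<Omega>) = norm (app x \<Omega>)"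
  by (simp add: norm_eq_sqrt_cinner cinner_adj_vacuum[of x x])

text \<open>By traciality the adjoint is isometric on vectors \<open>app x \<Omega>\<close>, and it
  turns the right factor \<open>y\<close> into a left factor \<open>adj y\<close>, where the
  operator norm applies.\<close>

lemma norm_mult_vacuum_right:
  assumes "x \<in> A" "y \<in> A"
  shows "norm (app (x * y) \<Omega>) \<le> norm y * norm (app x \<Omega>)"
proof -
  have "norm (app (x * y) \<Omega>) = norm (app (adj y) (app (adj x) \<Omega>))"
    using norm_adj_vacuum[OF mult[OF assms]] by (simp add: adj_mult)
  also have "\<dots> \<le> norm y * norm (app (adj x) \<Omega>)" by (rule norm_app_adj)
  finally show ?thesis by (simp add: norm_adj_vacuum assms)
qed

lemma dense_approx:
  obtains a where "\<And>k. a k \<in> A" "(\<lambda>k. app (a k) \<Omega>) \<longlonglongrightarrow> \<xi>"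
proof -
  obtain y where y: "\<And>k. y k \<in> (\<lambda>a. app a \<Omega>) ` A" "y \<longlonglongrightarrow> \<xi>"
    by (rule closure_UNIV_sequence[OF cyclic]) blast
  then have "\<forall>k. \<exists>a. a \<in> A \<and> y k = app a \<Omega>" by blast
  then obtain a where a: "\<And>k. a k \<in> A" "\<And>k. y k = app (a k) \<Omega>" by metis
  have "y = (\<lambda>k. app (a k) \<Omega>)" using a(2) by (rule ext)
  then show ?thesis using that[of a] a(1) y(2) by simp
qed

text \<open>Right multiplication by \<open>b\<close> is bounded on the dense set of vectors
  \<open>app a \<Omega>\<close> and commutes with left multiplication by \<open>A\<close>. This
  supplies enough elements of the commutant to reach any dense vector \<open>app b \<Omega>\<close>
  from \<open>\<Omega>\<close>.\<close>

lemma right_multiplication: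
  assumes b: "b \<in> A"
  obtains R where "R \<in> commutant A" "\<And>a. a \<in> A \<Longrightarrow> app R (app a \<Omega>) = app (a * b) \<Omega>"
    "app R \<Omega> = app b \<Omega>" "app (adj R) \<Omega> = app (adj b) \<Omega>"
proof -
  \<comment> \<open>An arbitrary representative is chosen; independence of the choice holds because
    \<open>app (a' - a) \<Omega> = 0\<close> forces \<open>app ((a' - a) * b) \<Omega> = 0\<close>
    by the preceding bound.\<close>
  define f where "f \<xi> = app ((SOME a. a \<in> A \<and> app a \<Omega> = \<xi>) * b) \<Omega>" for \<xi>
  have f: "f (app a \<Omega>) = app (a * b) \<Omega>" if a: "a \<in> A" for a
  proof -
    define a' where "a' = (SOME a'. a' \<in> A \<and> app a' \<Omega> = app a \<Omega>)"
    have a': "a' \<in> A" "app a' \<Omega> = app a \<Omega>"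
      using someI[of "\<lambda>a'. a' \<in> A \<and> app a' \<Omega> = app a \<Omega>" a] a by (auto simp: a'_def)
    have "norm (app ((a' - a) * b) \<Omega>) \<le> 0"
      using norm_mult_vacuum_right[OF diff[OF a'(1) a] b] a'(2) by simp
    then show ?thesis by (simp add: f_def a'_def[symmetric] left_diff_distrib)
  qed
  have "\<exists>R. \<forall>\<xi>\<in>(\<lambda>a. app a \<Omega>) ` A. app R \<xi> = f \<xi>"
  proof (rule bop_extension[OF cyclic])
    fix x y c assume "x \<in> (\<lambda>a. app a \<Omega>) ` A"
    then obtain a where a: "a \<in> A" "x = app a \<Omega>" by blast
    show "norm (f x) \<le> norm b * norm x"
      using norm_mult_vacuum_right[OF a(1) b] by (simp only: a(2) f[OF a(1)])
    have "c *\<^sub>C x = app (c *\<^sub>C a) \<Omega>" by (simp add: a(2))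
    then show "c *\<^sub>C x \<in> (\<lambda>a. app a \<Omega>) ` A \<and> f (c *\<^sub>C x) = c *\<^sub>C f x"
      using f[OF scaleC[OF a(1), of c]] f[OF a(1)] scaleC[OF a(1), of c]
      by (simp del: app_bop_simps(6) add: a(2) scaleC_mult_left) simp
    assume "y \<in> (\<lambda>a. app a \<Omega>) ` A"
    then obtain a' where a': "a' \<in> A" "y = app a' \<Omega>" by blast
    have "x + y = app (a + a') \<Omega>" by (simp add: a(2) a'(2))
    then show "x + y \<in> (\<lambda>a. app a \<Omega>) ` A \<and> f (x + y) = f x + f y"
      using f[OF add[OF a(1) a'(1)]] f[OF a(1)] f[OF a'(1)] add[OF a(1) a'(1)]
      by (simp del: app_bop_simps(4) add: a(2) a'(2) distrib_right) simp
  qed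
  then obtain R where R: "\<And>a. a \<in> A \<Longrightarrow> app R (app a \<Omega>) = app (a * b) \<Omega>" using f by force
  have "R \<in> commutant A"
    unfolding commutant_def
  proof (intro CollectI ballI bop_eq_dense[OF cyclic])
    fix c \<xi> assume c: "c \<in> A" and "\<xi> \<in> (\<lambda>a. app a \<Omega>) ` A"
    then obtain a where a: "a \<in> A" "\<xi> = app a \<Omega>" by blast
    show "app (R * c) \<xi> = app (c * R) \<xi>"
      using R[OF mult[OF c a(1)]] R[OF a(1)] by (simp add: a(2))
  qed
  moreover have "app (adj R) \<Omega> = app (adj b) \<Omega>"
  proof (rule vector_eq_dense[OF cyclic])
    fix \<xi> assume "\<xi> \<in> (\<lambda>a. app a \<Omega>) ` A"
    then obtain a where a: "a \<in> A" "\<xi> = app a \<Omega>" by blast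
    have "cinner \<xi> (app (adj R) \<Omega>) = vector_state \<Omega> (a * b)"
      by (simp add: a(2) cinner_adj_right R[OF a(1)] vector_state_def)
    also have "\<dots> = vector_state \<Omega> (b * a)" by (rule trace[OF a(1) b])
    also have "\<dots> = cinner \<xi> (app (adj b) \<Omega>)" by (simp add: vector_state_mult a(2))
    finally show "cinner \<xi> (app (adj R) \<Omega>) = cinner \<xi> (app (adj b) \<Omega>)" .
  qed
  moreover have "app R \<Omega> = app b \<Omega>" using R[OF one] by simp
  ultimately show ?thesis using R that by blast
qed

lemma bicommutant_right:
  assumes "T \<in> commutant (commutant A)" "R \<in> commutant A"
  shows "app T (app R \<xi>) = app R (app T \<xi>)"
  using assms unfolding app_bop_simps(1)[symmetric] by (simp add: commutant_def)

lemma separating: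
  assumes T: "T \<in> commutant (commutant A)" and 0: "app T \<Omega> = 0"
  shows "T = 0"
proof (rule bop_eq_dense[OF cyclic])
  fix \<xi> assume "\<xi> \<in> (\<lambda>a. app a \<Omega>) ` A"
  then obtain b where b: "b \<in> A" "\<xi> = app b \<Omega>" by blast
  obtain R where R: "R \<in> commutant A" "app R \<Omega> = app b \<Omega>" by (rule right_multiplication[OF b(1)])
  show "app T \<xi> = app 0 \<xi>"
    using bicommutant_right[OF T R(1), of \<Omega>] by (simp add: b(2) R(2) 0)
qed

text \<open>Cyclicity gives the first limit. The adjoint is isometric on \<open>A\<close>, so the
  second sequence is Cauchy, and pairing with the vectors \<open>app b \<Omega>\<close> through
  right multiplications identifies its limit. Approximating both vectors with one sequence is what
  products under the trace require.\<close>

lemma bicommutant_approx: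
  assumes T: "T \<in> commutant (commutant A)"
  obtains a where "\<And>k. a k \<in> A" "(\<lambda>k. app (a k) \<Omega>) \<longlonglongrightarrow> app T \<Omega>"
    "(\<lambda>k. app (adj (a k)) \<Omega>) \<longlonglongrightarrow> app (adj T) \<Omega>"
proof -
  obtain a where a: "\<And>k. a k \<in> A" "(\<lambda>k. app (a k) \<Omega>) \<longlonglongrightarrow> app T \<Omega>" by (rule dense_approx) blast
  have "norm (app (adj (a i)) \<Omega> - app (adj (a j)) \<Omega>) = norm (app (a i) \<Omega> - app (a j) \<Omega>)" for i j
    using norm_adj_vacuum[OF diff[OF a(1) a(1)], of i j] by (simp add: adj_diff)
  then have "Cauchy (\<lambda>k. app (adj (a k)) \<Omega>)"
    using LIMSEQ_imp_Cauchy[OF a(2)] by (simp add: Cauchy_iff)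
  then obtain \<eta> where \<eta>: "(\<lambda>k. app (adj (a k)) \<Omega>) \<longlonglongrightarrow> \<eta>"
    using convergent_eq_Cauchy convergent_def by blast
  have "\<eta> = app (adj T) \<Omega>"
  proof (rule vector_eq_dense[OF cyclic])
    fix \<xi> assume "\<xi> \<in> (\<lambda>a. app a \<Omega>) ` A"
    then obtain b where b: "b \<in> A" "\<xi> = app b \<Omega>" by blast
    obtain R where R: "R \<in> commutant A" "app R \<Omega> = app b \<Omega>" "app (adj R) \<Omega> = app (adj b) \<Omega>"
      by (rule right_multiplication[OF b(1)])
    have "cinner \<xi> (app (adj (a k)) \<Omega>) = cinner (app (a k) \<Omega>) (app (adj b) \<Omega>)" for k
      using cinner_adj_vacuum[OF b(1) adj[OF a(1)]] by (simp add: b(2))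
    then have "(\<lambda>k. cinner \<xi> (app (adj (a k)) \<Omega>)) \<longlonglongrightarrow> cinner (app T \<Omega>) (app (adj b) \<Omega>)"
      by (simp add: tendsto_cinner a(2))
    moreover have "(\<lambda>k. cinner \<xi> (app (adj (a k)) \<Omega>)) \<longlonglongrightarrow> cinner \<xi> \<eta>"
      by (intro tendsto_cinner \<eta> tendsto_const)
    moreover have "cinner (app T \<Omega>) (app (adj b) \<Omega>) = cinner \<xi> (app (adj T) \<Omega>)"
      unfolding R(3)[symmetric] cinner_adj_right bicommutant_right[OF T R(1), symmetric]
      by (simp add: R(2) b(2))
    ultimately show "cinner \<xi> \<eta> = cinner \<xi> (app (adj T) \<Omega>)" using LIMSEQ_unique by fastforce
  qed
  then show ?thesis using that a \<eta> by blast
qed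

text \<open>\<open>vector_state \<Omega> (S * T)\<close> pairs \<open>app T \<Omega>\<close> with
  \<open>app (adj S) \<Omega>\<close>, and both vectors are limits of their counterparts from
  \<open>A\<close>.\<close>

lemma bicommutant_trace:
  assumes S: "S \<in> commutant (commutant A)" and T: "T \<in> commutant (commutant A)"
  shows "vector_state \<Omega> (S * T) = vector_state \<Omega> (T * S)"
proof -
  obtain a where a: "\<And>k. a k \<in> A" "(\<lambda>k. app (a k) \<Omega>) \<longlonglongrightarrow> app S \<Omega>"
    "(\<lambda>k. app (adj (a k)) \<Omega>) \<longlonglongrightarrow> app (adj S) \<Omega>" using bicommutant_approx[OF S] by blast
  obtain b where b: "\<And>k. b k \<in> A" "(\<lambda>k. app (b k) \<Omega>) \<longlonglongrightarrow> app T \<Omega>"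
    "(\<lambda>k. app (adj (b k)) \<Omega>) \<longlonglongrightarrow> app (adj T) \<Omega>" using bicommutant_approx[OF T] by blast
  have "(\<lambda>k. vector_state \<Omega> (a k * b k)) \<longlonglongrightarrow> vector_state \<Omega> (S * T)"
    unfolding vector_state_mult by (intro tendsto_cinner a b)
  moreover have "(\<lambda>k. vector_state \<Omega> (b k * a k)) \<longlonglongrightarrow> vector_state \<Omega> (T * S)"
    unfolding vector_state_mult by (intro tendsto_cinner a b)
  ultimately show ?thesis unfolding trace[OF a(1) b(1)] by (rule LIMSEQ_unique)
qed

lemma cyclic_tracial_bicommutant: "cyclic_tracial (commutant (commutant A)) \<Omega>"
proof -
  have "adj ` A \<subseteq> A" using adj by blast
  note c = von_neumann_algebra_closed[OF von_neumann_algebra_bicommutant[OF this]]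
  have "closure ((\<lambda>a. app a \<Omega>) ` A) \<subseteq> closure ((\<lambda>a. app a \<Omega>) ` commutant (commutant A))"
    by (intro closure_mono image_mono bicommutant_subset)
  then have "closure ((\<lambda>a. app a \<Omega>) ` commutant (commutant A)) = UNIV"
    unfolding cyclic by (simp add: top.extremum_unique)
  then show ?thesis by unfold_locales (simp_all add: c bicommutant_trace)
qed

text \<open>Convergence at the one vector \<open>\<Omega>\<close> suffices: right multiplications
  commute with every \<open>S k\<close> and move the convergence to a dense set.\<close>

lemma bounded_limit:
  assumes S: "\<And>k. S k \<in> commutant (commutant A)" and K: "\<And>k \<xi>. norm (app (S k) \<xi>) \<le> K * norm \<xi>"
    and lim: "(\<lambda>k. app (S k) \<Omega>) \<longlonglongrightarrow> \<eta>"
  shows "\<exists>T. \<forall>\<xi>. (\<lambda>k. app (S k) \<xi>) \<longlonglongrightarrow> app T \<xi>"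
proof (rule bop_strong_limit[OF cyclic _ K])
  fix \<xi> assume "\<xi> \<in> (\<lambda>a. app a \<Omega>) ` A"
  then obtain b where b: "b \<in> A" "\<xi> = app b \<Omega>" by blast
  obtain R where R: "R \<in> commutant A" "app R \<Omega> = app b \<Omega>" by (rule right_multiplication[OF b(1)])
  have "app (S k) \<xi> = app R (app (S k) \<Omega>)" for k
    using bicommutant_right[OF S R(1), of k \<Omega>] by (simp add: b(2) R(2))
  then show "\<exists>l. (\<lambda>k. app (S k) \<xi>) \<longlonglongrightarrow> l" using tendsto_app[OF lim, of R] by auto
qed

end

section \<open>Conditional expectations\<close>

lemma pos_op_conj: "pos_op T \<Longrightarrow> pos_op (S * T * adj S)"
proof -
  have "cinner (app (S * T * adj S) \<xi>) \<xi> = cinner (app T (app (adj S) \<xi>)) (app (adj S) \<xi>)" for \<xi>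
    by (simp add: cinner_adj_right)
  then show "pos_op T \<Longrightarrow> pos_op (S * T * adj S)"
    by (simp del: app_bop_simps add: pos_op_def)
qed

lemma pos_op_adj_mult: "pos_op (adj T * T)"
  by (simp add: pos_op_iff cinner_adj_left cinner_self del: of_real_power)

text \<open>An element \<open>y\<close> of \<open>A\<close> as in the assumption \<open>ex\<close> is the image of \<open>x\<close> under the trace
  preserving conditional expectation.\<close>

locale expectation = cyclic_tracial M \<Omega> for M :: "'a::complex_hilbert bop set" and \<Omega> +
  fixes A
  assumes unit: "norm \<Omega> = 1"
    and sub: "A \<subseteq> M" and sub_one: "1 \<in> A" and sub_add: "x \<in> A \<Longrightarrow> y \<in> A \<Longrightarrow> x + y \<in> A"
    and sub_mult: "x \<in> A \<Longrightarrow> y \<in> A \<Longrightarrow> x * y \<in> A" and sub_scaleC: "x \<in> A \<Longrightarrow> c *\<^sub>C x \<in> A"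
    and sub_adj: "x \<in> A \<Longrightarrow> adj x \<in> A"
    and ex: "x \<in> M \<Longrightarrow> \<exists>y\<in>A. (\<forall>c\<in>A. vector_state \<Omega> (c * y) = vector_state \<Omega> (c * x)) \<and> (pos_op x \<longrightarrow> pos_op y)"
begin

abbreviation "\<tau> \<equiv> vector_state \<Omega>"
abbreviation "E \<equiv> cond_exp M \<tau> A"

lemma inM: "x \<in> A \<Longrightarrow> x \<in> M" using sub by blast

lemma faithful: "x \<in> M \<Longrightarrow> app x \<Omega> = 0 \<Longrightarrow> x = 0"
  using separating bicommutant_subset by blast

text \<open>Testing with \<open>c = adj (y - z)\<close> shows that \<open>y - z\<close> kills
  \<open>\<Omega>\<close>, which is separating.\<close>

lemma expectation_unique:
  assumes "y \<in> A" "z \<in> A" "\<And>c. c \<in> A \<Longrightarrow> \<tau> (c * y) = \<tau> (c * z)"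
  shows "y = z"
proof -
  have "y + (-1) *\<^sub>C z \<in> A" by (intro sub_add sub_scaleC assms)
  then have d: "y - z \<in> A" by simp
  have "cinner (app (y - z) \<Omega>) (app (y - z) \<Omega>) = \<tau> (adj (y - z) * (y - z))"
    by (simp only: vector_state_mult adj_adj)
  also have "\<dots> = 0" using assms(3)[OF sub_adj[OF d]] by (simp add: right_diff_distrib)
  finally have "app (y - z) \<Omega> = 0" unfolding cinner_self by simp
  then show ?thesis using faithful[OF inM[OF d]] by simp
qed

lemma \<tau>_rotate: "x \<in> M \<Longrightarrow> y \<in> M \<Longrightarrow> z \<in> M \<Longrightarrow> \<tau> (x * (y * z)) = \<tau> (z * (x * y))"
  using trace[of "x * y" z] mult by (simp add: mult.assoc)

text \<open>Resolves the definite description. The elements given by \<open>ex\<close> form a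
  function \<open>F\<close> with all the required properties, and any competitor \<open>G\<close>
  satisfies the same trace identities, by its bimodule property and trace preservation, hence equals
  \<open>F\<close>.\<close>

lemma cond_exp_spec:
  assumes x: "x \<in> M"
  shows "E x \<in> A" "\<And>c. c \<in> A \<Longrightarrow> \<tau> (c * E x) = \<tau> (c * x)" "pos_op x \<Longrightarrow> pos_op (E x)"
proof -
  define P where "P x y \<longleftrightarrow> y \<in> A \<and> (\<forall>c\<in>A. \<tau> (c * y) = \<tau> (c * x)) \<and> (pos_op x \<longrightarrow> pos_op y)" for x y
  define F where "F = restrict (\<lambda>x. SOME y. P x y) M"
  have F: "P x (F x)" if "x \<in> M" for x
    using someI_ex[of "P x"] ex[OF that] that by (auto simp: F_def P_def)
  have F_in: "F x \<in> A" "F x \<in> M" if "x \<in> M" for x using F[OF that] inM by (auto simp: P_def)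
  have F_tr: "\<tau> (c * F x) = \<tau> (c * x)" if "x \<in> M" "c \<in> A" for x c using F[OF that(1)] that(2) by (auto simp: P_def)
  have F_eq: "F x = y" if "x \<in> M" "y \<in> A" "\<And>c. c \<in> A \<Longrightarrow> \<tau> (c * y) = \<tau> (c * x)" for x y
    using expectation_unique[OF F_in(1)[OF that(1)] that(2)] F_tr[OF that(1)] that(3) by simp
  have bimod: "F (a * x * b) = a * F x * b" if "x \<in> M" "a \<in> A" "b \<in> A" for x a b
  proof (rule F_eq)
    fix c assume c: "c \<in> A"
    \<comment> \<open>The right factor \<open>b\<close> is rotated to the front under the trace,
      where it joins the test element.\<close>
    have "\<tau> (c * (a * F x * b)) = \<tau> (b * (c * a) * F x)"
      using \<tau>_rotate[of "c * a" "F x" b] that c F_in inM mult by (simp add: mult.assoc)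
    also have "\<dots> = \<tau> (b * (c * a) * x)" by (rule F_tr) (simp_all add: that c sub_mult)
    also have "\<dots> = \<tau> (c * (a * x * b))"
      using \<tau>_rotate[of "c * a" x b] that c inM mult by (simp add: mult.assoc)
    finally show "\<tau> (c * (a * F x * b)) = \<tau> (c * (a * x * b))" .
  qed (simp_all add: that inM mult sub_mult F_in)
  have lin: "clinear_on M F"
    unfolding clinear_on_def
    by (intro conjI ballI allI F_eq)
      (simp_all add: add scaleC sub_add sub_scaleC F_in F_tr distrib_left scaleC_mult_right)
  have good: "F \<in> extensional M" "conditional_expectation M A F" "\<And>x. x \<in> M \<Longrightarrow> \<tau> (F x) = \<tau> x"
  proof -
    show "F \<in> extensional M" by (simp add: F_def)
    show "conditional_expectation M A F"
      unfolding conditional_expectation_def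
      using lin F F_in bimod F_eq inM by (auto simp: P_def)
    show "\<tau> (F x) = \<tau> x" if "x \<in> M" for x using F_tr[OF that sub_one] by simp
  qed
  have "E = F"
    unfolding cond_exp_def
  proof (rule the_equality)
    fix G assume G: "G \<in> extensional M \<and> conditional_expectation M A G \<and> (\<forall>x\<in>M. \<tau> (G x) = \<tau> x)"
    show "G = F"
    proof (rule extensionalityI)
      fix x assume x: "x \<in> M"
      have "F x = G x"
      proof (rule F_eq[OF x])
        show "G x \<in> A" using G x by (auto simp: conditional_expectation_def)
        fix c assume c: "c \<in> A"
        have "G (c * x * 1) = c * G x * 1"
          using G x c sub_one unfolding conditional_expectation_def by blast
        then show "\<tau> (c * G x) = \<tau> (c * x)" using G x c inM mult[of c x] by (metis mult.right_neutral)
      qed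
      then show "G x = F x" by simp
    qed (use G good in auto)
  qed (use good in auto)
  then show "E x \<in> A" "\<And>c. c \<in> A \<Longrightarrow> \<tau> (c * E x) = \<tau> (c * x)" "pos_op x \<Longrightarrow> pos_op (E x)"
    using F[OF x] by (auto simp: P_def)
qed

section \<open>Rules for computing with the conditional expectation\<close>

lemma cond_exp_M: "x \<in> M \<Longrightarrow> E x \<in> M"
  using cond_exp_spec(1) inM by blast

lemma cond_exp_eqI:
  assumes "x \<in> M" "y \<in> A" "\<And>c. c \<in> A \<Longrightarrow> \<tau> (c * y) = \<tau> (c * x)"
  shows "E x = y"
  by (rule expectation_unique) (simp_all add: assms cond_exp_spec)

lemma cond_exp_add: "x \<in> M \<Longrightarrow> y \<in> M \<Longrightarrow> E (x + y) = E x + E y"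
  by (rule cond_exp_eqI) (simp_all add: add sub_add cond_exp_spec distrib_left)

lemma cond_exp_scaleC: "x \<in> M \<Longrightarrow> E (c *\<^sub>C x) = c *\<^sub>C E x"
  by (rule cond_exp_eqI) (simp_all add: scaleC sub_scaleC cond_exp_spec scaleC_mult_right)

lemma cond_exp_diff: "x \<in> M \<Longrightarrow> y \<in> M \<Longrightarrow> E (x - y) = E x - E y"
  using cond_exp_add[of x "(-1) *\<^sub>C y"] cond_exp_scaleC[of y "-1"] scaleC[of y "-1"] by simp

lemma cond_exp_id: "x \<in> A \<Longrightarrow> E x = x"
  by (rule cond_exp_eqI) (simp_all add: inM)

lemma cond_exp_adj:
  assumes "x \<in> M" shows "E (adj x) = adj (E x)"
proof (rule cond_exp_eqI)
  fix c assume c: "c \<in> A"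
  have "\<tau> (c * adj y) = cnj (\<tau> (adj c * y))" if "y \<in> M" for y
    using trace[OF adj[OF that] inM[OF c]]
    by (simp add: vector_state_adj[symmetric] adj_mult)
  then show "\<tau> (c * adj (E x)) = \<tau> (c * adj x)"
    using c assms by (simp add: cond_exp_M cond_exp_spec sub_adj)
qed (simp_all add: assms adj sub_adj cond_exp_spec)

lemma cond_exp_left:
  assumes "a \<in> A" "x \<in> M" shows "E (a * x) = a * E x"
proof (rule cond_exp_eqI)
  fix c assume "c \<in> A"
  then show "\<tau> (c * (a * E x)) = \<tau> (c * (a * x))"
    using cond_exp_spec(2)[OF assms(2), of "c * a"] assms sub_mult by (simp add: mult.assoc)
qed (simp_all add: assms inM mult sub_mult cond_exp_spec)

lemma cond_exp_right: "a \<in> A \<Longrightarrow> x \<in> M \<Longrightarrow> E (x * a) = E x * a"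
  using cond_exp_adj[of "adj a * adj x"] cond_exp_left[of "adj a" "adj x"] cond_exp_adj[of x]
  by (simp add: inM mult adj sub_adj adj_mult)

lemma trace_cond_exp: "x \<in> M \<Longrightarrow> \<tau> (E x) = \<tau> x"
  using cond_exp_spec(2)[OF _ sub_one] by simp

lemma cond_exp_Pythagoras:
  assumes x: "x \<in> M"
  shows "(norm (app (x - E x) \<Omega>))\<^sup>2 = (norm (app x \<Omega>))\<^sup>2 - (norm (app (E x) \<Omega>))\<^sup>2"
proof -
  have "cinner (app x \<Omega>) (app (E x) \<Omega>) = \<tau> (adj (E x) * x)" by (simp add: vector_state_mult)
  also have "\<dots> = \<tau> (adj (E x) * E x)" using x by (simp add: cond_exp_spec sub_adj)
  also have "\<dots> = complex_of_real ((norm (app (E x) \<Omega>))\<^sup>2)" by (simp only: vector_state_mult adj_adj cinner_self)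
  finally show ?thesis by (simp add: norm_diff_square del: of_real_power)
qed

lemma norm_cond_exp_vacuum_le:
  assumes "x \<in> M" shows "norm (app (E x) \<Omega>) \<le> norm (app x \<Omega>)"
proof (rule power2_le_imp_le)
  show "(norm (app (E x) \<Omega>))\<^sup>2 \<le> (norm (app x \<Omega>))\<^sup>2"
    using zero_le_power2[of "norm (app (x - E x) \<Omega>)"] unfolding cond_exp_Pythagoras[OF assms] by linarith
qed simp

text \<open>Kadison's inequality \<open>E(x)\<^sup>* E(x) \<le> E(x\<^sup>* x)\<close>, applied to a unitary.\<close>

lemma norm_cond_exp_unitary:
  assumes w: "w \<in> M" "unitary_op w"
  shows "norm (app (E w) \<xi>) \<le> norm \<xi>"
proof -
  let ?d = "w - E w"
  have d: "?d \<in> M" using w by (simp add: diff cond_exp_M)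
  have aw: "adj (E w) \<in> A" using w by (simp add: sub_adj cond_exp_spec)
  have 1: "E (adj w * w) = 1" using w(2) cond_exp_id[OF sub_one] by (simp add: unitary_op_def)
  \<comment> \<open>Since \<open>adj w * w = 1\<close>, the bimodule property collapses the four
    terms to \<open>1 - adj (E w) * E w\<close>, and positivity of \<open>E\<close> makes this
    positive.\<close>
  have "E (adj ?d * ?d) = E (adj w * w - adj w * E w - (adj (E w) * w - adj (E w) * E w))"
    by (simp add: adj_diff algebra_simps)
  also have "\<dots> = E (adj w * w) - E (adj w * E w) - (E (adj (E w) * w) - E (adj (E w) * E w))"
    using w(1) by (simp add: cond_exp_diff mult adj cond_exp_M diff)
  also have "\<dots> = 1 - adj (E w) * E w"
    using w(1) aw by (simp add: 1 cond_exp_right cond_exp_left cond_exp_adj cond_exp_spec adj cond_exp_id sub_mult)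
  finally have "pos_op (1 - adj (E w) * E w)"
    using cond_exp_spec(3)[OF mult[OF adj[OF d] d] pos_op_adj_mult] by simp
  then have "0 \<le> Re (cinner (app (1 - adj (E w) * E w) \<xi>) \<xi>)" unfolding pos_op_iff by blast
  then have "(norm (app (E w) \<xi>))\<^sup>2 \<le> (norm \<xi>)\<^sup>2"
    by (simp add: cinner_diff_left cinner_adj_left cinner_self del: of_real_power)
  then show ?thesis by (rule power2_le_imp_le) simp
qed

text \<open>The expectation onto the conjugate algebra is
  \<open>x \<mapsto> w * E (adj w * x * w) * adj w\<close>; rotating \<open>w\<close> around the
  trace verifies its defining identities.\<close>

lemma expectation_conj:
  assumes w: "w \<in> M" "unitary_op w"
  shows "expectation M \<Omega> ((\<lambda>a. w * a * adj w) ` A)"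
proof unfold_locales
  have ww: "adj w * w = 1" "adj w * (w * z) = z" "w * adj w = 1" "w * (adj w * z) = z" for z
    using w(2) by (simp_all add: unitary_op_def mult.assoc[symmetric])
  let ?A = "(\<lambda>a. w * a * adj w) ` A"
  show "norm \<Omega> = 1" by (rule unit)
  show "?A \<subseteq> M" using w(1) by (auto simp: mult adj inM)
  show "1 \<in> ?A" by (rule image_eqI[of _ _ 1]) (simp_all add: ww sub_one)
  fix x c assume x: "x \<in> ?A"
  then obtain a where a: "a \<in> A" "x = w * a * adj w" by blast
  show "c *\<^sub>C x \<in> ?A"
    by (rule image_eqI[of _ _ "c *\<^sub>C a"]) (simp_all add: a sub_scaleC scaleC_mult_left scaleC_mult_right)
  show "adj x \<in> ?A"
    by (rule image_eqI[of _ _ "adj a"]) (simp_all add: a sub_adj adj_mult mult.assoc)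
  fix y assume "y \<in> ?A"
  then obtain b where b: "b \<in> A" "y = w * b * adj w" by blast
  show "x + y \<in> ?A"
    by (rule image_eqI[of _ _ "a + b"]) (simp_all add: a b sub_add algebra_simps)
  show "x * y \<in> ?A"
    by (rule image_eqI[of _ _ "a * b"]) (simp_all add: a b sub_mult mult.assoc ww)
next
  have ww: "adj w * w = 1" "adj w * (w * z) = z" "w * adj w = 1" "w * (adj w * z) = z" for z
    using w(2) by (simp_all add: unitary_op_def mult.assoc[symmetric])
  let ?A = "(\<lambda>a. w * a * adj w) ` A"
  fix x assume x: "x \<in> M"
  let ?z = "adj w * x * w"
  have z: "?z \<in> M" using x w by (simp add: mult adj)
  show "\<exists>y\<in>?A. (\<forall>c\<in>?A. \<tau> (c * y) = \<tau> (c * x)) \<and> (pos_op x \<longrightarrow> pos_op y)"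
  proof (intro bexI[of _ "w * E ?z * adj w"] conjI ballI impI)
    fix c assume "c \<in> ?A"
    then obtain a where a: "a \<in> A" "c = w * a * adj w" by blast
    have "\<tau> (c * (w * E ?z * adj w)) = \<tau> (w * ((a * E ?z) * adj w))" by (simp add: a(2) mult.assoc ww)
    also have "\<dots> = \<tau> (a * E ?z)"
      using \<tau>_rotate[of w "a * E ?z" "adj w"] a(1) z w by (simp add: inM mult adj cond_exp_M ww)
    also have "\<dots> = \<tau> (a * ?z)" using z a(1) by (simp add: cond_exp_spec)
    also have "\<dots> = \<tau> (w * a * adj w * x)"
      using trace[of "a * (adj w * x)" w] a(1) x w by (simp add: inM mult adj mult.assoc)
    finally show "\<tau> (c * (w * E ?z * adj w)) = \<tau> (c * x)" by (simp only: a(2))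
  next
    assume "pos_op x"
    then have "pos_op ?z" using pos_op_conj[of x "adj w"] by simp
    then show "pos_op (w * E ?z * adj w)" by (intro pos_op_conj cond_exp_spec(3) z)
  qed (simp add: z cond_exp_spec)
qed

end

section \<open>Consequences of the asymptotic homomorphism property\<close>

lemma filterlim_int_at_top_abs: "filterlim int (filtercomap abs at_top) sequentially"
  unfolding filterlim_filtercomap_iff by (simp add: filterlim_int_sequentially comp_def)

lemma (in expectation) asymptotic_homomorphism_sequence:
  assumes "asymptotic_homomorphism M \<tau> A v" "x \<in> M" "y \<in> M"
  shows "(\<lambda>k. norm (app (E (x * upower v (int k) * y) - E x * upower v (int k) * E y) \<Omega>)) \<longlonglongrightarrow> 0"
  using assms filterlim_compose[OF _ filterlim_int_at_top_abs]
  unfolding asymptotic_homomorphism_def norm2_vector_state by blast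

lemma (in expectation) upower_in:
  assumes "v \<in> A" shows "upower v n \<in> A"
proof -
  have "v ^ k \<in> A" if "v \<in> A" for v k
    by (induction k) (simp_all add: sub_one sub_mult that)
  then show ?thesis using assms sub_adj by (simp add: upower_def)
qed

text \<open>The test element \<open>X k\<close> is a unitary of the conjugate algebra, so the other
  expectation fixes it and the difference has 2-norm squared \<open>1\<close> minus that of
  \<open>E (X k)\<close>. Asymptotically \<open>E (X k)\<close> is
  \<open>E w * v\<^sup>k * E (adj w)\<close>, whose 2-norm is at most that of \<open>E w\<close>
  because \<open>E w\<close> is a contraction.\<close>

theorem (in expectation) asymptotic_homomorphism_imp_strongly_singular:
  assumes v: "v \<in> A" "unitary_op v" and ah: "asymptotic_homomorphism M \<tau> A v"
  shows "strongly_singular M \<tau> A"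
  unfolding strongly_singular_def norm2_vector_state
proof (intro ballI impI)
  fix w assume w: "w \<in> M" "unitary_op w"
  let ?A' = "(\<lambda>a. w * a * adj w) ` A"
  interpret conj: expectation M \<Omega> ?A' by (rule expectation_conj[OF w])
  define X where "X k = w * upower v (int k) * adj w" for k
  define s where "s = norm_inf2 M \<tau> (\<lambda>x. E x - cond_exp M \<tau> ?A' x)"
  let ?r = "norm (app (E w) \<Omega>)"
  define d where "d k = norm (app (E (X k) - E w * upower v (int k) * E (adj w)) \<Omega>)" for k
  have X: "X k \<in> M" "X k \<in> ?A'" "unitary_op (X k)" for k
    using upower_in[OF v(1), of "int k"] w unitary_upower[OF v(2), of "int k"]
    by (auto simp: X_def inM mult adj unitary_mult unitary_adj)
  have "d \<longlonglongrightarrow> 0"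
    unfolding d_def X_def by (rule asymptotic_homomorphism_sequence[OF ah w(1) adj[OF w(1)]])
  have E_le: "norm (app (E (X k)) \<Omega>) \<le> d k + ?r" for k
  proof -
    have "norm (app (E w * upower v (int k) * E (adj w)) \<Omega>) \<le> norm (app (E (adj w)) \<Omega>)"
      using norm_cond_exp_unitary[OF w, of "app (upower v (int k)) (app (E (adj w)) \<Omega>)"]
      by (simp add: unitary_norm[OF unitary_upower[OF v(2)]])
    also have "\<dots> = ?r" using w(1) by (simp add: cond_exp_adj norm_adj_vacuum cond_exp_M)
    finally show ?thesis
      using norm_triangle_sub[of "app (E (X k)) \<Omega>" "app (E w * upower v (int k) * E (adj w)) \<Omega>"]
      by (simp add: d_def)
  qed
  have "ereal (sqrt (1 - (d k + ?r)\<^sup>2)) \<le> s" for k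
  proof -
    have "(norm (app (E (X k)) \<Omega>))\<^sup>2 \<le> (d k + ?r)\<^sup>2" by (intro power_mono E_le) simp
    then have "1 - (d k + ?r)\<^sup>2 \<le> (norm (app (X k - E (X k)) \<Omega>))\<^sup>2"
      unfolding cond_exp_Pythagoras[OF X(1)] by (simp add: unitary_norm[OF X(3)] unit)
    \<comment> \<open>For small \<open>k\<close> the radicand may be negative; \<open>sqrt\<close>
      is then negative too and the bound is trivial.\<close>
    then have "sqrt (1 - (d k + ?r)\<^sup>2) \<le> norm (app (X k - E (X k)) \<Omega>)"
      by (intro real_le_lsqrt) simp_all
    also have "\<dots> = norm (app (E (X k) - cond_exp M \<tau> ?A' (X k)) \<Omega>)"
      by (simp add: conj.cond_exp_id[OF X(2)] norm_minus_commute)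
    finally have "ereal (sqrt (1 - (d k + ?r)\<^sup>2)) \<le> ereal (norm2 \<tau> (E (X k) - cond_exp M \<tau> ?A' (X k)))"
      by (simp add: norm2_vector_state)
    also have "\<dots> \<le> s"
      unfolding s_def norm_inf2_def
    proof (rule SUP_upper)
      have "norm (X k) \<le> 1" by (rule norm_bop_le) (simp_all add: unitary_norm[OF X(3)])
      then show "X k \<in> {x \<in> M. norm x \<le> 1}" using X(1) by simp
    qed
    finally show ?thesis .
  qed
  moreover have "(\<lambda>k. ereal (sqrt (1 - (d k + ?r)\<^sup>2))) \<longlonglongrightarrow> ereal (sqrt (1 - (0 + ?r)\<^sup>2))"
    by (intro tendsto_ereal tendsto_real_sqrt tendsto_diff tendsto_const tendsto_power tendsto_add
        \<open>d \<longlonglongrightarrow> 0\<close>)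
  ultimately have "ereal (sqrt (1 - (0 + ?r)\<^sup>2)) \<le> s"
    by (intro tendsto_upperbound[of "\<lambda>k. ereal (sqrt (1 - (d k + ?r)\<^sup>2))"]) auto
  moreover have "norm (app (w - E w) \<Omega>) = sqrt (1 - ?r\<^sup>2)"
    using cond_exp_Pythagoras[OF w(1)] by (simp add: unitary_norm[OF w(2)] unit real_sqrt_unique)
  ultimately show "ereal (norm (app (w - E w) \<Omega>)) \<le> norm_inf2 M \<tau> (\<lambda>x. E x - cond_exp M \<tau> ?A' x)"
    unfolding s_def by simp
qed

theorem (in expectation) asymptotic_homomorphism_imp_masa:
  assumes v: "v \<in> A" "unitary_op v" and ab: "abelian A" and ah: "asymptotic_homomorphism M \<tau> A v"
  shows "masa M A"
proof -
  have sa: "selfadjoint_subalgebra A"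
    using sub_scaleC[OF sub_one, of 0]
    by (simp add: selfadjoint_subalgebra_def sub_add sub_mult sub_scaleC sub_adj)
  moreover have "C = A" if C: "selfadjoint_subalgebra C" "abelian C" "C \<subseteq> M" "A \<subseteq> C" for C
  proof (rule antisym[OF _ C(4)], rule subsetI)
    fix x assume xC: "x \<in> C"
    have x: "x \<in> M" using xC C(3) by blast
    define y where "y = x - E x"
    have y: "y \<in> M" by (simp add: y_def diff x cond_exp_M)
    have yv: "y * upower v n = upower v n * y" for n
    proof -
      have "x * upower v n = upower v n * x" "E x * upower v n = upower v n * E x"
        using C(2,4) ab xC upower_in[OF v(1), of n] cond_exp_spec(1)[OF x] by (auto simp: abelian_def)
      then show ?thesis by (simp add: y_def algebra_simps)
    qed
    have Ey: "E y = 0"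
      using x by (simp add: y_def cond_exp_diff cond_exp_M cond_exp_id cond_exp_spec)
    have yy: "y * adj y \<in> M" using y by (simp add: mult adj)
    have "norm (app (E (y * upower v (int k) * adj y) - E y * upower v (int k) * E (adj y)) \<Omega>)
        = norm (app (E (y * adj y)) \<Omega>)" for k
      using cond_exp_left[OF upower_in[OF v(1)] yy, of "int k"]
      by (simp add: yv Ey mult.assoc unitary_norm[OF unitary_upower[OF v(2)]])
    then have "norm (app (E (y * adj y)) \<Omega>) = 0"
      using asymptotic_homomorphism_sequence[OF ah y adj[OF y]] by (simp add: LIMSEQ_const_iff)
    \<comment> \<open>\<open>E\<close> preserves the trace, so its vanishing on
      \<open>y * adj y\<close> is seen by \<open>\<tau>\<close>, which is faithful.\<close>
    then have "\<tau> (y * adj y) = 0"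
      using trace_cond_exp[OF yy] by (simp add: vector_state_def)
    then have "app (adj y) \<Omega> = 0" by (simp add: vector_state_mult cinner_self)
    then have "y = 0" using faithful[OF y] norm_adj_vacuum[OF y] by simp
    then show "x \<in> A" using cond_exp_spec(1)[OF x] by (simp add: y_def)
  qed
  ultimately show ?thesis using ab sub unfolding masa_def by blast
qed

section \<open>Scalar matrices acting on vectors\<close>

text \<open>The last property matters for the inductions below: the chosen vector \<open>g\<close>
  itself leaves no remainder, even when \<open>g = 0\<close>, so its index drops out.\<close>

lemma orthogonal_split:
  fixes x g :: "'a::complex_hilbert"
  obtains c x' where "x = c *\<^sub>C g + x'" "cinner x' g = 0" "x = g \<Longrightarrow> x' = 0"
proof (cases "g = 0")
  case True
  show ?thesis by (rule that[of 0 x]) (simp_all add: True)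
next
  case False
  define c where "c = cinner x g / cinner g g"
  show ?thesis
    by (rule that[of c "x - c *\<^sub>C g"])
      (use False in \<open>simp_all add: c_def cinner_diff_left cinner_scaleC_left cinner_self\<close>)
qed

lemma norm_orthogonal: "cinner x' g = 0 \<Longrightarrow>
    (norm (c *\<^sub>C g + x'))\<^sup>2 = (cmod c)\<^sup>2 * (norm g)\<^sup>2 + (norm (x'::'a::complex_hilbert))\<^sup>2"
  using cinner_commute[of g x']
  by (simp add: norm_add_square norm_scaleC cinner_scaleC_left power_mult_distrib)

text \<open>Induction on the number of vectors, splitting off the components along one of them.\<close>

lemma ampliation_bound:
  fixes t :: "'i \<Rightarrow> 'j \<Rightarrow> complex" and \<xi> :: "'j \<Rightarrow> 'a::complex_hilbert"
  assumes "finite F"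
    and "\<And>a. (\<Sum>i\<in>G. (cmod (\<Sum>j\<in>F. t i j * a j))\<^sup>2) \<le> K * (\<Sum>j\<in>F. (cmod (a j))\<^sup>2)"
  shows "(\<Sum>i\<in>G. (norm (\<Sum>j\<in>F. t i j *\<^sub>C \<xi> j))\<^sup>2) \<le> K * (\<Sum>j\<in>F. (norm (\<xi> j))\<^sup>2)"
  using assms
proof (induction F arbitrary: \<xi> rule: finite_induct)
  case empty
  then show ?case by simp
next
  case (insert k F)
  define g where "g = \<xi> k"
  have "\<exists>c x'. \<xi> j = c *\<^sub>C g + x' \<and> cinner x' g = 0 \<and> (\<xi> j = g \<longrightarrow> x' = 0)" for j
    by (rule orthogonal_split[of "\<xi> j" g]) blast
  then obtain c x where x: "\<And>j. \<xi> j = c j *\<^sub>C g + x j" "\<And>j. cinner (x j) g = 0"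
    "\<And>j. \<xi> j = g \<Longrightarrow> x j = 0" by metis
  have xk: "x k = 0" using x(3)[of k] by (simp add: g_def)
  have F: "(\<Sum>i\<in>G. (cmod (\<Sum>j\<in>F. t i j * a j))\<^sup>2) \<le> K * (\<Sum>j\<in>F. (cmod (a j))\<^sup>2)" for a
  proof -
    have "(if j = k then 0 else a j) = a j" if "j \<in> F" for j using that insert.hyps by auto
    then show ?thesis
      using insert.prems[of "\<lambda>j. if j = k then 0 else a j"] insert.hyps
      by (simp cong: sum.cong)
  qed
  \<comment> \<open>For every \<open>i\<close> the part along \<open>g\<close> is orthogonal to the
    rest. The first is governed by the scalar hypothesis at the coefficients \<open>c\<close>, the
    second by induction, as \<open>x k = 0\<close>.\<close>
  have split: "(norm (\<Sum>j\<in>insert k F. t i j *\<^sub>C \<xi> j))\<^sup>2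
      = (cmod (\<Sum>j\<in>insert k F. t i j * c j))\<^sup>2 * (norm g)\<^sup>2 + (norm (\<Sum>j\<in>F. t i j *\<^sub>C x j))\<^sup>2" for i
  proof -
    have "(\<Sum>j\<in>insert k F. t i j *\<^sub>C \<xi> j)
        = (\<Sum>j\<in>insert k F. t i j * c j) *\<^sub>C g + (\<Sum>j\<in>F. t i j *\<^sub>C x j)"
      using insert.hyps
      by (simp add: x(1) xk scaleC_add_right scaleC_add_left scaleC_sum_left scaleC_scaleC sum.distrib)
    moreover have "cinner (\<Sum>j\<in>F. t i j *\<^sub>C x j) g = 0"
      by (simp add: cinner_sum_left cinner_scaleC_left x(2))
    ultimately show ?thesis by (simp only: norm_orthogonal)
  qed
  have "(\<Sum>i\<in>G. (norm (\<Sum>j\<in>insert k F. t i j *\<^sub>C \<xi> j))\<^sup>2)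
      = (\<Sum>i\<in>G. (cmod (\<Sum>j\<in>insert k F. t i j * c j))\<^sup>2) * (norm g)\<^sup>2
        + (\<Sum>i\<in>G. (norm (\<Sum>j\<in>F. t i j *\<^sub>C x j))\<^sup>2)"
    by (simp only: split sum.distrib sum_distrib_right)
  also have "\<dots> \<le> K * (\<Sum>j\<in>insert k F. (cmod (c j))\<^sup>2) * (norm g)\<^sup>2 + K * (\<Sum>j\<in>F. (norm (x j))\<^sup>2)"
    by (intro add_mono mult_right_mono insert.prems insert.IH F) simp
  also have "(\<Sum>j\<in>F. (norm (x j))\<^sup>2) = (\<Sum>j\<in>insert k F. (norm (x j))\<^sup>2)"
    using insert.hyps by (simp add: xk)
  also have "K * (\<Sum>j\<in>insert k F. (cmod (c j))\<^sup>2) * (norm g)\<^sup>2 + K * \<dots> = K * (\<Sum>j\<in>insert k F. (norm (\<xi> j))\<^sup>2)"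
    by (simp only: x(1) norm_orthogonal[OF x(2)] sum.distrib sum_distrib_right distrib_left mult.assoc)
  finally show ?case .
qed

text \<open>The same splitting removes from the Gram matrix of the vectors the rank one piece
  \<open>c j * cnj (c i)\<close> times the squared norm of \<open>g\<close>, to which the hypothesis
  applies directly; the remainder is the Gram matrix of fewer vectors.\<close>

lemma ampliation_positive:
  fixes P :: "'j \<Rightarrow> 'j \<Rightarrow> complex" and \<xi> :: "'j \<Rightarrow> 'a::complex_hilbert"
  assumes "finite F"
    and "\<And>a. (\<Sum>i\<in>F. \<Sum>j\<in>F. P i j * (a j * cnj (a i))) \<in> \<real>\<^sub>\<ge>\<^sub>0"
  shows "(\<Sum>i\<in>F. \<Sum>j\<in>F. P i j * cinner (\<xi> j) (\<xi> i)) \<in> \<real>\<^sub>\<ge>\<^sub>0"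
  using assms
proof (induction F arbitrary: \<xi> rule: finite_induct)
  case empty
  then show ?case by simp
next
  case (insert k F)
  define g where "g = \<xi> k"
  have "\<exists>c x'. \<xi> j = c *\<^sub>C g + x' \<and> cinner x' g = 0 \<and> (\<xi> j = g \<longrightarrow> x' = 0)" for j
    by (rule orthogonal_split[of "\<xi> j" g]) blast
  then obtain c x where x: "\<And>j. \<xi> j = c j *\<^sub>C g + x j" "\<And>j. cinner (x j) g = 0"
    "\<And>j. \<xi> j = g \<Longrightarrow> x j = 0" by metis
  have xk: "x k = 0" using x(3)[of k] by (simp add: g_def)
  have gx: "cinner g (x j) = 0" for j using x(2)[of j] cinner_commute[of g "x j"] by simp
  have F: "(\<Sum>i\<in>F. \<Sum>j\<in>F. P i j * (a j * cnj (a i))) \<in> \<real>\<^sub>\<ge>\<^sub>0" for a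
  proof -
    have "(if j = k then 0 else a j) = a j" if "j \<in> F" for j using that insert.hyps by auto
    then show ?thesis
      using insert.prems[of "\<lambda>j. if j = k then 0 else a j"] insert.hyps
      by (simp cong: sum.cong)
  qed
  have "(\<Sum>i\<in>insert k F. \<Sum>j\<in>insert k F. P i j * cinner (\<xi> j) (\<xi> i))
      = (\<Sum>i\<in>insert k F. \<Sum>j\<in>insert k F. P i j * (c j * cnj (c i)) * complex_of_real ((norm g)\<^sup>2))
        + (\<Sum>i\<in>insert k F. \<Sum>j\<in>insert k F. P i j * cinner (x j) (x i))"
    unfolding sum.distrib[symmetric]
    by (intro sum.cong refl)
      (simp add: x(1) cinner_add_left cinner_add_right cinner_scaleC_left cinner_scaleC_right x(2) gx
        cinner_self[of g] algebra_simps del: of_real_power)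
  also have "(\<Sum>i\<in>insert k F. \<Sum>j\<in>insert k F. P i j * cinner (x j) (x i))
      = (\<Sum>i\<in>F. \<Sum>j\<in>F. P i j * cinner (x j) (x i))"
    using insert.hyps by (simp add: xk)
  finally have "(\<Sum>i\<in>insert k F. \<Sum>j\<in>insert k F. P i j * cinner (\<xi> j) (\<xi> i))
      = (\<Sum>i\<in>insert k F. \<Sum>j\<in>insert k F. P i j * (c j * cnj (c i))) * complex_of_real ((norm g)\<^sup>2)
        + (\<Sum>i\<in>F. \<Sum>j\<in>F. P i j * cinner (x j) (x i))"
    by (simp only: sum_distrib_right)
  then show ?case
    using insert.prems[of c] insert.IH[OF F, of x]
    by (simp del: of_real_power sum.insert add: nonneg_Reals_add_I nonneg_Reals_mult_I)
qed

lemma norm_sum_orthonormal: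
  fixes e :: "'i \<Rightarrow> 'a::complex_hilbert"
  assumes e: "\<And>i j. cinner (e i) (e j) = (if i = j then 1 else 0)" and F: "finite F"
  shows "(norm (\<Sum>j\<in>F. a j *\<^sub>C e j))\<^sup>2 = (\<Sum>j\<in>F. (cmod (a j))\<^sup>2)"
proof -
  have "complex_of_real ((norm (\<Sum>j\<in>F. a j *\<^sub>C e j))\<^sup>2) = (\<Sum>j\<in>F. a j * cnj (a j))"
    unfolding cinner_self[symmetric] cinner_sum_left cinner_sum_right cinner_scaleC_left cinner_scaleC_right
    using F by (simp add: e if_distrib[of "\<lambda>z. _ * z"] mult.commute cong: if_cong)
  also have "\<dots> = complex_of_real (\<Sum>j\<in>F. (cmod (a j))\<^sup>2)" by (simp only: complex_norm_square[symmetric] of_real_sum)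
  finally show ?thesis by (simp only: of_real_eq_iff)
qed

lemma Bessel_inequality:
  fixes e :: "'i \<Rightarrow> 'a::complex_hilbert"
  assumes e: "\<And>i j. cinner (e i) (e j) = (if i = j then 1 else 0)" and F: "finite F"
  shows "(\<Sum>i\<in>F. (cmod (cinner \<zeta> (e i)))\<^sup>2) \<le> (norm \<zeta>)\<^sup>2"
proof -
  define s where "s = (\<Sum>i\<in>F. cinner \<zeta> (e i) *\<^sub>C e i)"
  have "cinner \<zeta> s = (\<Sum>i\<in>F. cinner \<zeta> (e i) * cnj (cinner \<zeta> (e i)))"
    by (simp add: s_def cinner_sum_right cinner_scaleC_right mult.commute)
  also have "\<dots> = complex_of_real (\<Sum>i\<in>F. (cmod (cinner \<zeta> (e i)))\<^sup>2)" by (simp only: complex_norm_square[symmetric] of_real_sum)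
  finally have "Re (cinner \<zeta> s) = (\<Sum>i\<in>F. (cmod (cinner \<zeta> (e i)))\<^sup>2)" by (simp only: Re_complex_of_real)
  moreover have "(norm s)\<^sup>2 = (\<Sum>i\<in>F. (cmod (cinner \<zeta> (e i)))\<^sup>2)"
    unfolding s_def by (rule norm_sum_orthonormal[OF e F])
  ultimately show ?thesis
    using zero_le_power2[of "norm (\<zeta> - s)"] unfolding norm_diff_square by linarith
qed

section \<open>Operators on square summable sequences\<close>

lemma norm_ell2Z_mono:
  assumes "\<And>n. norm (coord x n) \<le> norm (coord y n)"
  shows "norm x \<le> norm y"
proof (rule norm_ell2Z_le)
  fix F :: "int set" assume "finite F"
  have "L2_set (\<lambda>n. norm (coord x n)) F \<le> L2_set (\<lambda>n. norm (coord y n)) F"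
    by (rule L2_set_mono) (simp_all add: assms)
  also have "\<dots> \<le> norm y" by (rule L2_set_coord_le[OF \<open>finite F\<close>])
  finally show "L2_set (\<lambda>n. norm (coord x n)) F \<le> norm y" .
qed

lemma coord_sum: "coord (sum f F) n = (\<Sum>i\<in>F. coord (f i) n)"
  by (induction F rule: infinite_finite_induct) simp_all

lemma single_scaleC: "single n (c *\<^sub>C \<xi>) = c *\<^sub>C single n \<xi>"
  by (rule ell2Z_eqI) (simp add: coord_single)

lemma single_diff: "single n (\<xi> - \<eta>) = single n \<xi> - single n \<eta>"
  by (rule ell2Z_eqI) (simp add: coord_single)

lemma norm_single: "norm (single n \<xi>) = norm \<xi>"
  by (simp add: norm_eq_sqrt_cinner cinner_single coord_single)

lemma coord_sum_single:
  "finite F \<Longrightarrow> coord (\<Sum>m\<in>F. single m (f m)) n = (if n \<in> F then f n else 0)"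
  by (simp add: coord_sum coord_single)

lemma has_sum_single:
  fixes \<xi> :: "'a::complex_hilbert ell2Z"
  shows "((\<lambda>n. single n (coord \<xi> n)) has_sum \<xi>) UNIV"
  unfolding has_sum_def tendsto_iff eventually_finite_subsets_at_top
proof (intro allI impI)
  fix e :: real assume e: "e > 0"
  define f where "f n = (norm (coord \<xi> n))\<^sup>2" for n
  have f: "f summable_on UNIV" using coord[of \<xi>] unfolding f_def by simp
  \<comment> \<open>The error of a partial sum over \<open>Y\<close> is the tail of squares outside
    \<open>Y\<close>. Taking \<open>e / 2\<close> here compensates for \<open>norm_ell2Z_le\<close>,
    which yields only a weak inequality.\<close>
  have "\<exists>X. finite X \<and> X \<subseteq> UNIV \<and> (\<forall>Y. finite Y \<and> X \<subseteq> Y \<and> Y \<subseteq> UNIV \<longrightarrow> dist (sum f Y) (infsum f UNIV) < (e / 2)\<^sup>2)"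
    using has_sum_infsum[OF f, unfolded has_sum_def tendsto_iff eventually_finite_subsets_at_top,
      THEN spec[of _ "(e / 2)\<^sup>2"], THEN mp] e by simp
  then obtain X where X: "finite X" "dist (sum f X) (infsum f UNIV) < (e / 2)\<^sup>2" by blast
  have "dist (\<Sum>n\<in>Y. single n (coord \<xi> n)) \<xi> < e" if Y: "finite Y" "X \<subseteq> Y" for Y
  proof -
    let ?d = "(\<Sum>n\<in>Y. single n (coord \<xi> n)) - \<xi>"
    have "norm ?d \<le> e / 2"
    proof (rule norm_ell2Z_le)
      fix F :: "int set" assume F: "finite F"
      have "(\<Sum>n\<in>F. (norm (coord ?d n))\<^sup>2) = (\<Sum>n\<in>F. if n \<in> Y then 0 else f n)"
        by (intro sum.cong refl) (simp add: coord_sum_single[OF Y(1)] f_def)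
      also have "\<dots> = sum f (F - Y)" using F by (simp add: sum.If_cases Diff_eq)
      also have "\<dots> = sum f (F - Y \<union> X) - sum f X"
        using F X(1) Y(2) by (subst sum.union_disjoint) auto
      also have "sum f (F - Y \<union> X) \<le> infsum f UNIV"
        using F X(1) by (intro finite_sum_le_infsum f) (auto simp: f_def)
      also have "infsum f UNIV - sum f X \<le> (e / 2)\<^sup>2" using X(2) by (simp add: dist_real_def)
      finally show "L2_set (\<lambda>n. norm (coord ?d n)) F \<le> e / 2"
        unfolding L2_set_def using e by (intro real_le_lsqrt) simp_all
    qed
    then show ?thesis using e by (simp add: dist_norm)
  qed
  then show "\<exists>X. finite X \<and> X \<subseteq> UNIV \<and> (\<forall>Y. finite Y \<and> X \<subseteq> Y \<and> Y \<subseteq> UNIV \<longrightarrow>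
      dist (\<Sum>n\<in>Y. single n (coord \<xi> n)) \<xi> < e)" using X(1) by blast
qed

lemma ell2Z_diagonal:
  fixes P :: "'a::complex_hilbert bop"
  obtains T where "\<And>\<xi> n. coord (app T \<xi>) n = app P (coord \<xi> n)"
proof -
  define S where "S \<xi> = Ell2Z (\<lambda>n. app P (coord \<xi> n))" for \<xi>
  have le: "L2_set (\<lambda>n. norm (app P (coord \<xi> n))) F \<le> norm P * norm \<xi>" if "finite F" for F \<xi>
  proof -
    have "L2_set (\<lambda>n. norm (app P (coord \<xi> n))) F \<le> L2_set (\<lambda>n. norm P * norm (coord \<xi> n)) F"
      by (rule L2_set_mono) (simp_all add: norm_app_le)
    also have "\<dots> = norm P * L2_set (\<lambda>n. norm (coord \<xi> n)) F"
      by (rule L2_set_right_distrib[symmetric]) simp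
    also have "\<dots> \<le> norm P * norm \<xi>" by (intro mult_left_mono L2_set_coord_le that) simp
    finally show ?thesis .
  qed
  have S: "coord (S \<xi>) n = app P (coord \<xi> n)" for \<xi> n
    unfolding S_def using sq_summableI[OF le, of \<xi>] by (simp add: Ell2Z_inverse)
  have "app (Bop S) = S"
  proof (rule app_Bop)
    show "norm (S \<xi>) \<le> norm P * norm \<xi>" for \<xi>
      by (rule norm_ell2Z_le) (simp add: S le)
  qed (auto intro!: ell2Z_eqI simp: S app_add app_scaleC)
  then show ?thesis using that S by metis
qed

text \<open>For a unit vector \<open>g\<close> this is the projection onto the sequences with values
  in the multiples of \<open>g\<close>. Having the same entry at every index, it commutes with the
  shift.\<close>

lemma ell2Z_projection:
  fixes g :: "'a::complex_hilbert"
  obtains e where "\<And>\<xi> n. coord (app e \<xi>) n = cinner (coord \<xi> n) g *\<^sub>C g"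
proof -
  have "app (Bop (\<lambda>\<eta>. cinner \<eta> g *\<^sub>C g)) = (\<lambda>\<eta>. cinner \<eta> g *\<^sub>C g)"
  proof (rule app_Bop)
    show "norm (cinner \<eta> g *\<^sub>C g) \<le> ((norm g)\<^sup>2) * norm \<eta>" for \<eta>
      using mult_right_mono[OF cinner_Cauchy_Schwarz[of \<eta> g] norm_ge_zero[of g]]
      by (simp add: norm_scaleC power2_eq_square mult_ac)
  qed (simp_all add: cinner_add_left cinner_scaleC_left scaleC_add_left scaleC_scaleC)
  then show ?thesis using ell2Z_diagonal[of "Bop (\<lambda>\<eta>. cinner \<eta> g *\<^sub>C g)"] that by metis
qed

section \<open>The conditional expectation onto the algebra of the shift\<close>

lemma app_upower_single: "app (upower cp_unitary n) (single m \<xi>) = single (m + n) \<xi>"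
  by (rule ell2Z_eqI) (auto simp: coord_upower_cp_unitary coord_single)

lemma upower_cp_unitary_add:
  "upower cp_unitary (m + n) = upower cp_unitary m * upower cp_unitary n"
  by (rule bop_eqI, rule ell2Z_eqI) (simp add: coord_upower_cp_unitary algebra_simps)

text \<open>If the matrix coefficients depend only on \<open>i - j\<close>, this is the Cesaro mean
  of a Fourier series: the term at \<open>u\<^sup>n\<close> has weight
  \<open>1 - \<bar>n\<bar> / k\<close> for \<open>\<bar>n\<bar> < k\<close>. The double sum is kept
  because it exhibits the mean as a finite scalar matrix of \<open>T\<close> framed by powers of the
  shift.\<close>

definition fejer :: "'a::complex_hilbert \<Rightarrow> 'a ell2Z bop \<Rightarrow> nat \<Rightarrow> 'a ell2Z bop" where
  "fejer g T k = (1 / real k) *\<^sub>R (\<Sum>i<k. \<Sum>j<k.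
     cinner (app T (single (int j) g)) (single (int i) g) *\<^sub>C upower cp_unitary (int i - int j))"

text \<open>Splitting \<open>u\<^sup>i\<^sup>-\<^sup>j\<close> between the two arguments shows the
  scalar matrix of \<open>T\<close> acting on tuples of shifted vectors, the form that the
  ampliation lemmas treat.\<close>

lemma cinner_fejer:
  "cinner (app (fejer g T k) \<eta>) \<zeta> = complex_of_real (1 / real k) * (\<Sum>i<k. \<Sum>j<k.
     cinner (app T (single (int j) g)) (single (int i) g)
       * cinner (app (upower cp_unitary (- int j)) \<eta>) (app (upower cp_unitary (- int i)) \<zeta>))"
proof -
  have "cinner (app (upower cp_unitary (i - j)) \<eta>) \<zeta>
      = cinner (app (upower cp_unitary (- j)) \<eta>) (app (upower cp_unitary (- i)) \<zeta>)" for i j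
    using cinner_adj_left[of "upower cp_unitary (- i)" "app (upower cp_unitary (- j)) \<eta>" \<zeta>]
    by (simp add: adj_upower upower_cp_unitary_add[of i "- j", simplified])
  then show ?thesis
    by (simp add: fejer_def scaleR_scaleC app_sum_left cinner_sum_left cinner_scaleC_left)
qed

lemma orthonormal_single:
  assumes "norm g = 1"
  shows "cinner (single (int i) g) (single (int j) g) = (if i = j then 1 else 0)"
  using assms by (simp add: cinner_single coord_single cinner_self)

lemma cinner_app_sum_single:
  "cinner (app T (\<Sum>j\<in>F. a j *\<^sub>C single (int j) g)) \<zeta>
     = (\<Sum>j\<in>F. cinner (app T (single (int j) g)) \<zeta> * a j)"
  using linear_sum[OF bounded_linear.linear[OF bounded_linear_app], of T "\<lambda>j. a j *\<^sub>C single (int j) g" F]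
  by (simp add: cinner_sum_left app_scaleC cinner_scaleC_left mult.commute)

lemma norm_upower_cp_unitary: "norm (app (upower cp_unitary n) \<xi>) = norm \<xi>"
  by (intro unitary_norm unitary_upower unitary_cp_unitary)

text \<open>By Bessel the scalar matrix has norm at most \<open>norm T\<close>, hence so does its
  action on the tuple of the \<open>k\<close> shifts of \<open>\<eta>\<close>. Passing to sums of
  norms, the tuple length and Cauchy-Schwarz each cost a factor \<open>sqrt k\<close>, which the
  factor \<open>1 / k\<close> cancels.\<close>

lemma fejer_bounded:
  assumes g: "norm g = 1"
  shows "norm (app (fejer g T k) \<eta>) \<le> norm T * norm \<eta>"
proof (cases "k = 0 \<or> app (fejer g T k) \<eta> = 0")
  case True
  then show ?thesis by (auto simp: fejer_def)
next
  case False
  define t where "t i j = cinner (app T (single (int j) g)) (single (int i) g)" for i j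
  define U where "U j \<xi> = app (upower cp_unitary (- int j)) \<xi>" for j and \<xi> :: "'a ell2Z"
  define a where "a i = (\<Sum>j<k. t i j *\<^sub>C U j \<eta>)" for i
  have U: "norm (U j \<xi>) = norm \<xi>" for j \<xi> by (simp add: U_def norm_upower_cp_unitary)
  have "(\<Sum>i<k. (cmod (\<Sum>j<k. t i j * b j))\<^sup>2) \<le> (norm T)\<^sup>2 * (\<Sum>j<k. (cmod (b j))\<^sup>2)" for b
  proof -
    let ?v = "\<Sum>j<k. b j *\<^sub>C single (int j) g"
    have "(\<Sum>i<k. (cmod (\<Sum>j<k. t i j * b j))\<^sup>2) = (\<Sum>i<k. (cmod (cinner (app T ?v) (single (int i) g)))\<^sup>2)"
      by (simp only: cinner_app_sum_single t_def)
    also have "\<dots> \<le> (norm (app T ?v))\<^sup>2"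
      by (rule Bessel_inequality) (simp_all add: orthonormal_single[OF g])
    also have "\<dots> \<le> (norm T * norm ?v)\<^sup>2" by (intro power_mono norm_app_le) simp
    also have "\<dots> = (norm T)\<^sup>2 * (\<Sum>j<k. (cmod (b j))\<^sup>2)"
      unfolding power_mult_distrib by (subst norm_sum_orthonormal) (simp_all add: orthonormal_single[OF g])
    finally show ?thesis .
  qed
  then have "(\<Sum>i<k. (norm (a i))\<^sup>2) \<le> (norm T)\<^sup>2 * (\<Sum>j<k. (norm (U j \<eta>))\<^sup>2)"
    unfolding a_def by (intro ampliation_bound) simp_all
  then have "(\<Sum>i<k. (norm (a i))\<^sup>2) * real k \<le> (norm T)\<^sup>2 * (real k * (norm \<eta>)\<^sup>2) * real k"
    by (intro mult_right_mono) (simp_all add: U)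
  moreover have "(\<Sum>i<k. norm (a i))\<^sup>2 \<le> (\<Sum>i<k. (norm (a i))\<^sup>2) * real k"
    using sum_squared_le_sum_of_squares[of "\<lambda>i. norm (a i)" "{..<k}"] by simp
  ultimately have "(\<Sum>i<k. norm (a i))\<^sup>2 \<le> (real k * (norm T * norm \<eta>))\<^sup>2"
    by (simp add: power_mult_distrib power2_eq_square mult_ac)
  then have le: "(\<Sum>i<k. norm (a i)) \<le> real k * (norm T * norm \<eta>)"
    by (rule power2_le_imp_le) simp
  let ?\<zeta> = "app (fejer g T k) \<eta>"
  have "(norm ?\<zeta>)\<^sup>2 = cmod (cinner ?\<zeta> ?\<zeta>)" unfolding cinner_self norm_of_real by simp
  also have "cinner ?\<zeta> ?\<zeta> = complex_of_real (1 / real k) * (\<Sum>i<k. cinner (a i) (U i ?\<zeta>))"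
    unfolding cinner_fejer by (simp add: a_def t_def U_def cinner_sum_left cinner_scaleC_left)
  also have "cmod \<dots> \<le> (1 / real k) * (\<Sum>i<k. norm (a i) * norm ?\<zeta>)"
    unfolding norm_mult norm_of_real
    by (intro mult_mono order_trans[OF norm_sum] sum_mono order_trans[OF cinner_Cauchy_Schwarz])
      (simp_all add: U)
  also have "\<dots> \<le> (1 / real k) * (real k * (norm T * norm \<eta>) * norm ?\<zeta>)"
    unfolding sum_distrib_right[symmetric] by (intro mult_left_mono mult_right_mono le) simp_all
  finally show ?thesis using False by (simp add: power2_eq_square)
qed

lemma fejer_positive:
  assumes "pos_op T"
  shows "pos_op (fejer g T k)"
  unfolding pos_op_def cinner_fejer
proof (intro allI nonneg_Reals_mult_I ampliation_positive)
  fix a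
  have "(\<Sum>i<k. \<Sum>j<k. cinner (app T (single (int j) g)) (single (int i) g) * (a j * cnj (a i)))
      = cinner (app T (\<Sum>j<k. a j *\<^sub>C single (int j) g)) (\<Sum>j<k. a j *\<^sub>C single (int j) g)"
    unfolding cinner_sum_right cinner_scaleC_right cinner_app_sum_single sum_distrib_left
    by (simp add: mult_ac)
  also have "\<dots> \<in> \<real>\<^sub>\<ge>\<^sub>0" using assms by (simp add: pos_op_def)
  finally show "(\<Sum>i<k. \<Sum>j<k. cinner (app T (single (int j) g)) (single (int i) g) * (a j * cnj (a i))) \<in> \<real>\<^sub>\<ge>\<^sub>0" .
qed simp_all

text \<open>On the vacuum the mean is the average over \<open>j\<close> of the partial sums of
  \<open>\<xi>\<close> over the windows from \<open>- j\<close> to \<open>k - j - 1\<close>. All but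
  at most \<open>2 * m\<close> windows contain the finite set \<open>X\<close>; each exceptional one
  has error at most \<open>norm \<xi>\<close>.\<close>

lemma fejer_vacuum:
  assumes T: "\<And>i j. cinner (app T (single i g)) (single j g) = \<beta> (j - i)"
    and \<xi>: "\<And>n. coord \<xi> n = \<beta> n *\<^sub>C g"
  shows "(\<lambda>k. app (fejer g T k) (single 0 g)) \<longlonglongrightarrow> \<xi>"
proof (rule LIMSEQ_I)
  fix r :: real assume r: "r > 0"
  define Q where "Q F = (\<Sum>n\<in>F. single n (coord \<xi> n))" for F
  have Q_le: "norm (Q F - \<xi>) \<le> norm \<xi>" if "finite F" for F
    by (rule norm_ell2Z_mono) (simp add: Q_def coord_sum_single[OF that])
  have "\<exists>X. finite X \<and> X \<subseteq> UNIV \<and> (\<forall>Y. finite Y \<and> X \<subseteq> Y \<and> Y \<subseteq> UNIV \<longrightarrow> dist (Q Y) \<xi> < r / 2)"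
    using has_sum_single[of \<xi>, unfolded has_sum_def tendsto_iff eventually_finite_subsets_at_top,
      THEN spec[of _ "r / 2"], THEN mp] r by (simp add: Q_def)
  then obtain X where X: "finite X" "\<And>Y. finite Y \<Longrightarrow> X \<subseteq> Y \<Longrightarrow> norm (Q Y - \<xi>) < r / 2"
    by (auto simp: dist_norm)
  define m where "m = (\<Sum>x\<in>X. nat \<bar>x\<bar>)"
  have m: "\<bar>x\<bar> \<le> int m" if "x \<in> X" for x
  proof -
    have "nat \<bar>x\<bar> \<le> m" unfolding m_def by (rule member_le_sum[OF that]) (simp_all add: X(1))
    then show ?thesis by linarith
  qed
  define W where "W k j = {- int j..<int k - int j}" for k j
  have fejer: "app (fejer g T k) (single 0 g) = (1 / real k) *\<^sub>R (\<Sum>j<k. Q (W k j))" for k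
  proof -
    have "Q (W k j) = (\<Sum>i<k. single (int i - int j) (coord \<xi> (int i - int j)))" for j
      unfolding Q_def W_def
      by (rule sum.reindex_bij_witness[of _ "\<lambda>i. int i - int j" "\<lambda>n. nat (n + int j)"]) auto
    then have "(\<Sum>j<k. Q (W k j)) = (\<Sum>i<k. \<Sum>j<k. single (int i - int j) (coord \<xi> (int i - int j)))"
      by (subst sum.swap) simp
    then show ?thesis
      by (simp add: fejer_def app_scaleR_left app_sum_left T \<xi> single_scaleC app_upower_single)
  qed
  \<comment> \<open>Chosen so that the exceptional windows contribute
    \<open>2 * m * norm \<xi> / k < r / 2\<close>; \<open>Suc\<close> keeps \<open>k\<close>
    positive.\<close>
  define K where "K = Suc (nat \<lceil>4 * real m * norm \<xi> / r\<rceil>)"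
  have "norm (app (fejer g T k) (single 0 g) - \<xi>) < r" if k: "k \<ge> K" for k
  proof -
    have k0: "real k > 0" "4 * real m * norm \<xi> / r < real k" using k unfolding K_def by linarith+
    have "app (fejer g T k) (single 0 g) - \<xi> = (1 / real k) *\<^sub>R (\<Sum>j<k. Q (W k j) - \<xi>)"
      using k0 by (simp add: fejer sum_subtractf scaleR_diff_right sum_constant_scaleR)
    also have "norm \<dots> \<le> (1 / real k) * (\<Sum>j<k. norm (Q (W k j) - \<xi>))"
      by (simp add: norm_sum divide_right_mono)
    also have "\<dots> \<le> (1 / real k) * (\<Sum>j<k. r / 2 + (if j \<in> {m..<k - m} then 0 else norm \<xi>))"
    proof (intro mult_left_mono sum_mono)
      fix j
      show "norm (Q (W k j) - \<xi>) \<le> r / 2 + (if j \<in> {m..<k - m} then 0 else norm \<xi>)"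
      proof (cases "j \<in> {m..<k - m}")
        case True
        then have "X \<subseteq> W k j" using m by (force simp: W_def)
        then show ?thesis using X(2)[of "W k j"] True by (simp add: W_def)
      next
        case False
        then show ?thesis using Q_le[of "W k j"] r by (auto simp: W_def)
      qed
    qed simp
    also have "(\<Sum>j<k. r / 2 + (if j \<in> {m..<k - m} then 0 else norm \<xi>))
        = real k * (r / 2) + real (card ({..<k} - {m..<k - m})) * norm \<xi>"
      unfolding sum.distrib by (subst sum.If_cases) (simp_all add: Diff_eq del: atLeastLessThan_iff)
    also have "(1 / real k) * \<dots> \<le> (1 / real k) * (real k * (r / 2) + real (m + m) * norm \<xi>)"
    proof (intro mult_left_mono add_mono mult_right_mono of_nat_mono)
      have "card ({..<k} - {m..<k - m}) \<le> card ({..<m} \<union> {k - m..<k})"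
        by (intro card_mono) auto
      also have "\<dots> \<le> m + m" by (rule order_trans[OF card_Un_le]) simp
      finally show "card ({..<k} - {m..<k - m}) \<le> m + m" .
    qed simp_all
    also have "\<dots> < r" using k0 r by (simp add: field_simps)
    finally show ?thesis .
  qed
  then show "\<exists>K. \<forall>k\<ge>K. norm (app (fejer g T k) (single 0 g) - \<xi>) < r" by blast
qed

text \<open>Isolates what the expectation onto the shift algebra depends on; \<open>g\<close> will
  be the class \<open>\<Lambda> 1\<close>, and the coefficient algebra is out of sight.\<close>

locale shift_algebra = cyclic_tracial M "single 0 g" for M :: "'a::complex_hilbert ell2Z bop set" and g +
  assumes unit_g: "norm g = 1" and bicommutant: "commutant (commutant M) = M" and shift: "cp_unitary \<in> M"
begin

definition B :: "'a ell2Z bop set" where "B = commutant (commutant {cp_unitary, adj cp_unitary})"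

lemma von_neumann_algebra_B: "von_neumann_algebra B"
  unfolding B_def by (rule von_neumann_algebra_bicommutant) auto

lemmas B_closed = von_neumann_algebra_closed[OF von_neumann_algebra_B]

lemma cp_unitary_B: "cp_unitary \<in> B"
  using bicommutant_subset[of "{cp_unitary, adj cp_unitary :: 'a ell2Z bop}"] by (auto simp: B_def)

lemma B_subset: "B \<subseteq> M"
proof -
  have "{cp_unitary, adj cp_unitary} \<subseteq> M" using shift adj by blast
  then show ?thesis unfolding B_def by (metis bicommutant commutant_antimono)
qed

lemma upower_B: "upower cp_unitary n \<in> B"
proof -
  have "v ^ k \<in> B" if "v \<in> B" for v k by (induction k) (simp_all add: B_closed that)
  then show ?thesis using cp_unitary_B B_closed(6) by (simp add: upower_def)
qed

lemma abelian_B: "abelian B"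
proof -
  let ?S = "{cp_unitary, adj cp_unitary} :: 'a ell2Z bop set"
  have "cp_unitary * adj cp_unitary = adj cp_unitary * (cp_unitary :: 'a ell2Z bop)"
    using unitary_cp_unitary[where 'a = 'a] by (simp add: unitary_op_def)
  then have "?S \<subseteq> commutant ?S" by (auto simp: commutant_def)
  then have "B \<subseteq> commutant ?S" unfolding B_def by (intro commutant_antimono)
  then show ?thesis unfolding abelian_def B_def commutant_def[of "commutant ?S"] by auto
qed

lemma fejer_B: "fejer g T k \<in> B"
proof -
  have "sum f F \<in> B" if "\<And>i. i \<in> F \<Longrightarrow> f i \<in> B" for f :: "nat \<Rightarrow> 'a ell2Z bop" and F
    using that by (induction F rule: infinite_finite_induct) (simp_all add: B_closed)
  then show ?thesis unfolding fejer_def scaleR_scaleC by (simp add: B_closed upower_B)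
qed

text \<open>The projection \<open>e\<close> onto the multiples of \<open>g\<close> commutes with the
  shift and its adjoint, hence with \<open>B\<close>, and fixes the vacuum; so it fixes the image of
  the vacuum under \<open>c\<close>.\<close>

lemma B_vacuum:
  assumes "c \<in> B"
  shows "coord (app c (single 0 g)) n = cinner (coord (app c (single 0 g)) n) g *\<^sub>C g"
proof -
  obtain e where e: "\<And>\<xi> n. coord (app e \<xi>) n = cinner (coord \<xi> n) g *\<^sub>C g"
    by (rule ell2Z_projection[of g]) blast
  have "e \<in> commutant {cp_unitary, adj cp_unitary}"
    unfolding commutant_def
    by (auto intro!: bop_eqI ell2Z_eqI simp: e coord_cp_unitary coord_adj_cp_unitary)
  then have "c * e = e * c" using assms unfolding B_def commutant_def by blast
  moreover have "app e (single 0 g) = single 0 g"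
    by (rule ell2Z_eqI) (use unit_g in \<open>simp add: e coord_single cinner_self\<close>)
  ultimately have "app c (single 0 g) = app e (app c (single 0 g))"
    by (metis app_bop_simps(1))
  then show ?thesis using e by metis
qed

text \<open>The state pairs \<open>app x \<Omega>\<close> with \<open>app (adj c) \<Omega>\<close>,
  whose coordinates are multiples of \<open>g\<close>, so only the components along \<open>g\<close>
  are seen.\<close>

lemma vector_state_B:
  assumes "c \<in> B" and eq: "\<And>n. cinner (coord (app x (single 0 g)) n) g = cinner (coord (app y (single 0 g)) n) g"
  shows "vector_state (single 0 g) (c * x) = vector_state (single 0 g) (c * y)"
proof -
  define \<gamma> where "\<gamma> n = cinner (coord (app (adj c) (single 0 g)) n) g" for n
  have \<gamma>: "coord (app (adj c) (single 0 g)) n = \<gamma> n *\<^sub>C g" for n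
    unfolding \<gamma>_def using B_vacuum[OF B_closed(6)[OF assms(1)]] .
  show ?thesis
    unfolding vector_state_mult cinner_ell2Z_def \<gamma> cinner_scaleC_right eq ..
qed

lemma B_expectation_exists:
  assumes T: "T \<in> M"
  obtains b where "b \<in> B" "\<And>n. coord (app b (single 0 g)) n = cinner (coord (app T (single 0 g)) n) g *\<^sub>C g"
    "pos_op T \<Longrightarrow> pos_op b"
proof -
  obtain e where e: "\<And>\<xi> n. coord (app e \<xi>) n = cinner (coord \<xi> n) g *\<^sub>C g"
    by (rule ell2Z_projection[of g]) blast
  let ?u = "upower cp_unitary :: int \<Rightarrow> 'a ell2Z bop"
  have uM: "?u n \<in> M" for n using upower_B B_subset by blast
  \<comment> \<open>Traciality makes the matrix Toeplitz: both powers of the shift are brought to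
    one side of \<open>T\<close>.\<close>
  have "cinner (app T (single i g)) (single j g) = cinner (coord (app T (single 0 g)) (j - i)) g" for i j
  proof -
    have "cinner (app T (single i g)) (single j g) = vector_state (single 0 g) (?u (- j) * (T * ?u i))"
      by (simp add: vector_state_mult adj_upower app_upower_single)
    also have "\<dots> = vector_state (single 0 g) ((T * ?u i) * ?u (- j))"
      by (rule trace) (simp_all add: uM mult T)
    also have "\<dots> = vector_state (single 0 g) (T * ?u (i - j))"
      by (simp add: mult.assoc upower_cp_unitary_add[of i "- j", simplified])
    also have "\<dots> = vector_state (single 0 g) (?u (i - j) * T)" by (rule trace) (simp_all add: uM T)
    also have "\<dots> = cinner (coord (app T (single 0 g)) (j - i)) g"
      by (simp add: vector_state_mult adj_upower app_upower_single cinner_single)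
    finally show ?thesis .
  qed
  then have lim0: "(\<lambda>k. app (fejer g T k) (single 0 g)) \<longlonglongrightarrow> app e (app T (single 0 g))"
    by (rule fejer_vacuum) (rule e)
  have "\<exists>b. \<forall>\<xi>. (\<lambda>k. app (fejer g T k) \<xi>) \<longlonglongrightarrow> app b \<xi>"
  proof (rule bounded_limit[OF _ _ lim0])
    show "fejer g T k \<in> commutant (commutant M)" for k
      unfolding bicommutant using fejer_B B_subset by blast
    show "norm (app (fejer g T k) \<xi>) \<le> norm T * norm \<xi>" for k \<xi> by (rule fejer_bounded[OF unit_g])
  qed
  then obtain b where b: "\<And>\<xi>. (\<lambda>k. app (fejer g T k) \<xi>) \<longlonglongrightarrow> app b \<xi>" by blast
  show ?thesis
  proof (rule that[of b])
    show "b \<in> B" unfolding B_def by (rule commutant_strong_limit[OF _ b]) (use fejer_B B_def in blast)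
    have "app b (single 0 g) = app e (app T (single 0 g))" using LIMSEQ_unique[OF b lim0] .
    then show "coord (app b (single 0 g)) n = cinner (coord (app T (single 0 g)) n) g *\<^sub>C g" for n
      by (simp add: e)
    assume "pos_op T"
    then have "cinner (app (fejer g T k) \<xi>) \<xi> \<in> \<real>\<^sub>\<ge>\<^sub>0" for k \<xi>
      using fejer_positive unfolding pos_op_def by blast
    then show "pos_op b"
      unfolding pos_op_def
      using closed_sequentially[OF closed_nonneg_Reals_complex _ tendsto_cinner[OF b tendsto_const]] by blast
  qed
qed

sublocale expectation M "single 0 g" B
proof unfold_locales
  show "norm (single 0 g) = 1" by (simp add: norm_single unit_g)
  fix x assume "x \<in> M"
  then obtain b where b: "b \<in> B" "\<And>n. coord (app b (single 0 g)) n = cinner (coord (app x (single 0 g)) n) g *\<^sub>C g"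
    "pos_op x \<Longrightarrow> pos_op b" by (rule B_expectation_exists) blast
  have "vector_state (single 0 g) (c * b) = vector_state (single 0 g) (c * x)" if "c \<in> B" for c
    by (rule vector_state_B[OF that]) (use unit_g in \<open>simp add: b(2) cinner_scaleC_left cinner_self\<close>)
  then show "\<exists>y\<in>B. (\<forall>c\<in>B. vector_state (single 0 g) (c * y) = vector_state (single 0 g) (c * x))
      \<and> (pos_op x \<longrightarrow> pos_op y)" using b by blast
qed (simp_all add: B_subset B_closed)

lemma cond_exp_B_eqI:
  assumes "x \<in> M" "y \<in> B"
    "\<And>n. cinner (coord (app y (single 0 g)) n) g = cinner (coord (app x (single 0 g)) n) g"
  shows "E x = y"
  by (intro cond_exp_eqI vector_state_B assms)

end

section \<open>The crossed product\<close>

locale crossed =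
  fixes N :: "'h::complex_hilbert bop set" and tr :: "'h bop \<Rightarrow> complex" and \<theta> :: "'h bop \<Rightarrow> 'h bop"
    and \<Lambda> :: "'h bop \<Rightarrow> 'l::complex_hilbert"
  assumes N: "von_neumann_algebra N" and tr: "faithful_normal_trace N tr"
    and \<theta>: "automorphism N \<theta>" and tp: "trace_preserving N tr \<theta>" and L2: "is_L2 N tr \<Lambda>"
begin

abbreviation "\<alpha> \<equiv> autpow N \<theta>"
abbreviation "\<pi> \<equiv> cp_rep N \<theta> \<Lambda>"
abbreviation "U \<equiv> upower (cp_unitary :: 'l ell2Z bop)"
abbreviation "L \<equiv> left_mult N \<Lambda>"
abbreviation "\<Omega> \<equiv> single 0 (\<Lambda> 1)"
abbreviation "M \<equiv> crossed_product N \<theta> \<Lambda>"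

lemmas closed = von_neumann_algebra_closed[OF N]
lemmas coord_rep = coord_cp_rep[OF N tr \<theta> tp L2]
lemmas left_mult = left_mult_\<Lambda>[OF N tr \<theta> tp L2]
lemmas monomial_vacuum = cp_rep_upower_vacuum[OF N tr \<theta> tp L2]

section \<open>The action and the trace on the coefficient algebra\<close>

lemma \<alpha>_automorphism: "automorphism N (\<alpha> n)"
  by (rule automorphism_autpow[OF N \<theta>])

lemma \<alpha>_in: "x \<in> N \<Longrightarrow> \<alpha> n x \<in> N"
  by (rule automorphism_in[OF \<alpha>_automorphism])

lemma \<alpha>_mult: "x \<in> N \<Longrightarrow> y \<in> N \<Longrightarrow> \<alpha> n (x * y) = \<alpha> n x * \<alpha> n y"
  and \<alpha>_adj: "x \<in> N \<Longrightarrow> \<alpha> n (adj x) = adj (\<alpha> n x)"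
  and \<alpha>_scaleC: "x \<in> N \<Longrightarrow> \<alpha> n (c *\<^sub>C x) = c *\<^sub>C \<alpha> n x"
  using \<alpha>_automorphism[of n] by (auto simp: automorphism_def clinear_on_def)

lemma tr_\<alpha>: "x \<in> N \<Longrightarrow> tr (\<alpha> n x) = tr x"
  using trace_preserving_autpow[OF N \<theta> tp, of n] unfolding trace_preserving_def by blast

lemma tr_commute: "x \<in> N \<Longrightarrow> y \<in> N \<Longrightarrow> tr (x * y) = tr (y * x)"
  using tr unfolding faithful_normal_trace_def by blast

lemma tr_one: "tr 1 = 1"
  using tr unfolding faithful_normal_trace_def by blast

lemma \<alpha>_zero: "\<alpha> 0 x = x"
  by (simp add: autpow_def)

text \<open>Unitality comes from surjectivity: a preimage of \<open>1\<close> makes the image of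
  \<open>1\<close> a left unit for \<open>1\<close>.\<close>

lemma \<alpha>_one: "\<alpha> n 1 = 1"
proof -
  obtain y where y: "y \<in> N" "\<alpha> n y = 1"
    using \<alpha>_automorphism[of n] closed(1) unfolding automorphism_def bij_betw_def by (metis imageE)
  have "\<alpha> n 1 * \<alpha> n y = \<alpha> n y" using \<alpha>_mult[OF closed(1) y(1), of n] by simp
  then show ?thesis using y(2) by simp
qed

lemma \<alpha>_funpow: "x \<in> N \<Longrightarrow> \<alpha> k ((\<theta> ^^ n) x) = \<alpha> (k + int n) x"
proof (induction n arbitrary: k)
  case (Suc n)
  have "(\<theta> ^^ n) x \<in> N" by (rule automorphism_in[OF automorphism_funpow[OF \<theta>] Suc.prems])
  then show ?case using autpow_shift[OF \<theta>, of _ k] Suc.IH[OF Suc.prems, of "k + 1"] by (simp add: add_ac)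
qed simp

lemma \<alpha>_\<alpha>: assumes x: "x \<in> N" shows "\<alpha> k (\<alpha> n x) = \<alpha> (k + n) x"
proof (cases "n \<ge> 0")
  case True
  then show ?thesis using \<alpha>_funpow[OF x, of k "nat n"] by (simp add: autpow_def)
next
  case False
  define j where "j = nat (- n)"
  have j: "n = - int j" using False by (simp add: j_def)
  let ?i = "inv_into N \<theta>"
  have "(\<theta> ^^ j) ((?i ^^ j) y) = y" if "y \<in> N" for y
    using that
  proof (induction j arbitrary: y)
    case (Suc j)
    have i: "?i y \<in> N" "\<theta> (?i y) = y"
      using \<theta> Suc.prems by (auto simp: automorphism_def bij_betw_def f_inv_into_f inv_into_into)
    have "(\<theta> ^^ Suc j) ((?i ^^ Suc j) y) = \<theta> ((\<theta> ^^ j) ((?i ^^ j) (?i y)))"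
      by (simp add: funpow_swap1)
    then show ?case using Suc.IH[OF i(1)] i(2) by simp
  qed simp
  moreover have "\<alpha> n x = (?i ^^ j) x" by (cases "j = 0") (simp_all add: j autpow_def)
  ultimately have "(\<theta> ^^ j) (\<alpha> n x) = x" using x by simp
  \<comment> \<open>The rule for forward powers is applied to \<open>\<alpha> n x\<close> itself,
    from which \<open>j\<close> forward steps lead back to \<open>x\<close>.\<close>
  then show ?thesis using \<alpha>_funpow[OF \<alpha>_in[OF x, of n], of "k + n" j] by (simp add: j)
qed

lemma \<Lambda>_dense: "closure (\<Lambda> ` N) = UNIV"
  using L2 by (simp add: is_L2_def)

lemma \<Lambda>_cinner: "x \<in> N \<Longrightarrow> y \<in> N \<Longrightarrow> cinner (\<Lambda> x) (\<Lambda> y) = tr (adj y * x)"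
  using L2 by (simp add: is_L2_def)

lemma \<Lambda>_scaleC: "x \<in> N \<Longrightarrow> \<Lambda> (c *\<^sub>C x) = c *\<^sub>C \<Lambda> x"
  using L2 by (simp add: is_L2_def clinear_on_def)

lemma norm_\<Lambda>_one: "norm (\<Lambda> 1) = 1"
  using \<Lambda>_cinner[OF closed(1) closed(1)] by (simp add: norm_eq_sqrt_cinner tr_one)

section \<open>The representation and the algebra of monomials\<close>

lemma left_mult_mult: "x \<in> N \<Longrightarrow> y \<in> N \<Longrightarrow> L (x * y) = L x * L y"
  by (rule bop_eq_dense[OF \<Lambda>_dense]) (auto simp: left_mult closed mult.assoc)

lemma left_mult_scaleC: "x \<in> N \<Longrightarrow> L (c *\<^sub>C x) = c *\<^sub>C L x"
  by (rule bop_eq_dense[OF \<Lambda>_dense]) (auto simp: left_mult closed scaleC_mult_left \<Lambda>_scaleC)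

lemma left_mult_one: "L 1 = 1"
  by (rule bop_eq_dense[OF \<Lambda>_dense]) (auto simp: left_mult closed)

lemma left_mult_adj:
  assumes x: "x \<in> N" shows "L (adj x) = adj (L x)"
proof (rule bop_eq_dense[OF \<Lambda>_dense], rule vector_eq_dense[OF \<Lambda>_dense])
  fix \<xi> \<eta> assume "\<xi> \<in> \<Lambda> ` N" "\<eta> \<in> \<Lambda> ` N"
  then obtain y z where "y \<in> N" "z \<in> N" "\<xi> = \<Lambda> y" "\<eta> = \<Lambda> z" by blast
  then show "cinner \<eta> (app (L (adj x)) \<xi>) = cinner \<eta> (app (adj (L x)) \<xi>)"
    using x by (simp add: cinner_adj_right left_mult closed \<Lambda>_cinner adj_mult mult.assoc)
qed

lemma rep_one: "\<pi> 1 = 1"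
  by (rule bop_eqI, rule ell2Z_eqI) (simp add: coord_rep closed \<alpha>_one left_mult_one)

lemma rep_adj:
  assumes x: "x \<in> N" shows "adj (\<pi> x) = \<pi> (adj x)"
  by (rule adj_eqI)
    (simp add: cinner_ell2Z_def coord_rep x closed \<alpha>_adj left_mult_adj \<alpha>_in cinner_adj_right)

lemma monomial_mult:
  "x \<in> N \<Longrightarrow> y \<in> N \<Longrightarrow> (\<pi> x * U n) * (\<pi> y * U m) = \<pi> (x * \<alpha> n y) * U (n + m)"
  by (rule bop_eqI, rule ell2Z_eqI)
    (simp add: coord_rep coord_upower_cp_unitary closed \<alpha>_in \<alpha>_mult \<alpha>_\<alpha> left_mult_mult algebra_simps)

lemma monomial_scaleC: "x \<in> N \<Longrightarrow> c *\<^sub>C (\<pi> x * U n) = \<pi> (c *\<^sub>C x) * U n"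
  by (rule bop_eqI, rule ell2Z_eqI)
    (simp add: coord_rep closed \<alpha>_in \<alpha>_scaleC left_mult_scaleC)

lemma upower_0 [simp]: "U 0 = 1"
  by (simp add: upower_def)

lemma monomial_adj:
  assumes x: "x \<in> N" shows "adj (\<pi> x * U n) = \<pi> (\<alpha> (- n) (adj x)) * U (- n)"
  using monomial_mult[OF closed(1) closed(6)[OF x], of "- n" 0]
  by (simp add: adj_mult adj_upower rep_adj x rep_one)

lemma cp_trace_eq: "cp_trace \<Lambda> = vector_state \<Omega>"
  by (rule ext) (simp add: cp_trace_def vector_state_def)

lemma trace_monomial:
  "x \<in> N \<Longrightarrow> vector_state \<Omega> (\<pi> x * U n) = (if n = 0 then tr x else 0)"
  using cp_trace_monomial[OF N tr \<theta> tp L2] by (simp add: cp_trace_eq)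

text \<open>The linear span of the monomials. Scalars are absorbed into the coefficients, so sums
  are the only further clause, and bilinear claims reduce to monomials by induction.\<close>

inductive_set A0 :: "'l ell2Z bop set" where
  monomial: "x \<in> N \<Longrightarrow> \<pi> x * U n \<in> A0"
| sum: "a \<in> A0 \<Longrightarrow> b \<in> A0 \<Longrightarrow> a + b \<in> A0"

lemma A0_mult:
  assumes "a \<in> A0" "b \<in> A0" shows "a * b \<in> A0"
  using assms(1)
proof induction
  case (monomial x n)
  show ?case using assms(2)
  proof induction
    case (monomial y m)
    then show ?case using \<open>x \<in> N\<close> by (simp only: monomial_mult A0.monomial closed \<alpha>_in)
  next
    case (sum a b)
    then show ?case by (simp only: distrib_left A0.sum)
  qed
next
  case (sum a b)
  then show ?case by (simp only: distrib_right A0.sum)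
qed

lemma A0_scaleC: "a \<in> A0 \<Longrightarrow> c *\<^sub>C a \<in> A0"
  by (induction rule: A0.induct) (simp_all only: monomial_scaleC scaleC_add_right A0.intros closed)

lemma A0_adj: "a \<in> A0 \<Longrightarrow> adj a \<in> A0"
  by (induction rule: A0.induct) (simp_all only: monomial_adj adj_add A0.intros closed \<alpha>_in)

text \<open>Only opposite exponents contribute; then invariance of \<open>tr\<close> under the
  action and its traciality exchange the two coefficients.\<close>

lemma A0_trace:
  assumes "a \<in> A0" "b \<in> A0" shows "vector_state \<Omega> (a * b) = vector_state \<Omega> (b * a)"
  using assms(1)
proof induction
  case (monomial x n)
  show ?case using assms(2)
  proof induction
    case (monomial y m)
    have "tr (x * \<alpha> n y) = tr (y * \<alpha> m x)" if "n + m = 0"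
    proof -
      have m: "m = - n" using that by simp
      have "tr (y * \<alpha> m x) = tr (\<alpha> n (y * \<alpha> m x))"
        using monomial \<open>x \<in> N\<close> by (simp add: tr_\<alpha> closed \<alpha>_in)
      also have "\<dots> = tr (\<alpha> n y * x)"
        using monomial \<open>x \<in> N\<close> by (simp add: \<alpha>_mult \<alpha>_in \<alpha>_\<alpha> m \<alpha>_zero)
      finally show ?thesis using monomial \<open>x \<in> N\<close> by (simp add: tr_commute \<alpha>_in)
    qed
    then show ?case
      using monomial \<open>x \<in> N\<close> by (simp only: monomial_mult trace_monomial closed \<alpha>_in) (simp add: add.commute)
  next
    case (sum a b)
    then show ?case by (simp add: distrib_left distrib_right)
  qed
next
  case (sum a b)
  then show ?case by (simp add: distrib_left distrib_right)
qed

lemma A0_cyclic: "closure ((\<lambda>a. app a \<Omega>) ` A0) = UNIV"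
proof -
  let ?V = "closure ((\<lambda>a. app a \<Omega>) ` A0)"
  have single_\<Lambda>: "single n (\<Lambda> y) \<in> (\<lambda>a. app a \<Omega>) ` A0" if y: "y \<in> N" for n y
    using monomial_vacuum[OF \<alpha>_in[OF y, of n], of n] A0.monomial[OF \<alpha>_in[OF y, of n], of n]
    by (intro image_eqI[of _ _ "\<pi> (\<alpha> n y) * U n"]) (simp_all add: \<alpha>_\<alpha> y \<alpha>_zero)
  have single: "single n \<eta> \<in> ?V" for n \<eta>
    unfolding closure_approachable
  proof (intro allI impI)
    fix e :: real assume "e > 0"
    moreover have "\<eta> \<in> closure (\<Lambda> ` N)" by (simp add: \<Lambda>_dense)
    ultimately obtain y where y: "y \<in> N" "dist (\<Lambda> y) \<eta> < e" unfolding closure_approachable by blast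
    then have "dist (single n (\<Lambda> y)) (single n \<eta>) < e"
      by (simp add: dist_norm single_diff[symmetric] norm_single)
    then show "\<exists>v\<in>(\<lambda>a. app a \<Omega>) ` A0. dist v (single n \<eta>) < e" using single_\<Lambda>[OF y(1)] by blast
  qed
  have add: "v + w \<in> ?V" if v: "v \<in> ?V" and w: "w \<in> ?V" for v w
  proof -
    obtain x where x: "\<And>k. x k \<in> (\<lambda>a. app a \<Omega>) ` A0" "x \<longlonglongrightarrow> v"
      using v unfolding closure_sequential by blast
    obtain y where y: "\<And>k. y k \<in> (\<lambda>a. app a \<Omega>) ` A0" "y \<longlonglongrightarrow> w"
      using w unfolding closure_sequential by blast
    have "x k + y k \<in> (\<lambda>a. app a \<Omega>) ` A0" for k
    proof -
      obtain a b where "a \<in> A0" "b \<in> A0" "x k = app a \<Omega>" "y k = app b \<Omega>" using x(1)[of k] y(1)[of k] by blast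
      then show ?thesis by (intro image_eqI[of _ _ "a + b"]) (simp_all add: A0.sum)
    qed
    then show ?thesis
      using tendsto_add[OF x(2) y(2)] unfolding closure_sequential
      by (intro exI[of _ "\<lambda>k. x k + y k"] conjI allI)
  qed
  have sum: "(\<Sum>n\<in>F. single n (f n)) \<in> ?V" if "finite F" for F :: "int set" and f
    using that
  proof induction
    case empty
    have "single 0 0 = (0 :: 'l ell2Z)" by (rule ell2Z_eqI) (simp add: coord_single)
    then show ?case using single[of 0 0] by simp
  qed (simp add: add single)
  have "\<xi> \<in> ?V" for \<xi>
  proof -
    have "\<xi> \<in> closure ?V"
      unfolding closure_approachable
    proof (intro allI impI)
      fix e :: real assume "e > 0"
      then obtain X where "finite X" "dist (\<Sum>n\<in>X. single n (coord \<xi> n)) \<xi> < e"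
        using has_sum_single[of \<xi>, unfolded has_sum_def tendsto_iff eventually_finite_subsets_at_top,
          THEN spec[of _ e], THEN mp] by auto
      then show "\<exists>v\<in>?V. dist v \<xi> < e" using sum by blast
    qed
    then show ?thesis by simp
  qed
  then show ?thesis by blast
qed

lemma A0_cyclic_tracial: "cyclic_tracial A0 \<Omega>"
  using A0.monomial[OF closed(1), of 0]
  by unfold_locales (simp_all add: rep_one A0.sum A0_mult A0_scaleC A0_adj A0_trace A0_cyclic)

lemma A0_subset: "A0 \<subseteq> M"
proof
  note M = von_neumann_algebra_closed[OF von_neumann_algebra_hull[of "insert cp_unitary (\<pi> ` N)"], folded crossed_product_def]
  have gen: "insert cp_unitary (\<pi> ` N) \<subseteq> M" unfolding crossed_product_def by (rule hull_subset)
  have pow: "v ^ k \<in> M" if "v \<in> M" for v k by (induction k) (simp_all add: M that)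
  have U: "U n \<in> M" for n using gen M(6) pow by (simp add: upower_def)
  fix a assume "a \<in> A0"
  then show "a \<in> M" using gen U by induction (auto intro!: M(3,4))
qed

lemma crossed_product_eq: "M = commutant (commutant A0)"
  unfolding crossed_product_def
proof (rule von_neumann_algebra_hull_eq)
  have "\<pi> 1 * U 1 \<in> A0" by (rule A0.monomial[OF closed(1)])
  moreover have "\<pi> x * U 0 \<in> A0" if "x \<in> N" for x by (rule A0.monomial[OF that])
  ultimately show "insert cp_unitary (\<pi> ` N) \<subseteq> A0" by (auto simp: rep_one upower_def)
  show "A0 \<subseteq> von_neumann_algebra hull insert cp_unitary (\<pi> ` N)"
    using A0_subset by (simp add: crossed_product_def)
  show "adj ` A0 \<subseteq> A0" using A0_adj by blast
qed

sublocale shift_algebra M "\<Lambda> 1"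
proof (intro shift_algebra.intro shift_algebra_axioms.intro)
  show "cyclic_tracial M \<Omega>"
    unfolding crossed_product_eq by (rule cyclic_tracial.cyclic_tracial_bicommutant[OF A0_cyclic_tracial])
  show "norm (\<Lambda> 1) = 1" by (rule norm_\<Lambda>_one)
  show "commutant (commutant M) = M"
    using von_neumann_algebra_hull[of "insert cp_unitary (\<pi> ` N)"]
    by (simp add: von_neumann_algebra_def crossed_product_def)
  show "cp_unitary \<in> M"
    using hull_subset[of "insert cp_unitary (\<pi> ` N)" von_neumann_algebra] by (auto simp: crossed_product_def)
qed

lemma B_eq_hull: "von_neumann_algebra hull {cp_unitary} = B"
  unfolding B_def
proof (rule von_neumann_algebra_hull_eq)
  have u: "cp_unitary \<in> von_neumann_algebra hull {cp_unitary :: 'l ell2Z bop}"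
    using hull_subset[of "{cp_unitary :: 'l ell2Z bop}" von_neumann_algebra] by blast
  then show "{cp_unitary, adj cp_unitary} \<subseteq> von_neumann_algebra hull {cp_unitary :: 'l ell2Z bop}"
    using von_neumann_algebra_closed(6)[OF von_neumann_algebra_hull u] by blast
qed auto

section \<open>Mixing\<close>

lemma monomial_M: "x \<in> N \<Longrightarrow> \<pi> x * U n \<in> M"
  using A0_subset A0.monomial by blast

lemma U_M: "U n \<in> M"
  using upower_B inM by blast

lemma cond_exp_monomial:
  assumes "x \<in> N" shows "E (\<pi> x * U n) = tr x *\<^sub>C U n"
proof (rule cond_exp_B_eqI)
  fix m
  have "cinner (\<Lambda> (\<alpha> (- n) x)) (\<Lambda> 1) = tr x"
    using assms by (simp add: \<Lambda>_cinner closed \<alpha>_in tr_\<alpha>)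
  then show "cinner (coord (app (tr x *\<^sub>C U n) \<Omega>) m) (\<Lambda> 1) = cinner (coord (app (\<pi> x * U n) \<Omega>) m) (\<Lambda> 1)"
    unfolding monomial_vacuum[OF assms]
    by (simp add: coord_upower_cp_unitary coord_single cinner_scaleC_left \<Lambda>_cinner closed tr_one)
qed (simp_all add: assms monomial_M upower_B B_closed)

text \<open>Kept as a vector rather than a norm so that it is additive in both arguments.\<close>

definition defect :: "'l ell2Z bop \<Rightarrow> 'l ell2Z bop \<Rightarrow> int \<Rightarrow> 'l ell2Z" where
  "defect x y n = app (E (x * U n * y) - E x * U n * E y) \<Omega>"

lemma asymptotic_homomorphism_iff:
  "asymptotic_homomorphism M \<tau> B cp_unitary \<longleftrightarrow>
     (\<forall>x\<in>M. \<forall>y\<in>M. (defect x y \<longlongrightarrow> 0) (filtercomap abs at_top))"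
  unfolding asymptotic_homomorphism_def norm2_vector_state defect_def[symmetric] tendsto_norm_zero_iff ..

lemma defect_monomial:
  assumes a: "a \<in> N" and b: "b \<in> N"
  shows "defect (\<pi> a * U k) (\<pi> b * U l) n
     = (tr (a * \<alpha> (k + n) b) - tr a * tr b) *\<^sub>C single (k + n + l) (\<Lambda> 1)"
proof -
  have "\<pi> a * U k * U n * (\<pi> b * U l) = \<pi> (a * \<alpha> (k + n) b) * U (k + n + l)"
    using monomial_mult[OF a b, of "k + n" l] by (simp add: upower_cp_unitary_add mult.assoc)
  moreover have "tr a *\<^sub>C U k * U n * (tr b *\<^sub>C U l) = (tr a * tr b) *\<^sub>C U (k + n + l)"
    by (simp add: scaleC_mult_left scaleC_mult_right scaleC_scaleC upower_cp_unitary_add mult.assoc mult.commute[of "tr b"])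
  ultimately show ?thesis
    using a b
    by (simp only: defect_def cond_exp_monomial closed \<alpha>_in)
      (simp add: app_upower_single scaleC_diff_left)
qed

text \<open>Mixing concerns positive powers only. For negative ones invariance and traciality give
  \<open>tr (a * \<alpha> m b) = tr (b * \<alpha> (- m) a)\<close>, which is mixing with
  \<open>a\<close> and \<open>b\<close> exchanged.\<close>

lemma mixing_two_sided:
  assumes mix: "strongly_mixing N tr \<theta>" and a: "a \<in> N" and b: "b \<in> N"
  shows "((\<lambda>n. tr (a * \<alpha> (k + n) b)) \<longlongrightarrow> tr a * tr b) (filtercomap abs at_top)"
  unfolding tendsto_iff eventually_filtercomap
proof (intro allI impI)
  fix e :: real assume e: "e > 0"
  have ex: "\<exists>K. \<forall>m\<ge>K. dist (tr (x * (\<theta> ^^ m) y)) (tr x * tr y) < e" if "x \<in> N" "y \<in> N" for x y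
    using mix that e unfolding strongly_mixing_def lim_sequentially by blast
  obtain K1 where K1: "\<And>m. m \<ge> K1 \<Longrightarrow> dist (tr (a * (\<theta> ^^ m) b)) (tr a * tr b) < e" using ex[OF a b] by blast
  obtain K2 where K2: "\<And>m. m \<ge> K2 \<Longrightarrow> dist (tr (b * (\<theta> ^^ m) a)) (tr b * tr a) < e" using ex[OF b a] by blast
  \<comment> \<open>The threshold covers both directions; the summand \<open>\<bar>k\<bar>\<close>
    absorbs the shift of the exponent.\<close>
  have "dist (tr (a * \<alpha> (k + n) b)) (tr a * tr b) < e" if n: "\<bar>n\<bar> \<ge> int K1 + int K2 + \<bar>k\<bar>" for n
  proof (cases "k + n \<ge> 0")
    case True
    then have "nat (k + n) \<ge> K1" using n by linarith
    then show ?thesis using K1[of "nat (k + n)"] True by (simp add: autpow_def)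
  next
    case False
    then have m: "nat (- (k + n)) \<ge> K2" using n by linarith
    have "tr (a * \<alpha> (k + n) b) = tr (\<alpha> (- (k + n)) (a * \<alpha> (k + n) b))"
      using a b by (simp add: tr_\<alpha> closed \<alpha>_in)
    also have "\<dots> = tr (b * \<alpha> (- (k + n)) a)"
      using a b by (simp add: \<alpha>_mult \<alpha>_in \<alpha>_\<alpha> \<alpha>_zero tr_commute del: minus_add_distrib)
    also have "\<dots> = tr (b * (\<theta> ^^ nat (- (k + n))) a)" using False by (simp add: autpow_def)
    finally show ?thesis using K2[OF m] by (simp add: mult.commute)
  qed
  then show "\<exists>Q. eventually Q at_top \<and> (\<forall>n. Q \<bar>n\<bar> \<longrightarrow> dist (tr (a * \<alpha> (k + n) b)) (tr a * tr b) < e)"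
    by (intro exI[of _ "\<lambda>m. m \<ge> int K1 + int K2 + \<bar>k\<bar>"]) simp
qed

text \<open>The point is uniformity in \<open>n\<close>: powers of the shift are unitary,
  \<open>E\<close> contracts the 2-norm, and traciality allows either factor to carry the operator
  norm.\<close>

lemma norm_defect_le:
  assumes "x \<in> M" "y \<in> M"
  shows "norm (defect x y n) \<le> (norm x + norm (E x)) * norm (app y \<Omega>)"
    and "norm (defect x y n) \<le> (norm y + norm (E y)) * norm (app x \<Omega>)"
proof -
  have xUy: "x * U n * y \<in> M" using assms by (simp add: mult U_M)
  have tri: "norm (defect x y n) \<le> norm (app (x * U n * y) \<Omega>) + norm (app (E x * U n * E y) \<Omega>)"
    unfolding defect_def app_bop_simps(5)
    using norm_triangle_ineq4[of "app (E (x * U n * y)) \<Omega>" "app (E x * U n * E y) \<Omega>"]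
      norm_cond_exp_vacuum_le[OF xUy] by linarith
  have 1: "norm (app (a * U n * b) \<Omega>) \<le> norm a * norm (app b \<Omega>)" for a b
    using norm_app_le[of a "app (U n) (app b \<Omega>)"] by (simp add: norm_upower_cp_unitary)
  have 2: "norm (app (a * U n * b) \<Omega>) \<le> norm b * norm (app a \<Omega>)" if "a \<in> M" "b \<in> M" for a b
  proof -
    have "norm (U n * b) \<le> norm b"
      by (rule norm_bop_le) (simp_all add: norm_upower_cp_unitary norm_app_le)
    then have "norm (U n * b) * norm (app a \<Omega>) \<le> norm b * norm (app a \<Omega>)" by (rule mult_right_mono) simp
    then show ?thesis
      using norm_mult_vacuum_right[OF that(1) mult[OF U_M that(2)], of n] by (simp add: mult.assoc)
  qed
  have "norm (E x) * norm (app (E y) \<Omega>) \<le> norm (E x) * norm (app y \<Omega>)"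
    by (intro mult_left_mono norm_cond_exp_vacuum_le assms) simp
  then show "norm (defect x y n) \<le> (norm x + norm (E x)) * norm (app y \<Omega>)"
    using tri 1[of x y] 1[of "E x" "E y"] by (simp only: distrib_right)
  have "norm (E y) * norm (app (E x) \<Omega>) \<le> norm (E y) * norm (app x \<Omega>)"
    by (intro mult_left_mono norm_cond_exp_vacuum_le assms) simp
  then show "norm (defect x y n) \<le> (norm y + norm (E y)) * norm (app x \<Omega>)"
    using tri 2[OF assms] 2[OF cond_exp_M[OF assms(1)] cond_exp_M[OF assms(2)]] by (simp only: distrib_right)
qed

lemma defect_add:
  assumes "x \<in> M" "x' \<in> M" "y \<in> M"
  shows "defect (x + x') y = (\<lambda>n. defect x y n + defect x' y n)"
    and "defect y (x + x') = (\<lambda>n. defect y x n + defect y x' n)"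
  using assms
  by (simp_all add: fun_eq_iff defect_def distrib_right distrib_left cond_exp_add mult U_M app_add)

lemma defect_diff:
  assumes "x \<in> M" "x' \<in> M" "y \<in> M"
  shows "defect (x - x') y n = defect x y n - defect x' y n"
    and "defect y (x - x') n = defect y x n - defect y x' n"
  using assms
  by (simp_all add: defect_def left_diff_distrib right_diff_distrib cond_exp_diff mult U_M app_diff)

lemma A0_approx:
  assumes "x \<in> M" "e > 0"
  obtains a where "a \<in> A0" "C * norm (app (x - a) \<Omega>) < e"
proof -
  have "app x \<Omega> \<in> closure ((\<lambda>a. app a \<Omega>) ` A0)" by (simp add: A0_cyclic)
  moreover have "e / (\<bar>C\<bar> + 1) > 0" using assms(2) by simp
  ultimately obtain a where a: "a \<in> A0" "dist (app a \<Omega>) (app x \<Omega>) < e / (\<bar>C\<bar> + 1)"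
    unfolding closure_approachable by blast
  have "C * norm (app (x - a) \<Omega>) \<le> (\<bar>C\<bar> + 1) * norm (app (x - a) \<Omega>)" by (intro mult_right_mono) auto
  also have "\<dots> < e"
    using a(2) by (simp add: dist_norm norm_minus_commute pos_less_divide_eq mult.commute)
  finally show ?thesis using that a(1) by blast
qed

theorem strongly_mixing_imp_asymptotic_homomorphism:
  assumes mix: "strongly_mixing N tr \<theta>"
  shows "asymptotic_homomorphism M \<tau> B cp_unitary"
  unfolding asymptotic_homomorphism_iff
proof (intro ballI)
  let ?F = "filtercomap abs at_top :: int filter"
  note A0_M = subsetD[OF A0_subset]
  have monomials: "(defect (\<pi> a * U k) (\<pi> b * U l) \<longlongrightarrow> 0) ?F" if "a \<in> N" "b \<in> N" for a b k l
  proof (rule tendsto_norm_zero_cancel)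
    have "((\<lambda>n. tr (a * \<alpha> (k + n) b) - tr a * tr b) \<longlongrightarrow> 0) ?F"
      using mixing_two_sided[OF mix that] by (rule LIM_zero)
    then have "((\<lambda>n. norm (tr (a * \<alpha> (k + n) b) - tr a * tr b)) \<longlongrightarrow> 0) ?F"
      by (rule tendsto_norm_zero)
    then show "((\<lambda>n. norm (defect (\<pi> a * U k) (\<pi> b * U l) n)) \<longlongrightarrow> 0) ?F"
      by (simp add: defect_monomial that norm_scaleC norm_single norm_\<Lambda>_one)
  qed
  have 1: "(defect (\<pi> a * U k) y \<longlongrightarrow> 0) ?F" if "a \<in> N" "y \<in> A0" for a k y
    using that(2)
  proof induction
    case (monomial b l)
    then show ?case by (rule monomials[OF that(1)])
  next
    case (sum x y)
    then show ?case
      using tendsto_add[OF sum.IH] by (simp add: defect_add A0_M monomial_M that(1))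
  qed
  have 2: "(defect x y \<longlongrightarrow> 0) ?F" if "x \<in> A0" "y \<in> A0" for x y
    using that(1)
  proof induction
    case (monomial a k)
    then show ?case by (rule 1[OF _ that(2)])
  next
    case (sum x x')
    then show ?case
      using tendsto_add[OF sum.IH] by (simp add: defect_add A0_M that(2))
  qed
  \<comment> \<open>One argument at a time: the approximant is close in 2-norm only and its operator
    norm is not controlled, so the other argument must be fixed beforehand.\<close>
  have 3: "(defect x y \<longlongrightarrow> 0) ?F" if x: "x \<in> A0" and y: "y \<in> M" for x y
  proof (rule tendsto_zero_approx)
    fix e :: real assume "e > 0"
    then obtain a where a: "a \<in> A0" "(norm x + norm (E x)) * norm (app (y - a) \<Omega>) < e"
      using A0_approx[OF y] by blast
    have "norm (defect x y n - defect x a n) < e" for n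
      using norm_defect_le(1)[OF A0_M[OF x] diff[OF y A0_M[OF a(1)]], of n] a x y
      by (simp add: defect_diff A0_M)
    then show "\<exists>g. (g \<longlongrightarrow> 0) ?F \<and> (\<forall>n. norm (defect x y n - g n) < e)" using 2[OF x a(1)] by blast
  qed
  fix x y assume x: "x \<in> M" and y: "y \<in> M"
  show "(defect x y \<longlongrightarrow> 0) ?F"
  proof (rule tendsto_zero_approx)
    fix e :: real assume "e > 0"
    then obtain a where a: "a \<in> A0" "(norm y + norm (E y)) * norm (app (x - a) \<Omega>) < e"
      using A0_approx[OF x] by blast
    have "norm (defect x y n - defect a y n) < e" for n
      using norm_defect_le(2)[OF diff[OF x A0_M[OF a(1)]] y, of n] a x y
      by (simp add: defect_diff A0_M)
    then show "\<exists>g. (g \<longlongrightarrow> 0) ?F \<and> (\<forall>n. norm (defect x y n - g n) < e)" using 3[OF a(1) y] by blast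
  qed
qed

theorem asymptotic_homomorphism_imp_strongly_mixing:
  assumes ah: "asymptotic_homomorphism M \<tau> B cp_unitary"
  shows "strongly_mixing N tr \<theta>"
  unfolding strongly_mixing_def
proof (intro ballI)
  fix x y assume x: "x \<in> N" and y: "y \<in> N"
  \<comment> \<open>Exponent 0 picks out the coefficients themselves; the vector in
    \<open>defect_monomial\<close> is then a unit vector times the correlation of \<open>x\<close>
    and \<open>y\<close>.\<close>
  have "(\<lambda>k. norm (defect (\<pi> x * U 0) (\<pi> y * U 0) (int k))) \<longlonglongrightarrow> 0"
    unfolding defect_def by (rule asymptotic_homomorphism_sequence[OF ah monomial_M[OF x] monomial_M[OF y]])
  then have "(\<lambda>k. tr (x * \<alpha> (int k) y) - tr x * tr y) \<longlonglongrightarrow> 0"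
    unfolding defect_monomial[OF x y] by (simp add: norm_scaleC norm_single norm_\<Lambda>_one tendsto_norm_zero_iff)
  then show "(\<lambda>n. tr (x * (\<theta> ^^ n) y)) \<longlonglongrightarrow> tr x * tr y"
    unfolding LIM_zero_iff by (simp add: autpow_def)
qed

end

theorem lemma3p1:
  fixes N :: "'h::complex_hilbert bop set"
    and tr :: "'h bop \<Rightarrow> complex"
    and \<theta> :: "'h bop \<Rightarrow> 'h bop"
    and \<Lambda> :: "'h bop \<Rightarrow> 'l::complex_hilbert"
    and M B :: "'l ell2Z bop set"
    and u :: "'l ell2Z bop"
    and \<tau> :: "'l ell2Z bop \<Rightarrow> complex"
  assumes "von_neumann_algebra N"
    and "faithful_normal_trace N tr"
    and "automorphism N \<theta>"
    and "trace_preserving N tr \<theta>"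
    and "ergodic N \<theta>"
    and "is_L2 N tr \<Lambda>"
    and "M = crossed_product N \<theta> \<Lambda>"
    and "\<tau> = cp_trace \<Lambda>"
    and "u = cp_unitary"
    and "B = von_neumann_algebra hull {u}"
  shows "(asymptotic_homomorphism M \<tau> B u \<longleftrightarrow> strongly_mixing N tr \<theta>)
    \<and> (strongly_mixing N tr \<theta> \<longrightarrow> strongly_singular M \<tau> B \<and> masa M B)"
proof -
  interpret crossed N tr \<theta> \<Lambda> by unfold_locales fact+
  have iff: "asymptotic_homomorphism (crossed_product N \<theta> \<Lambda>) (cp_trace \<Lambda>) local.B cp_unitary
      \<longleftrightarrow> strongly_mixing N tr \<theta>"
    using strongly_mixing_imp_asymptotic_homomorphism asymptotic_homomorphism_imp_strongly_mixing
    unfolding cp_trace_eq by blast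
  moreover have "strongly_singular (crossed_product N \<theta> \<Lambda>) (cp_trace \<Lambda>) local.B"
      "masa (crossed_product N \<theta> \<Lambda>) local.B" if "strongly_mixing N tr \<theta>"
    using asymptotic_homomorphism_imp_strongly_singular[OF cp_unitary_B unitary_cp_unitary]
      asymptotic_homomorphism_imp_masa[OF cp_unitary_B unitary_cp_unitary abelian_B] iff that
    unfolding cp_trace_eq by blast+
  ultimately show ?thesis unfolding assms(7-10) B_eq_hull by blast
qed

end
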